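(* Let $G$ be a connected and non-complete graph. Then $I_G$ has a generator of degree $2$ (in a minimal homogeneous generating system). In particular, the following statements are equivalent: (a) $I_G$ is generated in a single degree; (b) $I_G$ is generated in degree $2$; (c) $G$ is $K_4$-minor-free.
   Context: $\mathbb{K}$ is a field. All graphs are finite and simple with non-empty vertex set. For a graph $G=(V,E)$ let $S_G=\mathbb{K}[q_{A|B}]$ be the polynomial ring with one variable for each unordered partition $A|B$ of $V$ (i.e. $A\cup B=V$, $A\cap B=\emptyset$, empty parts allowed), standard graded, and $R_G=\mathbb{K}[s_{ij},t_{ij}:\{i,j\}\in E]$. Let $\mathrm{Cut}(A|B)\subseteq E$ be the set of edges with one endpoint in $A$ and the other in $B$. Let $\phi_G\colon S_G\to R_G$ be the $\mathbb{K}$-algebra homomorphism $q_{A|B}\mapsto \prod_{\{i,j\}\in \mathrm{Cut}(A|B)}s_{ij}\prod_{\{i,j\}\in E\setminus \mathrm{Cut}(A|B)}t_{ij}$. The cut ideal is the graded ideal $I_G=\ker\phi_G$. A minor of $G$ is a graph obtained from $G$ by a sequence of edge deletions and edge contractions, where contracting $e=\{u,v\}\in E$ gives the simple graph with vertex set $(V\setminus\{u,v\})\cup\{w\}$, $w$ new, and edge set $\{f\in E: f\cap\{u,v\}=\emptyset\}\cup\{\{w,z\}: z\in V\setminus\{u,v\},\ z \text{ adjacent to } u \text{ or } v\}$. $G$ is $K_4$-minor-free if it has no minor isomorphic to the complete graph $K_4$. *)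

theory Defs
  imports "HOL-Library.Poly_Mapping" "HOL-Algebra.RingHom"
begin

section \<open>Finite simple graphs and minors\<close>

text \<open>A graph is a pair \<open>(V, E)\<close> of a vertex set and a set of two-element subsets of it.\<close>

type_synonym 'v graph = "'v set \<times> 'v set set"

abbreviation verts :: "'v graph \<Rightarrow> 'v set" where "verts G \<equiv> fst G"
abbreviation edges :: "'v graph \<Rightarrow> 'v set set" where "edges G \<equiv> snd G"

definition complete_graph :: "'v set \<Rightarrow> 'v graph" where
  "complete_graph V = (V, {{u, v} | u v. u \<in> V \<and> v \<in> V \<and> u \<noteq> v})"

definition simple_graph :: "'v graph \<Rightarrow> bool" where
  "simple_graph G \<longleftrightarrow>
     finite (verts G) \<and> verts G \<noteq> {} \<and> edges G \<subseteq> edges (complete_graph (verts G))"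

definition connected_graph :: "'v graph \<Rightarrow> bool" where
  "connected_graph G \<longleftrightarrow>
     (\<forall>u \<in> verts G. \<forall>v \<in> verts G. (u, v) \<in> {(x, y). {x, y} \<in> edges G}\<^sup>*)"

definition graph_isomorphic :: "'v graph \<Rightarrow> 'w graph \<Rightarrow> bool" where
  "graph_isomorphic G H \<longleftrightarrow>
     (\<exists>f. bij_betw f (verts G) (verts H) \<and> edges H = (\<lambda>e. f ` e) ` edges G)"

definition delete_edge :: "'v graph \<Rightarrow> 'v set \<Rightarrow> 'v graph" where
  "delete_edge G e = (verts G, edges G - {e})"

text \<open>Contraction of the edge \<open>{u, v}\<close> to the vertex \<open>w\<close>.\<close>

definition contract_edge :: "'v graph \<Rightarrow> 'v \<Rightarrow> 'v \<Rightarrow> 'v \<Rightarrow> 'v graph" where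
  "contract_edge G u v w =
     (insert w (verts G - {u, v}),
      {f \<in> edges G. f \<inter> {u, v} = {}} \<union>
      {{w, z} | z. z \<in> verts G - {u, v} \<and> ({u, z} \<in> edges G \<or> {v, z} \<in> edges G)})"

text \<open>
  The name \<open>w\<close> of the merged vertex only has to avoid the surviving vertices. So
  \<open>u\<close> and \<open>v\<close> may be reused, which changes the result only up to isomorphism;
  demanding \<open>w \<notin> V\<close> would block every contraction when \<open>V\<close> exhausts its type.
\<close>

inductive minor :: "'v graph \<Rightarrow> 'v graph \<Rightarrow> bool" for G where
  refl: "minor G G"
| delete: "minor G H \<Longrightarrow> e \<in> edges H \<Longrightarrow> minor G (delete_edge H e)"
| contract: "minor G H \<Longrightarrow> {u, v} \<in> edges H \<Longrightarrow> w \<notin> verts H - {u, v} \<Longrightarrow>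
    minor G (contract_edge H u v w)"

definition K4_minor_free :: "'v graph \<Rightarrow> bool" where
  "K4_minor_free G \<longleftrightarrow>
     \<not> (\<exists>H. minor G H \<and> graph_isomorphic H (complete_graph {0..<4::nat}))"


section \<open>Polynomial rings\<close>

text \<open>
  Polynomials with coefficients in \<open>'k\<close> and indeterminates in \<open>'x\<close> are elements of the
  monoid algebra over the exponent vectors \<open>'x \<Rightarrow>\<^sub>0 nat\<close>.
\<close>

type_synonym ('x, 'k) mpoly = "('x \<Rightarrow>\<^sub>0 nat) \<Rightarrow>\<^sub>0 'k"

definition Var :: "'x \<Rightarrow> ('x, 'k::zero_neq_one) mpoly" where
  "Var x = Poly_Mapping.single (Poly_Mapping.single x 1) 1"

definition Const :: "'k \<Rightarrow> ('x, 'k::zero) mpoly" where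
  "Const c = Poly_Mapping.single 0 c"

definition vars :: "('x, 'k::zero) mpoly \<Rightarrow> 'x set" where
  "vars p = (\<Union>m \<in> Poly_Mapping.keys p. Poly_Mapping.keys m)"

definition mpoly_ring :: "'x set \<Rightarrow> ('x, 'k::field) mpoly ring" where
  "mpoly_ring X =
     \<lparr>carrier = {p. vars p \<subseteq> X}, mult = (*), one = 1, zero = 0, add = (+)\<rparr>"

definition total_deg :: "('x \<Rightarrow>\<^sub>0 nat) \<Rightarrow> nat" where
  "total_deg m = (\<Sum>x \<in> Poly_Mapping.keys m. Poly_Mapping.lookup m x)"

text \<open>As usual, the zero polynomial is homogeneous of every degree.\<close>

definition homogeneous :: "nat \<Rightarrow> ('x, 'k::zero) mpoly \<Rightarrow> bool" where
  "homogeneous d p \<longleftrightarrow> (\<forall>m \<in> Poly_Mapping.keys p. total_deg m = d)"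

text \<open>The \<open>'k\<close>-algebra homomorphism given by \<open>Var x \<mapsto> f x\<close>.\<close>

definition subst_hom :: "('x \<Rightarrow> ('y, 'k::field) mpoly) \<Rightarrow> ('x, 'k) mpoly \<Rightarrow> ('y, 'k) mpoly" where
  "subst_hom f p =
     (\<Sum>m \<in> Poly_Mapping.keys p. Const (Poly_Mapping.lookup p m) *
        (\<Prod>x \<in> Poly_Mapping.keys m. f x ^ Poly_Mapping.lookup m x))"


section \<open>Homogeneous generating systems\<close>

definition hom_generating ::
    "('x, 'k::field) mpoly ring \<Rightarrow> ('x, 'k) mpoly set \<Rightarrow> ('x, 'k) mpoly set \<Rightarrow> bool" where
  "hom_generating S I F \<longleftrightarrow>
     F \<subseteq> carrier S \<and> (\<forall>f \<in> F. \<exists>d. homogeneous d f) \<and> Idl\<^bsub>S\<^esub> F = I"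

definition min_hom_generating ::
    "('x, 'k::field) mpoly ring \<Rightarrow> ('x, 'k) mpoly set \<Rightarrow> ('x, 'k) mpoly set \<Rightarrow> bool" where
  "min_hom_generating S I F \<longleftrightarrow>
     hom_generating S I F \<and> (\<forall>F'. F' \<subset> F \<longrightarrow> \<not> hom_generating S I F')"

text \<open>
  The number of degree \<open>d\<close> elements is the same in all minimal homogeneous generating
  systems of a graded ideal, so the choice of the system is immaterial. We ask that such a
  system exists and that each one contains a generator of degree \<open>d\<close>.
\<close>

definition has_min_generator_of_degree ::
    "('x, 'k::field) mpoly ring \<Rightarrow> ('x, 'k) mpoly set \<Rightarrow> nat \<Rightarrow> bool" where
  "has_min_generator_of_degree S I d \<longleftrightarrow>
     (\<exists>F. min_hom_generating S I F) \<and>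
     (\<forall>F. min_hom_generating S I F \<longrightarrow> (\<exists>f \<in> F. f \<noteq> 0 \<and> homogeneous d f))"

definition generated_in_degree ::
    "('x, 'k::field) mpoly ring \<Rightarrow> ('x, 'k) mpoly set \<Rightarrow> nat \<Rightarrow> bool" where
  "generated_in_degree S I d \<longleftrightarrow>
     (\<exists>F. hom_generating S I F \<and> (\<forall>f \<in> F. homogeneous d f))"


section \<open>Cut ideals\<close>

text \<open>The unordered partition \<open>A|B\<close> is the set \<open>{A, B}\<close>.\<close>

definition bipartitions :: "'v set \<Rightarrow> 'v set set set" where
  "bipartitions V = {{A, B} | A B. A \<union> B = V \<and> A \<inter> B = {}}"

definition Cut :: "'v graph \<Rightarrow> 'v set set \<Rightarrow> 'v set set" where
  "Cut G P = {e \<in> edges G. \<exists>A B a b. P = {A, B} \<and> a \<in> A \<and> b \<in> B \<and> e = {a, b}}"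

text \<open>The variables \<open>s\<close> and \<open>t\<close> attached to an edge.\<close>

datatype 'e edge_var = s_var 'e | t_var 'e

definition S_ring :: "'v graph \<Rightarrow> ('v set set, 'k::field) mpoly ring" where
  "S_ring G = mpoly_ring (bipartitions (verts G))"

definition R_ring :: "'v graph \<Rightarrow> ('v set edge_var, 'k::field) mpoly ring" where
  "R_ring G = mpoly_ring (s_var ` edges G \<union> t_var ` edges G)"

definition cut_hom ::
    "'v graph \<Rightarrow> ('v set set, 'k::field) mpoly \<Rightarrow> ('v set edge_var, 'k) mpoly" where
  "cut_hom G = subst_hom (\<lambda>P.
     (\<Prod>e \<in> Cut G P. Var (s_var e)) * (\<Prod>e \<in> edges G - Cut G P. Var (t_var e)))"

definition cut_ideal :: "'v graph \<Rightarrow> ('v set set, 'k::field) mpoly set" where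
  "cut_ideal G = a_kernel (S_ring G) (R_ring G) (cut_hom G)"

end

theory Submission
  imports Defs Complex_Main
begin

text \<open>
  A monomial of degree \<open>d\<close> is a list of \<open>d\<close> cuts, represented by Boolean rows on the vertices up to
  complement, and the cut ideal is spanned by the differences of monomials with the same number of
  cutting rows at each edge. It is generated by quadrics iff any two such lists are joined by steps that
  alter two rows and keep these numbers.

  If there is no \<open>K\<^sub>4\<close> minor, some vertex \<open>v\<close> has degree at most two, say with neighbours \<open>u\<close> and \<open>w\<close>.
  Call the number of rows that separate \<open>u\<close> from \<open>w\<close> the level. On one level, steps of the graph with \<open>v\<close>
  contracted into \<open>u\<close> lift to the whole graph. If \<open>v\<close> is deleted and the rest is connected, a chain of
  steps there changes the level by at most two at a time, and parity is preserved, so it contains a step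
  from each level to the next; between levels that both lists allow, such a step lifts as well. If
  deleting \<open>v\<close> disconnects the graph, flipping one component in two rows changes the level.

  Conversely, in a connected graph a \<open>K\<^sub>4\<close> minor arises from a map onto four vertices with connected
  fibres. Pulling back the quartic generator of the cut ideal of \<open>K\<^sub>4\<close> gives two lists of cuts, the first
  of which admits no nontrivial step. Finally, two nonadjacent vertices \<open>u\<close>, \<open>v\<close> yield the quadric that
  comes from replacing the cuts of \<open>{}\<close> and \<open>{u, v}\<close> by those of \<open>{u}\<close> and \<open>{v}\<close>.
\<close>

section \<open>Lists of cuts and quadratic steps\<close>

text \<open>Each row separates an even number of the three pairs among \<open>u\<close>,
  \<open>v\<close>, \<open>w\<close>. So the counts at \<open>{u, v}\<close> and
  \<open>{v, w}\<close> fix the parity of the level, and together with \<open>d\<close> and the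
  level they fix how many rows show each pattern on the three vertices. The contracted graph has
  \<open>{u, w}\<close> as an edge, so its steps never change the level; deleting \<open>v\<close>
  frees the level but forgets \<open>v\<close>. Hence both graphs are needed, and the delicate point
  is a step that raises the level while the counts at \<open>v\<close> are prescribed.

  The vertex of degree at most two comes from Dirac's theorem on minimum degree three, strengthened
  by exempting the two ends of one edge, so that induction by contraction can run.

  Minors here never delete vertices. So a minor yields a map defined on all of \<open>V\<close>;
  conversely, connectivity lets branch sets absorb the remaining vertices.

  The quartic is not generated by quadrics because on a complete graph two cuts are determined, as
  an unordered pair, by how many of them separate each pair of vertices.\<close>

definition sep :: "'v set \<Rightarrow> ('v \<Rightarrow> bool) \<Rightarrow> bool" where
  "sep e x \<longleftrightarrow> (\<exists>u \<in> e. \<exists>v \<in> e. x u \<noteq> x v)"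

lemma sep_doubleton [simp]: "sep {u, v} x \<longleftrightarrow> x u \<noteq> x v"
  by (auto simp: sep_def)

lemma sep_cong: "(\<And>z. z \<in> e \<Longrightarrow> x z = y z) \<Longrightarrow> sep e x = sep e y"
  by (auto simp: sep_def)

definition cut_count :: "nat \<Rightarrow> (nat \<Rightarrow> 'v \<Rightarrow> bool) \<Rightarrow> 'v set \<Rightarrow> nat" where
  "cut_count d X e = (\<Sum>k<d. of_bool (sep e (X k)))"

definition same_counts ::
    "'v set set \<Rightarrow> nat \<Rightarrow> (nat \<Rightarrow> 'v \<Rightarrow> bool) \<Rightarrow> (nat \<Rightarrow> 'v \<Rightarrow> bool) \<Rightarrow> bool" where
  "same_counts E d X Y \<longleftrightarrow> (\<forall>e \<in> E. cut_count d X e = cut_count d Y e)"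

text \<open>The indices \<open>i\<close> and \<open>j\<close> may coincide or exceed
  \<open>d\<close>, so a step may also alter one row or none. Rows from \<open>d\<close> on are
  ignored by both conditions.\<close>

definition quad_step ::
    "'v set set \<Rightarrow> nat \<Rightarrow> (nat \<Rightarrow> 'v \<Rightarrow> bool) \<Rightarrow> (nat \<Rightarrow> 'v \<Rightarrow> bool) \<Rightarrow> bool" where
  "quad_step E d X Y \<longleftrightarrow> same_counts E d X Y \<and>
     (\<exists>i j. \<forall>k<d. k \<noteq> i \<longrightarrow> k \<noteq> j \<longrightarrow> X k = Y k)"

abbreviation reach ::
    "'v set set \<Rightarrow> nat \<Rightarrow> (nat \<Rightarrow> 'v \<Rightarrow> bool) \<Rightarrow> (nat \<Rightarrow> 'v \<Rightarrow> bool) \<Rightarrow> bool" where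
  "reach E d \<equiv> (quad_step E d)\<^sup>*\<^sup>*"

definition quad_connected :: "'v set set \<Rightarrow> bool" where
  "quad_connected E \<longleftrightarrow> (\<forall>d X Y. same_counts E d X Y \<longrightarrow> reach E d X Y)"

lemma same_counts_refl [simp]: "same_counts E d X X"
  by (simp add: same_counts_def)

lemma same_counts_sym: "same_counts E d X Y \<Longrightarrow> same_counts E d Y X"
  by (simp add: same_counts_def)

lemma same_counts_trans: "same_counts E d X Y \<Longrightarrow> same_counts E d Y Z \<Longrightarrow> same_counts E d X Z"
  by (simp add: same_counts_def)

lemma reach_same_counts: "reach E d X Y \<Longrightarrow> same_counts E d X Y"
  by (induction rule: rtranclp_induct) (auto simp: quad_step_def intro: same_counts_trans)

lemma cut_count_cong: "(\<And>k. k < d \<Longrightarrow> sep e (X k) = sep e (Y k)) \<Longrightarrow> cut_count d X e = cut_count d Y e"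
  by (simp add: cut_count_def)

lemma sum_two_indices:
  fixes f :: "nat \<Rightarrow> 'a::comm_monoid_add"
  assumes "i < d" "j < d" "i \<noteq> j"
  shows "(\<Sum>k<d. f k) = f i + f j + (\<Sum>k\<in>{..<d} - {i, j}. f k)"
proof -
  have "(\<Sum>k<d. f k) = (\<Sum>k\<in>{..<d} - {i, j}. f k) + (\<Sum>k\<in>{i, j}. f k)"
    using assms by (intro sum.subset_diff) auto
  then show ?thesis using assms by (simp add: add.commute)
qed

lemma cut_count_two_rows:
  assumes "i < d" "j < d" "i \<noteq> j" and "\<And>k. k < d \<Longrightarrow> k \<noteq> i \<Longrightarrow> k \<noteq> j \<Longrightarrow> sep e (X k) = sep e (Y k)"
  shows "int (cut_count d Y e) - int (cut_count d X e) =
    of_bool (sep e (Y i)) + of_bool (sep e (Y j)) - of_bool (sep e (X i)) - of_bool (sep e (X j))"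
proof -
  have "(\<Sum>k\<in>{..<d} - {i, j}. of_bool (sep e (X k)) :: nat) =
    (\<Sum>k\<in>{..<d} - {i, j}. of_bool (sep e (Y k)))"
    using assms(4) by (intro sum.cong) auto
  then show ?thesis
    unfolding cut_count_def sum_two_indices[OF assms(1-3)] by simp
qed

lemma cut_count_one_row:
  assumes "i < d" and "\<And>k. k < d \<Longrightarrow> k \<noteq> i \<Longrightarrow> sep e (X k) = sep e (Y k)"
  shows "int (cut_count d Y e) - int (cut_count d X e) = of_bool (sep e (Y i)) - of_bool (sep e (X i))"
proof -
  have "(\<Sum>k\<in>{..<d} - {i}. of_bool (sep e (X k)) :: nat) =
    (\<Sum>k\<in>{..<d} - {i}. of_bool (sep e (Y k)))"
    using assms(2) by (intro sum.cong) auto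
  then show ?thesis
    using assms(1) unfolding cut_count_def
    by (simp add: sum.remove[of "{..<d}" i] del: sum_of_bool_eq)
qed

text \<open>The rows are exchanged one at a time; a row that cuts the same edges leaves every count
  unchanged. In particular a row may be replaced by its complement.\<close>

lemma reach_rowwise:
  assumes "\<And>k e. k < d \<Longrightarrow> e \<in> E \<Longrightarrow> sep e (X k) = sep e (Y k)"
  shows "reach E d X Y"
proof -
  have "reach E d X (\<lambda>k. if k < n then Y k else X k)" for n
  proof (induction n)
    case (Suc n)
    have "quad_step E d (\<lambda>k. if k < n then Y k else X k) (\<lambda>k. if k < Suc n then Y k else X k)"
      unfolding quad_step_def same_counts_def
    proof (intro conjI ballI)
      fix e assume "e \<in> E"
      then show "cut_count d (\<lambda>k. if k < n then Y k else X k) e =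
          cut_count d (\<lambda>k. if k < Suc n then Y k else X k) e"
        by (intro cut_count_cong) (simp add: assms)
    qed (auto intro!: exI[of _ n])
    with Suc show ?case by (auto intro: rtranclp.rtrancl_into_rtrancl)
  qed simp
  from this[of d] have "reach E d X (\<lambda>k. if k < d then Y k else X k)" .
  \<comment> \<open>Both lists agree below \<open>d\<close>; this last step adjusts the rows from
    \<open>d\<close> on, since \<open>reach\<close> compares functions on all of
    \<open>nat\<close>.\<close>
  moreover have "quad_step E d (\<lambda>k. if k < d then Y k else X k) Y"
    unfolding quad_step_def same_counts_def by (auto intro!: cut_count_cong)
  ultimately show ?thesis by (auto intro: rtranclp.rtrancl_into_rtrancl)
qed

text \<open>If at most one row below \<open>d\<close> is altered, no second row can compensate, so
  this row must cut the same edges as before. What remains is a genuine exchange between two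
  rows.\<close>

lemma quad_step_cases:
  assumes "quad_step E d X Y"
  obtains (rowwise) "\<And>k e. k < d \<Longrightarrow> e \<in> E \<Longrightarrow> sep e (X k) = sep e (Y k)"
  | (two) i j where "i < d" "j < d" "i \<noteq> j" "\<And>k. k < d \<Longrightarrow> k \<noteq> i \<Longrightarrow> k \<noteq> j \<Longrightarrow> X k = Y k"
proof -
  obtain i j where ij: "\<And>k. k < d \<Longrightarrow> k \<noteq> i \<Longrightarrow> k \<noteq> j \<Longrightarrow> X k = Y k"
    using assms by (auto simp: quad_step_def)
  have counts: "cut_count d X e = cut_count d Y e" if "e \<in> E" for e
    using assms that by (auto simp: quad_step_def same_counts_def)
  show thesis
  proof (cases "i < d \<and> j < d \<and> i \<noteq> j")
    case True
    then show thesis using two ij by blast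
  next
    case False
    then obtain l where l: "\<And>k. k < d \<Longrightarrow> k \<noteq> l \<Longrightarrow> X k = Y k"
      using ij by (metis)
    have "sep e (X k) = sep e (Y k)" if "k < d" "e \<in> E" for k e
    proof (cases "k = l")
      case True
      then show ?thesis
        using cut_count_one_row[of l d e X Y] l counts[OF that(2)] that by auto
    qed (use l that in simp)
    then show thesis by (rule rowwise)
  qed
qed

section \<open>Lifting steps through an ear\<close>

definition agree_off :: "'v \<Rightarrow> nat \<Rightarrow> (nat \<Rightarrow> 'v \<Rightarrow> bool) \<Rightarrow> (nat \<Rightarrow> 'v \<Rightarrow> bool) \<Rightarrow> bool" where
  "agree_off v d X Y \<longleftrightarrow> (\<forall>k<d. \<forall>z. z \<noteq> v \<longrightarrow> X k z = Y k z)"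

text \<open>\<open>EP\<close> adds the path through \<open>u\<close>, \<open>v\<close>, \<open>w\<close> to \<open>E\<close>, and \<open>EB\<close> contracts its first edge. The case \<open>u = w\<close>
  of a pendant edge is allowed: then the extra edge of \<open>EB\<close> is a singleton, which no row separates.\<close>

locale ear =
  fixes E :: "'v set set" and u v w :: 'v
  assumes v_notin: "v \<notin> \<Union>E" and v_ne: "v \<noteq> u" "v \<noteq> w"
begin

definition EP :: "'v set set" where "EP = E \<union> {{u, v}, {v, w}}"

definition EB :: "'v set set" where "EB = insert {u, w} E"

lemma not_v: "e \<in> E \<Longrightarrow> z \<in> e \<Longrightarrow> z \<noteq> v"
  using v_notin by blast

lemma agree_off_sep: "agree_off v d X Y \<Longrightarrow> k < d \<Longrightarrow> e \<in> EB \<Longrightarrow> sep e (X k) = sep e (Y k)"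
  using v_ne not_v by (intro sep_cong) (auto simp: EB_def agree_off_def)

text \<open>Two rows \<open>x\<close>, \<open>y\<close> with values \<open>p\<close>,
  \<open>q\<close> at \<open>v\<close> change their values at \<open>u\<close> and \<open>w\<close>;
  primes mark the new values. As the sum of the two \<open>{u, w}\<close> indicators is kept, either
  both indicators are kept or they trade places. In the first case each row keeps its relation
  between \<open>v\<close> and \<open>u\<close>, in the second the rows trade this relation too; the
  relation to \<open>w\<close> follows.\<close>

lemma lift_bits:
  fixes xu xw yu yw xu' xw' yu' yw' p q :: bool
  assumes "of_bool (xu \<noteq> xw) + of_bool (yu \<noteq> yw) = (of_bool (xu' \<noteq> xw') + of_bool (yu' \<noteq> yw') :: int)"
  shows "\<exists>p' q'. of_bool (xu \<noteq> p) + of_bool (yu \<noteq> q) = (of_bool (xu' \<noteq> p') + of_bool (yu' \<noteq> q') :: int) \<and>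
    of_bool (p \<noteq> xw) + of_bool (q \<noteq> yw) = (of_bool (p' \<noteq> xw') + of_bool (q' \<noteq> yw') :: int)"
proof (cases "(xu \<noteq> xw) = (xu' \<noteq> xw')")
  case True
  then have T: "(yu \<noteq> yw) = (yu' \<noteq> yw')"
    using assms by (cases "xu \<noteq> xw"; cases "yu \<noteq> yw"; cases "yu' \<noteq> yw'") simp_all
  have "(xu' \<noteq> (p \<noteq> (xu \<noteq> xu'))) = (xu \<noteq> p)" "(yu' \<noteq> (q \<noteq> (yu \<noteq> yu'))) = (yu \<noteq> q)"
    "((p \<noteq> (xu \<noteq> xu')) \<noteq> xw') = (p \<noteq> xw)" "((q \<noteq> (yu \<noteq> yu')) \<noteq> yw') = (q \<noteq> yw)"
    using True T by blast+
  then show ?thesis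
    by (intro exI[of _ "p \<noteq> (xu \<noteq> xu')"] exI[of _ "q \<noteq> (yu \<noteq> yu')"]) (simp only:)
next
  case False
  then have T: "(yu \<noteq> yw) = (xu' \<noteq> xw')" "(xu \<noteq> xw) = (yu' \<noteq> yw')"
    using assms
    by (cases "xu \<noteq> xw"; cases "yu \<noteq> yw"; cases "yu' \<noteq> yw'"; cases "xu' \<noteq> xw'"; simp)+
  have "(yu' \<noteq> (p \<noteq> (xu \<noteq> yu'))) = (xu \<noteq> p)" "(xu' \<noteq> (q \<noteq> (yu \<noteq> xu'))) = (yu \<noteq> q)"
    "((p \<noteq> (xu \<noteq> yu')) \<noteq> yw') = (p \<noteq> xw)" "((q \<noteq> (yu \<noteq> xu')) \<noteq> xw') = (q \<noteq> yw)"
    using T by blast+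
  then show ?thesis
    by (intro exI[of _ "q \<noteq> (yu \<noteq> xu')"] exI[of _ "p \<noteq> (xu \<noteq> yu')"]) (simp only: add.commute)
qed

lemma same_counts_two_rows:
  assumes "i < d" "j < d" "i \<noteq> j"
    and "\<And>k. k < d \<Longrightarrow> k \<noteq> i \<Longrightarrow> k \<noteq> j \<Longrightarrow> X k = Y k"
    and "\<And>e. e \<in> A \<Longrightarrow> of_bool (sep e (X i)) + of_bool (sep e (X j)) =
           (of_bool (sep e (Y i)) + of_bool (sep e (Y j)) :: int)"
  shows "quad_step A d X Y"
proof -
  have "cut_count d X e = cut_count d Y e" if "e \<in> A" for e
    using cut_count_two_rows[OF assms(1-3), of e X Y] assms(4) assms(5)[OF that] by auto
  then show ?thesis
    using assms(4) by (auto simp: quad_step_def same_counts_def)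
qed

text \<open>Because \<open>{u, w}\<close> belongs to \<open>EB\<close>, values at \<open>v\<close>
  can be chosen that keep the counts of both edges there. In a rowwise step \<open>v\<close> moves
  along with \<open>u\<close>; otherwise only the two altered rows need new values, which
  \<open>lift_bits\<close> supplies.\<close>

lemma lift_step:
  assumes "quad_step EB d X Y" and X': "agree_off v d X' X"
  shows "\<exists>Y'. agree_off v d Y' Y \<and> reach EP d X' Y'"
  using assms(1)
proof (cases rule: quad_step_cases)
  case rowwise
  define Y' where "Y' = (\<lambda>k. (Y k)(v := (X' k v \<noteq> (X k u \<noteq> Y k u))))"
  have "agree_off v d Y' Y" by (auto simp: Y'_def agree_off_def)
  moreover have "reach EP d X' Y'"
  proof (rule reach_rowwise)
    fix k e assume k: "k < d" and e: "e \<in> EP"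
    have uw: "(X k u \<noteq> X k w) = (Y k u \<noteq> Y k w)"
      using rowwise[OF k, of "{u, w}"] by (simp add: EB_def)
    have X'k: "X' k z = X k z" if "z \<noteq> v" for z
      using X' k that by (auto simp: agree_off_def)
    consider "e \<in> E" | "e = {u, v}" | "e = {v, w}" using e by (auto simp: EP_def)
    then show "sep e (X' k) = sep e (Y' k)"
    proof cases
      case 1
      then have "sep e (X' k) = sep e (X k)" "sep e (Y' k) = sep e (Y k)"
        using not_v X'k by (auto simp: Y'_def intro!: sep_cong)
      then show ?thesis using rowwise[OF k, of e] 1 by (simp add: EB_def)
    qed (use uw v_ne X'k[of u] X'k[of w] in \<open>auto simp: Y'_def\<close>)
  qed
  ultimately show ?thesis by blast
next
  case (two i j)
  have sum2: "of_bool (sep e (X i)) + of_bool (sep e (X j)) =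
           (of_bool (sep e (Y i)) + of_bool (sep e (Y j)) :: int)" if "e \<in> EB" for e
    using cut_count_two_rows[OF two(1-3), of e X Y] two(4) that assms(1)
    by (auto simp: quad_step_def same_counts_def)
  have X'k: "X' k z = X k z" if "z \<noteq> v" "k < d" for k z
    using X' that by (auto simp: agree_off_def)
  obtain p q where
    p: "of_bool (X i u \<noteq> X' i v) + of_bool (X j u \<noteq> X' j v) = (of_bool (Y i u \<noteq> p) + of_bool (Y j u \<noteq> q) :: int)" and
    q: "of_bool (X' i v \<noteq> X i w) + of_bool (X' j v \<noteq> X j w) = (of_bool (p \<noteq> Y i w) + of_bool (q \<noteq> Y j w) :: int)"
    using lift_bits[of "X i u" "X i w" "X j u" "X j w" "Y i u" "Y i w" "Y j u" "Y j w" "X' i v" "X' j v"]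
      sum2[of "{u, w}"] by (auto simp: EB_def)
  define Y' where "Y' = X'(i := (Y i)(v := p), j := (Y j)(v := q))"
  have Y': "agree_off v d Y' Y"
    using two(4) X'k by (auto simp: Y'_def agree_off_def)
  have "quad_step EP d X' Y'"
  proof (rule same_counts_two_rows[OF two(1-3)])
    fix e assume e: "e \<in> EP"
    consider "e \<in> E" | "e = {u, v}" | "e = {v, w}" using e by (auto simp: EP_def)
    then show "of_bool (sep e (X' i)) + of_bool (sep e (X' j)) =
           (of_bool (sep e (Y' i)) + of_bool (sep e (Y' j)) :: int)"
    proof cases
      case 1
      then have eB: "e \<in> EB" by (simp add: EB_def)
      show ?thesis
        using sum2[OF eB] agree_off_sep[OF X' _ eB] agree_off_sep[OF Y' _ eB] two(1,2) by simp
    qed (use p q two v_ne X'k in \<open>auto simp: Y'_def\<close>)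
  qed (simp add: Y'_def)
  with Y' show ?thesis by blast
qed

lemma lift_reach:
  assumes "reach EB d X Y" and "agree_off v d X' X"
  shows "\<exists>Y'. agree_off v d Y' Y \<and> reach EP d X' Y'"
  using assms(1)
proof (induction rule: rtranclp_induct)
  case base
  then show ?case using assms(2) by blast
next
  case (step Y Z)
  then show ?case using lift_step by (meson rtranclp_trans)
qed

section \<open>Patterns of a row on the ear, and moves within one level\<close>

definition rel :: "(nat \<Rightarrow> 'v \<Rightarrow> bool) \<Rightarrow> nat \<Rightarrow> bool" where "rel X k \<longleftrightarrow> X k u \<noteq> X k v"

definition kind :: "(nat \<Rightarrow> 'v \<Rightarrow> bool) \<Rightarrow> nat \<Rightarrow> bool" where "kind X k \<longleftrightarrow> X k u \<noteq> X k w"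

abbreviation level :: "nat \<Rightarrow> (nat \<Rightarrow> 'v \<Rightarrow> bool) \<Rightarrow> nat" where
  "level d X \<equiv> cut_count d X {u, w}"

text \<open>The pair (\<open>kind\<close>, \<open>rel\<close>) is the pattern of a row on
  \<open>u\<close>, \<open>v\<close>, \<open>w\<close> up to complement; \<open>v\<close> and
  \<open>w\<close> are separated exactly if its two components differ. So each of the three pair
  counts is a sum of two of these four numbers.\<close>

definition num :: "nat \<Rightarrow> (nat \<Rightarrow> 'v \<Rightarrow> bool) \<Rightarrow> bool \<Rightarrow> bool \<Rightarrow> nat" where
  "num d X t r = card {k. k < d \<and> kind X k = t \<and> rel X k = r}"

lemma cut_count_card: "cut_count d X e = card {k. k < d \<and> sep e (X k)}"
proof -
  have "{..<d} \<inter> {k. sep e (X k)} = {k. k < d \<and> sep e (X k)}" by auto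
  then show ?thesis by (simp add: cut_count_def)
qed

lemma card_split: "card {k. k < d \<and> P k} = card {k. k < d \<and> P k \<and> Q k} + card {k. k < (d::nat) \<and> P k \<and> \<not> Q k}"
proof -
  have "{k. k < d \<and> P k} = {k. k < d \<and> P k \<and> Q k} \<union> {k. k < d \<and> P k \<and> \<not> Q k}" by auto
  moreover have "card ({k. k < d \<and> P k \<and> Q k} \<union> {k. k < d \<and> P k \<and> \<not> Q k}) =
      card {k. k < d \<and> P k \<and> Q k} + card {k. k < d \<and> P k \<and> \<not> Q k}"
    by (rule card_Un_disjoint) auto
  ultimately show ?thesis by simp
qed

lemma agree_off_level: "agree_off v d X Y \<Longrightarrow> level d X = level d Y"
  by (intro cut_count_cong agree_off_sep) (auto simp: EB_def)

lemma count_uw: "cut_count d X {u, w} = num d X True True + num d X True False"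
proof -
  have "cut_count d X {u, w} = card {k. k < d \<and> (kind X k)}"
    unfolding cut_count_card by (rule arg_cong[of _ _ card]) (auto simp: kind_def rel_def)
  also have "\<dots> = card {k. k < d \<and> (kind X k) \<and> rel X k} + card {k. k < d \<and> (kind X k) \<and> \<not> rel X k}"
    by (rule card_split)
  also have "{k. k < d \<and> (kind X k) \<and> rel X k} = {k. k < d \<and> kind X k = True \<and> rel X k = True}"
    by auto
  also have "{k. k < d \<and> (kind X k) \<and> \<not> rel X k} = {k. k < d \<and> kind X k = True \<and> rel X k = False}"
    by auto
  finally show ?thesis by (simp only: num_def)
qed

lemma count_uv: "cut_count d X {u, v} = num d X True True + num d X False True"
proof -
  have "cut_count d X {u, v} = card {k. k < d \<and> (rel X k)}"
    unfolding cut_count_card by (rule arg_cong[of _ _ card]) (auto simp: kind_def rel_def)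
  also have "\<dots> = card {k. k < d \<and> (rel X k) \<and> kind X k} + card {k. k < d \<and> (rel X k) \<and> \<not> kind X k}"
    by (rule card_split)
  also have "{k. k < d \<and> (rel X k) \<and> kind X k} = {k. k < d \<and> kind X k = True \<and> rel X k = True}"
    by auto
  also have "{k. k < d \<and> (rel X k) \<and> \<not> kind X k} = {k. k < d \<and> kind X k = False \<and> rel X k = True}"
    by auto
  finally show ?thesis by (simp only: num_def)
qed

lemma count_vw: "cut_count d X {v, w} = num d X True False + num d X False True"
proof -
  have "cut_count d X {v, w} = card {k. k < d \<and> (kind X k \<noteq> rel X k)}"
    unfolding cut_count_card by (rule arg_cong[of _ _ card]) (auto simp: kind_def rel_def)
  also have "\<dots> = card {k. k < d \<and> (kind X k \<noteq> rel X k) \<and> kind X k} + card {k. k < d \<and> (kind X k \<noteq> rel X k) \<and> \<not> kind X k}"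
    by (rule card_split)
  also have "{k. k < d \<and> (kind X k \<noteq> rel X k) \<and> kind X k} = {k. k < d \<and> kind X k = True \<and> rel X k = False}"
    by auto
  also have "{k. k < d \<and> (kind X k \<noteq> rel X k) \<and> \<not> kind X k} = {k. k < d \<and> kind X k = False \<and> rel X k = True}"
    by auto
  finally show ?thesis by (simp only: num_def)
qed

lemma num_kind: "card {k. k < d \<and> kind X k = t} = num d X t True + num d X t False"
  using card_split[of d "\<lambda>k. kind X k = t" "rel X"] by (simp add: num_def)

lemma count_total: "d = num d X True True + num d X True False + num d X False True + num d X False False"
  using card_split[of d "\<lambda>_. True" "kind X"] num_kind[of d X True] num_kind[of d X False] by simp

text \<open>Flipping \<open>v\<close> in two rows of equal \<open>kind\<close> and opposite
  \<open>rel\<close> exchanges their patterns, so the sums at the two edges of \<open>v\<close> are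
  kept, and all other edges avoid \<open>v\<close>.\<close>

lemma swap_step:
  assumes "i < d" "j < d" "i \<noteq> j" "kind X i = kind X j" "rel X i \<noteq> rel X j"
  defines "Z \<equiv> X(i := (X i)(v := \<not> X i v), j := (X j)(v := \<not> X j v))"
  shows "quad_step EP d X Z"
proof (rule same_counts_two_rows[OF assms(1-3)])
  fix e assume "e \<in> EP"
  then consider "e \<in> E" | "e = {u, v}" | "e = {v, w}" by (auto simp: EP_def)
  then show "of_bool (sep e (X i)) + of_bool (sep e (X j)) =
      (of_bool (sep e (Z i)) + of_bool (sep e (Z j)) :: int)"
  proof cases
    case 1
    then have "sep e (X k) = sep e (Z k)" for k
      using not_v by (intro sep_cong) (auto simp: Z_def)
    then show ?thesis by simp
  qed (use assms(3-5) v_ne in \<open>auto simp: Z_def rel_def kind_def of_bool_def\<close>)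
qed (simp add: Z_def)

lemma swap_agree: "agree_off v d (X(i := (X i)(v := p), j := (X j)(v := q))) X"
  by (auto simp: agree_off_def)

text \<open>The three pair counts and \<open>d\<close> give four independent linear equations for
  the four numbers \<open>num\<close>.\<close>

lemma same_num:
  assumes "same_counts EP d X Y" "level d X = level d Y"
  shows "num d X t r = num d Y t r"
proof -
  have "cut_count d X {u, v} = cut_count d Y {u, v}" "cut_count d X {v, w} = cut_count d Y {v, w}"
    using assms(1) by (auto simp: same_counts_def EP_def)
  then have "num d X True True = num d Y True True" "num d X True False = num d Y True False"
    "num d X False True = num d Y False True" "num d X False False = num d Y False False"
    using assms(2) count_total[of d X] count_total[of d Y]
    unfolding count_uv count_uw count_vw by linarith+
  then show ?thesis by (cases t; cases r) auto
qed

text \<open>A row that is wrong at \<open>v\<close> is paired with a row of the same kind that is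
  wrong in the opposite direction; one swap repairs both.\<close>

lemma agree_off_reach:
  assumes "same_counts EP d X Y" "agree_off v d X Y"
  shows "reach EP d X Y"
  using assms
proof (induction "card {k. k < d \<and> X k v \<noteq> Y k v}" arbitrary: X rule: less_induct)
  case less
  have off: "X k z = Y k z" if "k < d" "z \<noteq> v" for k z
    using less.prems that by (auto simp: agree_off_def)
  have kind: "kind X k = kind Y k" if "k < d" for k
    using off[OF that] v_ne by (auto simp: kind_def)
  have diff: "X k v \<noteq> Y k v \<longleftrightarrow> rel X k \<noteq> rel Y k" if "k < d" for k
    using off[OF that] v_ne by (auto simp: rel_def)
  show ?case
  proof (cases "\<exists>i<d. X i v \<noteq> Y i v")
    case False
    have "X k = Y k" if "k < d" for k
    proof
      fix z show "X k z = Y k z" using False off that by (cases "z = v") auto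
    qed
    then show ?thesis by (intro reach_rowwise) auto
  next
    case True
    then obtain i where i: "i < d" "X i v \<noteq> Y i v" by blast
    define t where "t = kind X i"
    have "level d X = level d Y"
      using less.prems(2) by (rule agree_off_level)
    with less.prems(1) have num: "num d X t (rel X i) = num d Y t (rel X i)" by (rule same_num)
    \<comment> \<open>Without such a \<open>j\<close>, every row of kind \<open>t\<close> that has
      the value \<open>rel X i\<close> in \<open>Y\<close> would have it in \<open>X\<close> as
      well, while row \<open>i\<close> has it in \<open>X\<close> only; the two counts could not be
      equal.\<close>
    have "\<exists>j<d. kind X j = t \<and> rel X j \<noteq> rel X i \<and> rel Y j = rel X i"
    proof (rule ccontr)
      assume "\<not> ?thesis"
      then have "{k. k < d \<and> kind Y k = t \<and> rel Y k = rel X i} \<subset>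
          {k. k < d \<and> kind X k = t \<and> rel X k = rel X i}"
        using i diff[OF i(1)] kind by (auto simp: t_def)
      then have "num d Y t (rel X i) < num d X t (rel X i)"
        unfolding num_def by (intro psubset_card_mono) auto
      with num show False by simp
    qed
    then obtain j where j: "j < d" "kind X j = t" "rel X j \<noteq> rel X i" "rel Y j = rel X i" by blast
    have ij: "i \<noteq> j" using j by auto
    define Z where "Z = X(i := (X i)(v := \<not> X i v), j := (X j)(v := \<not> X j v))"
    have XZ: "quad_step EP d X Z"
      unfolding Z_def using i j ij by (intro swap_step) (auto simp: t_def)
    have "same_counts EP d Z Y"
      using XZ less.prems(1) by (meson quad_step_def same_counts_sym same_counts_trans)
    moreover have "agree_off v d Z Y"
      using off by (auto simp: agree_off_def Z_def)
    moreover have "{k. k < d \<and> Z k v \<noteq> Y k v} \<subset> {k. k < d \<and> X k v \<noteq> Y k v}"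
      using i j diff[of j] by (auto simp: Z_def)
    then have "card {k. k < d \<and> Z k v \<noteq> Y k v} < card {k. k < d \<and> X k v \<noteq> Y k v}"
      by (intro psubset_card_mono) auto
    ultimately have "reach EP d Z Y" by (intro less.hyps)
    with XZ show ?thesis by (rule converse_rtranclp_into_rtranclp)
  qed
qed

text \<open>Lists on one level have the same counts on \<open>EB\<close>, so they are joined there.
  The lifted chain ends at a list that agrees with \<open>Y\<close> off \<open>v\<close>;
  \<open>agree_off_reach\<close> does the rest once the counts at \<open>v\<close> agree.\<close>

lemma same_level_lift:
  assumes "quad_connected EB" "same_counts E d X Y" "level d X = level d Y"
  shows "\<exists>Y'. agree_off v d Y' Y \<and> reach EP d X Y'"
proof -
  have "same_counts EB d X Y" using assms by (auto simp: same_counts_def EB_def)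
  then have "reach EB d X Y" using assms(1) by (auto simp: quad_connected_def)
  then show ?thesis by (rule lift_reach) (simp add: agree_off_def)
qed

lemma same_level_reach:
  assumes "quad_connected EB" "same_counts EP d X Y" "level d X = level d Y"
  shows "reach EP d X Y"
proof -
  have "same_counts E d X Y" using assms(2) by (auto simp: same_counts_def EP_def)
  from same_level_lift[OF assms(1) this assms(3)] obtain Y' where
    Y': "agree_off v d Y' Y" "reach EP d X Y'" by blast
  have "same_counts EP d Y' Y"
    using reach_same_counts[OF Y'(2)] assms(2) by (meson same_counts_sym same_counts_trans)
  with Y' show ?thesis using agree_off_reach by (meson rtranclp_trans)
qed

end

lemma quad_step_sym: "quad_step E d X Y \<Longrightarrow> quad_step E d Y X"
  by (auto simp: quad_step_def intro: same_counts_sym) metis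

lemma reach_sym: "reach E d X Y \<Longrightarrow> reach E d Y X"
  by (induction rule: rtranclp_induct) (auto intro: quad_step_sym converse_rtranclp_into_rtranclp)

context ear
begin

section \<open>Passing from one level to the next\<close>

lemma counts_EP:
  assumes "same_counts EP d X Y"
  shows "cut_count d X {u, v} = cut_count d Y {u, v}" "cut_count d X {v, w} = cut_count d Y {v, w}"
  using assms by (auto simp: same_counts_def EP_def)

lemma level_parity:
  assumes "same_counts EP d X Y"
  shows "even (level d X) = even (level d Y)"
proof -
  have "even (level d Z + cut_count d Z {u, v} + cut_count d Z {v, w})" for Z
    unfolding count_uv count_uw count_vw by presburger
  from this[of X] this[of Y] show ?thesis
    using counts_EP[OF assms] by (simp add: even_add) argo
qed

text \<open>For fixed counts at \<open>v\<close>, the number of rows with pattern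
  (\<open>False\<close>, \<open>True\<close>) is half the sum of these counts minus half the level,
  and with (\<open>False\<close>, \<open>False\<close>) it is \<open>d\<close> minus half the sum
  minus half the level. Both decrease as the level grows, so both are positive on the lower level.
  These are the rows that an ascent consumes.\<close>

lemma room:
  assumes "same_counts EP d X Y" "level d X < level d Y"
  shows "0 < num d X False r"
proof -
  have "0 < num d X False True" "0 < num d X False False"
    using counts_EP[OF assms(1)] assms(2) count_total[of d X] count_total[of d Y]
    unfolding count_uv count_uw count_vw by linarith+
  then show ?thesis by (cases r) auto
qed

lemma num_pos: "0 < num d X t r \<Longrightarrow> \<exists>k<d. kind X k = t \<and> rel X k = r"
  by (auto simp: num_def card_gt_0_iff)

text \<open>A discrete intermediate value argument: steps of \<open>E\<close> need not preserve the
  level, so a chain to a higher level contains a step across \<open>k\<close>.\<close>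

lemma chain_crossing:
  assumes "reach E d X Y" "level d X \<le> k" "k < level d Y"
  shows "\<exists>Z Z'. reach E d X Z \<and> quad_step E d Z Z' \<and> level d Z \<le> k \<and> k < level d Z'"
  using assms(1,3)
proof (induction rule: rtranclp_induct)
  case base
  then show ?case using assms(2) by simp
next
  case (step Y Z)
  then show ?case by (cases "k < level d Y") (auto simp: not_less)
qed

text \<open>The rows \<open>i\<close> and \<open>j\<close> are about to become separating for
  \<open>u\<close> and \<open>w\<close>, which consumes one row of either \<open>rel\<close>. If
  their \<open>rel\<close> coincides, \<open>j\<close> trades with a third row.\<close>

lemma arrange:
  assumes "i < d" "j < d" "i \<noteq> j" "\<not> kind Z i" "\<not> kind Z j" "\<And>r. 0 < num d Z False r"
  shows "\<exists>Z'. reach EP d Z Z' \<and> agree_off v d Z' Z \<and> rel Z' i \<noteq> rel Z' j"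
proof (cases "rel Z i = rel Z j")
  case True
  obtain l where l: "l < d" "\<not> kind Z l" "rel Z l = (\<not> rel Z j)"
    using num_pos[OF assms(6)] by metis
  then have ne: "j \<noteq> l" "i \<noteq> l" using True by auto
  define Z' where "Z' = Z(j := (Z j)(v := \<not> Z j v), l := (Z l)(v := \<not> Z l v))"
  have "quad_step EP d Z Z'"
    unfolding Z'_def using l ne assms by (intro swap_step) auto
  moreover have "agree_off v d Z' Z" by (simp add: Z'_def swap_agree)
  moreover have "rel Z' i \<noteq> rel Z' j"
    using True ne assms(3) v_ne by (auto simp: rel_def Z'_def)
  ultimately show ?thesis by blast
qed (auto simp: agree_off_def intro!: exI[of _ Z])

text \<open>Some step of the chain in \<open>E\<close> rises above the level of \<open>X\<close>. A
  step moves the level by at most two and parity is fixed, so this step starts on the level of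
  \<open>X\<close>, ends two higher, and makes both altered rows separate \<open>u\<close> from
  \<open>w\<close>. Its start is reached from \<open>X\<close> off \<open>v\<close> by
  \<open>same_level_lift\<close>, and the step itself lifts after \<open>arrange\<close>.\<close>

lemma cross_connected:
  assumes "quad_connected E" "quad_connected EB"
    and parity: "\<And>d X Y. same_counts E d X Y \<Longrightarrow> even (level d X) = even (level d Y)"
    and XY: "same_counts EP d X Y" "level d X < level d Y"
  shows "\<exists>X'. reach EP d X X' \<and> level d X' = level d X + 2"
proof -
  have "same_counts E d X Y" using XY(1) by (auto simp: same_counts_def EP_def)
  then have "reach E d X Y" using assms(1) by (auto simp: quad_connected_def)
  from chain_crossing[OF this order_refl XY(2)] obtain Z Z' where
    Z: "reach E d X Z" "quad_step E d Z Z'" "level d Z \<le> level d X" "level d X < level d Z'" by blast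
  have ev: "even (level d Z) = even (level d X)" "even (level d Z') = even (level d X)"
    using parity reach_same_counts[OF Z(1)] Z(2)
    by (auto simp: quad_step_def)
  show ?thesis
    using Z(2)
  proof (cases rule: quad_step_cases)
    case rowwise
    have "sep {u, w} (Z k) = sep {u, w} (Z' k)" if "k < d" for k
    proof -
      \<comment> \<open>Parity applied to lists of one row: rows that cut the same edges of
        \<open>E\<close> agree on \<open>{u, w}\<close>, so a rowwise step cannot cross.\<close>
      have "same_counts E 1 (\<lambda>_. Z k) (\<lambda>_. Z' k)"
        using rowwise[OF that] by (auto simp: same_counts_def cut_count_def)
      from parity[OF this] show ?thesis by (auto simp: cut_count_def split: if_splits)
    qed
    then have "level d Z = level d Z'" by (rule cut_count_cong)
    then show ?thesis using Z by simp
  next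
    case (two i j)
    have two': "int (cut_count d Z' e) - int (cut_count d Z e) =
        of_bool (sep e (Z' i)) + of_bool (sep e (Z' j)) - of_bool (sep e (Z i)) - of_bool (sep e (Z j))" for e
      using two(4) by (intro cut_count_two_rows two) simp
    have diff: "int (level d Z') - int (level d Z) =
        of_bool (kind Z' i) + of_bool (kind Z' j) - of_bool (kind Z i) - of_bool (kind Z j)"
      using two'[of "{u, w}"] by (simp add: kind_def)
    have "level d Z' \<noteq> level d X + 1" "level d Z + 1 \<noteq> level d X"
      using ev by (metis even_plus_one_iff)+
    then have "int (level d Z') - int (level d Z) \<ge> 2"
      using Z by linarith
    then have knd: "\<not> kind Z i" "\<not> kind Z j" "kind Z' i" "kind Z' j"
      using diff by (auto simp: of_bool_def split: if_splits)
    then have lev: "level d Z' = level d Z + 2" using diff by simp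
    then have levX: "level d Z = level d X"
      using Z \<open>level d Z' \<noteq> level d X + 1\<close> by linarith
    obtain Z1 where Z1: "agree_off v d Z1 Z" "reach EP d X Z1"
      using same_level_lift[OF assms(2) reach_same_counts[OF Z(1)]] levX by auto
    have kindZ1: "kind Z1 k = kind Z k" if "k < d" for k
      using Z1(1) that v_ne by (auto simp: agree_off_def kind_def)
    have "level d Z1 = level d Z"
      using Z1(1) by (rule agree_off_level)
    then have "num d Z1 False r = num d X False r" for r
      using same_num[OF reach_same_counts[OF Z1(2)]] levX by simp
    then have "0 < num d Z1 False r" for r
      using room[OF XY] by simp
    then obtain Z2 where Z2: "reach EP d Z1 Z2" "agree_off v d Z2 Z1" "rel Z2 i \<noteq> rel Z2 j"
      using arrange[OF two(1-3), of Z1] knd kindZ1 two(1,2) by auto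
    have Z2Z: "Z2 k z = Z k z" if "k < d" "z \<noteq> v" for k z
      using Z1(1) Z2(2) that by (auto simp: agree_off_def)
    \<comment> \<open>In \<open>Z2\<close> exactly one of the rows \<open>i\<close>,
      \<open>j\<close> separates \<open>v\<close> from \<open>u\<close>, and the same row separates
      \<open>v\<close> from \<open>w\<close>. Placing \<open>v\<close> with \<open>u\<close> in row
      \<open>i\<close> and with \<open>w\<close> in row \<open>j\<close> again gives one separation
      for each edge.\<close>
    define X' where "X' = Z2(i := (Z' i)(v := Z' i u), j := (Z' j)(v := \<not> Z' j u))"
    have X'Z': "agree_off v d X' Z'"
      using two(4) Z2Z by (auto simp: agree_off_def X'_def)
    have "quad_step EP d Z2 X'"
    proof (rule same_counts_two_rows[OF two(1-3)])
      fix e assume "e \<in> EP"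
      then consider "e \<in> E" | "e = {u, v}" | "e = {v, w}" by (auto simp: EP_def)
      then show "of_bool (sep e (Z2 i)) + of_bool (sep e (Z2 j)) =
          (of_bool (sep e (X' i)) + of_bool (sep e (X' j)) :: int)"
      proof cases
        case 1
        then have eB: "e \<in> EB" by (simp add: EB_def)
        have "agree_off v d Z2 Z" using Z2Z by (simp add: agree_off_def)
        from agree_off_sep[OF this _ eB] agree_off_sep[OF X'Z' _ eB] two(1,2)
        have "sep e (Z2 i) = sep e (Z i)" "sep e (Z2 j) = sep e (Z j)"
          "sep e (X' i) = sep e (Z' i)" "sep e (X' j) = sep e (Z' j)" by auto
        moreover have "cut_count d Z e = cut_count d Z' e"
          using Z(2) 1 by (auto simp: quad_step_def same_counts_def)
        ultimately show ?thesis
          using two'[of e] by simp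
      next
        case 2
        then show ?thesis using Z2(3) two(3) v_ne by (auto simp: rel_def X'_def of_bool_def)
      next
        case 3
        have "Z2 i u = Z2 i w" "Z2 j u = Z2 j w"
          using knd Z2Z two(1,2) v_ne by (auto simp: kind_def)
        moreover have "Z' i u \<noteq> Z' i w" "Z' j u \<noteq> Z' j w" using knd by (auto simp: kind_def)
        ultimately show ?thesis
          using 3 Z2(3) two(3) v_ne by (auto simp: rel_def X'_def of_bool_def)
      qed
    qed (simp add: X'_def)
    then have "reach EP d X X'" using Z1(2) Z2(1)
      by (meson rtranclp.rtrancl_into_rtrancl rtranclp_trans)
    moreover have "level d X' = level d Z'"
      using X'Z' by (rule agree_off_level)
    ultimately show ?thesis using lev levX by auto
  qed
qed

text \<open>Flipping \<open>A\<close>, which no edge of \<open>E\<close> leaves, toggles only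
  \<open>{u, v}\<close> and \<open>{u, w}\<close>. In two rows with \<open>u\<close>,
  \<open>w\<close> unseparated and opposite \<open>rel\<close>, the changes at \<open>{u, v}\<close>
  cancel and the level rises by two.\<close>

lemma cross_disconnected:
  assumes A: "\<And>x y. {x, y} \<in> E \<Longrightarrow> x \<in> A \<longleftrightarrow> y \<in> A" "u \<in> A" "w \<notin> A" "v \<notin> A"
    and E: "\<And>e. e \<in> E \<Longrightarrow> \<exists>x y. e = {x, y}"
    and XY: "same_counts EP d X Y" "level d X < level d Y"
  shows "\<exists>X'. reach EP d X X' \<and> level d X' = level d X + 2"
proof -
  obtain i j where ij: "i < d" "j < d" "\<not> kind X i" "\<not> kind X j" "rel X i" "\<not> rel X j"
    using num_pos[OF room[OF XY]] by metis
  then have ne: "i \<noteq> j" by auto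
  define X' where "X' = X(i := \<lambda>z. X i z \<noteq> (z \<in> A), j := \<lambda>z. X j z \<noteq> (z \<in> A))"
  have "quad_step EP d X X'"
  proof (rule same_counts_two_rows[OF ij(1,2) ne])
    fix e assume "e \<in> EP"
    then consider "e \<in> E" | "e = {u, v}" | "e = {v, w}" by (auto simp: EP_def)
    then show "of_bool (sep e (X i)) + of_bool (sep e (X j)) =
        (of_bool (sep e (X' i)) + of_bool (sep e (X' j)) :: int)"
    proof cases
      case 1
      then obtain x y where e: "e = {x, y}" using E by blast
      then have "sep e (X' k) = sep e (X k)" for k
        using A(1)[of x y] 1 by (auto simp: X'_def)
      then show ?thesis by simp
    qed (use ij ne v_ne A in \<open>auto simp: X'_def rel_def kind_def of_bool_def\<close>)
  qed (simp add: X'_def)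
  moreover have "int (level d X') - int (level d X) = 2"
    using cut_count_two_rows[OF ij(1,2) ne, of "{u, w}" X X'] ij ne A
    by (auto simp: X'_def kind_def)
  ultimately show ?thesis by (intro exI[of _ X']) auto
qed

text \<open>The lower list climbs by two at a time; as the levels have equal parity, it meets the
  upper level exactly. Symmetry of \<open>reach\<close> allows either list to be the lower
  one.\<close>

lemma quad_connected_EP:
  assumes B: "quad_connected EB"
    and cross: "\<And>d X Y. same_counts EP d X Y \<Longrightarrow> level d X < level d Y \<Longrightarrow>
      \<exists>X'. reach EP d X X' \<and> level d X' = level d X + 2"
  shows "quad_connected EP"
proof -
  have up: "reach EP d X Y" if "same_counts EP d X Y" "level d X \<le> level d Y" for d X Y
    using that
  proof (induction "level d Y - level d X" arbitrary: X rule: less_induct)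
    case less
    show ?case
    proof (cases "level d X = level d Y")
      case True
      then show ?thesis using same_level_reach[OF B less.prems(1)] by simp
    next
      case False
      with less.prems have "level d X < level d Y" by simp
      then obtain X' where X': "reach EP d X X'" "level d X' = level d X + 2"
        using cross less.prems by blast
      have "level d Y \<noteq> level d X + 1"
        using level_parity[OF less.prems(1)] by auto
      with \<open>level d X < level d Y\<close> have "level d X' \<le> level d Y" "level d Y - level d X' < level d Y - level d X"
        using X'(2) by linarith+
      moreover have "same_counts EP d X' Y"
        using reach_same_counts[OF X'(1)] less.prems(1) by (meson same_counts_sym same_counts_trans)
      ultimately have "reach EP d X' Y" by (intro less.hyps)
      with X'(1) show ?thesis by simp
    qed
  qed
  show ?thesis
    unfolding quad_connected_def
  proof (intro allI impI)
    fix d X Y assume "same_counts EP d X Y"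
    then show "reach EP d X Y"
      using up[of d X Y] up[of d Y X] reach_sym same_counts_sym by (metis nat_le_linear)
  qed
qed

end

section \<open>Connected sets and models of the complete graph on four vertices\<close>

text \<open>Connectivity of the subgraph induced on \<open>B\<close>, in terms of subsets closed under adjacency.\<close>

definition conn :: "'v set set \<Rightarrow> 'v set \<Rightarrow> bool" where
  "conn E B \<longleftrightarrow>
     (\<forall>S \<subseteq> B. S \<noteq> {} \<longrightarrow> (\<forall>x \<in> S. \<forall>y \<in> B. {x, y} \<in> E \<longrightarrow> y \<in> S) \<longrightarrow> S = B)"

lemma connD:
  assumes "conn E B" "S \<subseteq> B" "s \<in> S" "\<And>x y. x \<in> S \<Longrightarrow> y \<in> B \<Longrightarrow> {x, y} \<in> E \<Longrightarrow> y \<in> S"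
  shows "S = B"
  using assms unfolding conn_def by blast

lemma connI:
  assumes "\<And>S s. S \<subseteq> B \<Longrightarrow> s \<in> S \<Longrightarrow> (\<And>x y. x \<in> S \<Longrightarrow> y \<in> B \<Longrightarrow> {x, y} \<in> E \<Longrightarrow> y \<in> S) \<Longrightarrow> B \<subseteq> S"
  shows "conn E B"
  using assms unfolding conn_def by (metis equals0I subset_antisym)

lemma conn_mono:
  assumes "conn E B" "\<And>x y. x \<in> B \<Longrightarrow> y \<in> B \<Longrightarrow> {x, y} \<in> E \<Longrightarrow> {x, y} \<in> E'"
  shows "conn E' B"
proof (rule connI)
  fix S s assume S: "S \<subseteq> B" "s \<in> S" "\<And>x y. x \<in> S \<Longrightarrow> y \<in> B \<Longrightarrow> {x, y} \<in> E' \<Longrightarrow> y \<in> S"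
  have "S = B" using assms(1) S(1,2) by (rule connD) (use assms(2) S in blast)
  then show "B \<subseteq> S" by simp
qed

lemma conn_singleton [simp]: "conn E {x}"
  by (auto simp: conn_def)

lemma conn_pair: "{x, y} \<in> E \<Longrightarrow> conn E {x, y}"
  by (rule connI) (auto simp: insert_commute)

definition simple :: "'v set \<Rightarrow> 'v set set \<Rightarrow> bool" where
  "simple V E \<longleftrightarrow> (\<forall>e \<in> E. \<exists>x y. e = {x, y} \<and> x \<in> V \<and> y \<in> V \<and> x \<noteq> y)"

lemma simpleD:
  assumes "simple V E" "{x, y} \<in> E"
  shows "x \<in> V" "y \<in> V" "x \<noteq> y"
  using assms unfolding simple_def by (metis doubleton_eq_iff)+

lemma simple_loop [simp]: "simple V E \<Longrightarrow> {x} \<notin> E"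
  using simpleD(3)[of V E x x] by auto

lemma connected_graph_conn:
  assumes "simple V E" "connected_graph (V, E)"
  shows "conn E V"
proof (rule connI, rule subsetI)
  fix S s v assume S: "S \<subseteq> V" "s \<in> S" "\<And>x y. x \<in> S \<Longrightarrow> y \<in> V \<Longrightarrow> {x, y} \<in> E \<Longrightarrow> y \<in> S" and "v \<in> V"
  then have "(s, v) \<in> {(x, y). {x, y} \<in> E}\<^sup>*"
    using assms(2) by (auto simp: connected_graph_def)
  then show "v \<in> S"
    by (induction rule: rtrancl_induct) (use S simpleD[OF assms(1)] in blast)+
qed

lemma simple_graph_simple: "simple_graph (V, E) \<Longrightarrow> simple V E"
  by (auto simp: simple_graph_def complete_graph_def simple_def)

section \<open>Contraction of \<open>c\<close> into \<open>a\<close>, and connected sets\<close>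

definition contr :: "'v \<Rightarrow> 'v \<Rightarrow> 'v set set \<Rightarrow> 'v set set" where
  "contr a c E = {e \<in> E. c \<notin> e} \<union> {{a, z} | z. {c, z} \<in> E \<and> z \<noteq> a}"

lemma contr_iff:
  assumes "simple V E" "a \<noteq> c"
  shows "{x, y} \<in> contr a c E \<longleftrightarrow> x \<noteq> c \<and> y \<noteq> c \<and>
    ({x, y} \<in> E \<or> (x = a \<and> y \<noteq> a \<and> {c, y} \<in> E) \<or> (y = a \<and> x \<noteq> a \<and> {c, x} \<in> E))"
  using assms simple_loop[OF assms(1), of c] unfolding contr_def by (auto simp: doubleton_eq_iff)

lemma simple_contr:
  assumes "simple V E" "{a, c} \<in> E"
  shows "simple (V - {c}) (contr a c E)"
proof -
  have ac: "a \<in> V" "a \<noteq> c" using simpleD[OF assms] by auto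
  show ?thesis
    unfolding simple_def
  proof
    fix e assume "e \<in> contr a c E"
    then consider "e \<in> E" "c \<notin> e" | z where "e = {a, z}" "{c, z} \<in> E" "z \<noteq> a"
      by (auto simp: contr_def)
    then show "\<exists>x y. e = {x, y} \<and> x \<in> V - {c} \<and> y \<in> V - {c} \<and> x \<noteq> y"
    proof cases
      case 1
      then obtain x y where "e = {x, y}" "x \<in> V" "y \<in> V" "x \<noteq> y"
        using assms(1) unfolding simple_def by blast
      with 1 show ?thesis by auto
    next
      case 2
      with ac simpleD[OF assms(1) 2(2)] show ?thesis by auto
    qed
  qed
qed

text \<open>A set closed under adjacency in the contraction becomes closed in \<open>E\<close> when
  \<open>c\<close> is added exactly if \<open>a\<close> belongs to it.\<close>

lemma conn_contr:
  assumes "simple V E" "{a, c} \<in> E" "conn E B" "a \<in> B"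
  shows "conn (contr a c E) (B - {c})"
proof (rule connI)
  have ac: "a \<noteq> c" using simpleD[OF assms(1,2)] by auto
  note iff = contr_iff[OF assms(1) ac]
  fix S s assume S: "S \<subseteq> B - {c}" "s \<in> S"
    "\<And>x y. x \<in> S \<Longrightarrow> y \<in> B - {c} \<Longrightarrow> {x, y} \<in> contr a c E \<Longrightarrow> y \<in> S"
  define S' where "S' = S \<union> (if a \<in> S then {c} \<inter> B else {})"
  have "S' = B" using assms(3)
  proof (rule connD)
    show "S' \<subseteq> B" using S by (auto simp: S'_def)
    show "s \<in> S'" using S by (auto simp: S'_def)
    fix x y assume x: "x \<in> S'" and y: "y \<in> B" and xy: "{x, y} \<in> E"
    show "y \<in> S'"
    proof (cases "y = c")
      case True
      then have "x \<in> S" "x \<noteq> c" using x xy simple_loop[OF assms(1), of c] S(1)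
        by (auto simp: S'_def split: if_splits)
      moreover have "{x, a} \<in> contr a c E" if "x \<noteq> a"
        using that xy True ac \<open>x \<noteq> c\<close> by (simp add: iff insert_commute)
      ultimately have "a \<in> S" using S(3)[of x a] assms(4) ac by blast
      then show ?thesis using True y by (auto simp: S'_def)
    next
      case False
      have "y \<in> S"
      proof (cases "x = c")
        case True
        then have aS: "a \<in> S" using x S(1) by (auto simp: S'_def split: if_splits)
        then show ?thesis using S(3)[OF aS, of y] y False xy True ac by (cases "y = a") (auto simp: iff)
      next
        case xc: False
        then have "x \<in> S" using x by (auto simp: S'_def split: if_splits)
        then show ?thesis using S(3)[of x y] y False xy xc by (auto simp: iff)
      qed
      then show ?thesis by (simp add: S'_def)
    qed
  qed
  then show "B - {c} \<subseteq> S" by (auto simp: S'_def split: if_splits)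
qed

lemma conn_contr_off:
  assumes "conn E B" "c \<notin> B"
  shows "conn (contr a c E) B"
  using assms(1) by (rule conn_mono) (use assms(2) in \<open>auto simp: contr_def\<close>)

text \<open>The edge \<open>{a, c}\<close> forces a closed set to contain both ends or neither, once
  \<open>c\<close> is available; removing \<open>c\<close> leaves a nonempty closed set of the
  contraction.\<close>

lemma conn_uncontr:
  assumes "simple V E" "{a, c} \<in> E" "conn (contr a c E) B" "c \<notin> B"
  shows "conn E (if a \<in> B then insert c B else B)"
proof (rule connI)
  have ac: "a \<noteq> c" using simpleD[OF assms(1,2)] by auto
  note iff = contr_iff[OF assms(1) ac]
  define B' where "B' = (if a \<in> B then insert c B else B)"
  fix S s assume S: "S \<subseteq> (if a \<in> B then insert c B else B)" "s \<in> S"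
    "\<And>x y. x \<in> S \<Longrightarrow> y \<in> (if a \<in> B then insert c B else B) \<Longrightarrow> {x, y} \<in> E \<Longrightarrow> y \<in> S"
  note S = S[folded B'_def]
  have aS: "a \<in> S" if "c \<in> S"
    using S(3)[OF that, of a] S(1) that assms(2,4) by (auto simp: B'_def insert_commute split: if_splits)
  have cS: "c \<in> S" if "a \<in> S"
    using S(3)[OF that, of c] S(1) that assms(2,4) ac by (auto simp: B'_def split: if_splits)
  obtain t where t: "t \<in> S - {c}" using aS S(2) ac by blast
  have "S - {c} = B" using assms(3) _ t
  proof (rule connD)
    show "S - {c} \<subseteq> B" using S(1) by (auto simp: B'_def split: if_splits)
    fix x y assume x: "x \<in> S - {c}" and y: "y \<in> B" and xy: "{x, y} \<in> contr a c E"
    then consider "{x, y} \<in> E" | "x = a" "{c, y} \<in> E" | "y = a" "{x, c} \<in> E"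
      by (auto simp: iff insert_commute)
    moreover have "y \<in> B'" "y \<noteq> c" using y assms(4) by (auto simp: B'_def)
    moreover have "c \<in> B'" if "y = a" using y that by (auto simp: B'_def)
    ultimately have "y \<in> S"
      using x S(3) aS cS by cases auto
    then show "y \<in> S - {c}" using \<open>y \<noteq> c\<close> by simp
  qed
  then show "(if a \<in> B then insert c B else B) \<subseteq> S"
    using cS by auto
qed

definition link :: "'v set set \<Rightarrow> 'v set \<Rightarrow> 'v set \<Rightarrow> bool" where
  "link E P Q \<longleftrightarrow> P \<inter> Q = {} \<and> (\<exists>x \<in> P. \<exists>y \<in> Q. {x, y} \<in> E)"

lemma link_sym: "link E P Q \<Longrightarrow> link E Q P"
  unfolding link_def
proof (elim conjE bexE, intro conjI)
  fix x y assume "x \<in> P" "y \<in> Q" "{x, y} \<in> E"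
  then show "\<exists>x \<in> Q. \<exists>y \<in> P. {x, y} \<in> E"
    by (intro bexI[of _ y] bexI[of _ x]) (simp_all add: insert_commute)
qed auto

text \<open>Branch sets of a \<open>K4\<close> minor. They may leave out vertices of
  \<open>V\<close>, which makes the property monotone.\<close>

definition K4m :: "'v set \<Rightarrow> 'v set set \<Rightarrow> bool" where
  "K4m V E \<longleftrightarrow> (\<exists>B. (\<forall>i<4::nat. B i \<subseteq> V \<and> B i \<noteq> {} \<and> conn E (B i)) \<and>
     (\<forall>i<4. \<forall>j<4. i \<noteq> j \<longrightarrow> link E (B i) (B j)))"

lemma all_less_4: "(\<forall>i<4::nat. P i) \<longleftrightarrow> P 0 \<and> P 1 \<and> P 2 \<and> P 3"
  by (auto simp: numeral_eq_Suc less_Suc_eq)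

lemma K4mI:
  assumes "P \<subseteq> V" "Q \<subseteq> V" "R \<subseteq> V" "T \<subseteq> V" "P \<noteq> {}" "Q \<noteq> {}" "R \<noteq> {}" "T \<noteq> {}"
    "conn E P" "conn E Q" "conn E R" "conn E T"
    "link E P Q" "link E P R" "link E P T" "link E Q R" "link E Q T" "link E R T"
  shows "K4m V E"
  unfolding K4m_def all_less_4
  by (rule exI[of _ "\<lambda>i. if i = 0 then P else if i = 1 then Q else if i = 2 then R else T"])
     (use assms assms(13-18)[THEN link_sym] in simp)

lemma K4m_mono:
  assumes "K4m V E" "V \<subseteq> V'" "E \<subseteq> E'"
  shows "K4m V' E'"
proof -
  have "conn E' B" if "conn E B" for B using that by (rule conn_mono) (use assms(3) in auto)
  moreover have "link E' P Q" if "link E P Q" for P Q using that assms(3) by (auto simp: link_def)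
  moreover obtain B where "\<forall>i<4::nat. B i \<subseteq> V \<and> B i \<noteq> {} \<and> conn E (B i)"
    "\<forall>i<4. \<forall>j<4. i \<noteq> j \<longrightarrow> link E (B i) (B j)"
    using assms(1) unfolding K4m_def by blast
  ultimately show ?thesis
    unfolding K4m_def using assms(2) by (intro exI[of _ B] conjI allI impI; blast)
qed

text \<open>The vertex \<open>c\<close> joins the branch set that contains \<open>a\<close>, if
  there is one. An edge of the contraction at \<open>a\<close> stems from an edge at
  \<open>a\<close> or at \<open>c\<close>, and both vertices now lie in that set.\<close>

lemma K4m_uncontr:
  assumes "simple V E" "{a, c} \<in> E" "K4m (V - {c}) (contr a c E)"
  shows "K4m V E"
proof -
  have ac: "a \<noteq> c" "c \<in> V" using simpleD[OF assms(1,2)] by auto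
  note iff = contr_iff[OF assms(1) ac(1)]
  obtain B where B: "\<And>i. i < (4::nat) \<Longrightarrow> B i \<subseteq> V - {c} \<and> B i \<noteq> {} \<and> conn (contr a c E) (B i)"
    "\<And>i j. i < 4 \<Longrightarrow> j < 4 \<Longrightarrow> i \<noteq> j \<Longrightarrow> link (contr a c E) (B i) (B j)"
    using assms(3) unfolding K4m_def by blast
  define B' where "B' i = (if a \<in> B i then insert c (B i) else B i)" for i
  show ?thesis
    unfolding K4m_def
  proof (intro exI[of _ B'] conjI allI impI)
    fix i :: nat assume i: "i < 4"
    show "B' i \<subseteq> V" "B' i \<noteq> {}" using B(1)[OF i] ac by (auto simp: B'_def)
    show "conn E (B' i)"
      unfolding B'_def using B(1)[OF i] by (intro conn_uncontr[OF assms(1,2)]) auto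
    fix j :: nat assume j: "j < 4" "i \<noteq> j"
    have c: "c \<notin> B i" "c \<notin> B j" using B(1) i j by auto
    have l: "link (contr a c E) (B i) (B j)" using B(2) i j by blast
    then obtain x y where xy: "x \<in> B i" "y \<in> B j" "{x, y} \<in> contr a c E" by (auto simp: link_def)
    from xy(3) consider "{x, y} \<in> E" | "x = a" "{c, y} \<in> E" | "y = a" "{x, c} \<in> E"
      by (auto simp: iff insert_commute)
    then have "\<exists>x \<in> B' i. \<exists>y \<in> B' j. {x, y} \<in> E"
    proof cases
      case 1
      with xy show ?thesis by (intro bexI[of _ x] bexI[of _ y]) (auto simp: B'_def)
    next
      case 2
      with xy show ?thesis by (intro bexI[of _ c] bexI[of _ y]) (auto simp: B'_def)
    next
      case 3
      with xy show ?thesis by (intro bexI[of _ x] bexI[of _ c]) (auto simp: B'_def)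
    qed
    then show "link E (B' i) (B' j)"
      using l c by (auto simp: link_def B'_def)
  qed
qed

section \<open>Vertices of degree at most two\<close>

definition deg :: "'v set set \<Rightarrow> 'v \<Rightarrow> nat" where "deg E x = card {y. {x, y} \<in> E}"

lemma finite_nbrs: "finite V \<Longrightarrow> simple V E \<Longrightarrow> finite {y. {x, y} \<in> E}"
  by (rule finite_subset[of _ V]) (auto dest: simpleD(2))

lemma nbrs_contr:
  assumes "simple V E" "{a, c} \<in> E" "x \<noteq> a" "x \<noteq> c"
  shows "{y. {x, y} \<in> contr a c E} =
    (if {x, c} \<in> E then insert a ({y. {x, y} \<in> E} - {c}) else {y. {x, y} \<in> E})"
proof -
  have "a \<noteq> c" using simpleD[OF assms(1,2)] by auto
  then show ?thesis
    using assms(3,4) by (auto simp: contr_iff[OF assms(1)] insert_commute)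
qed

text \<open>Two neighbours of \<open>x\<close> are merged only if \<open>x\<close> is adjacent to
  both ends; otherwise a neighbour is at most renamed.\<close>

lemma deg_contr:
  assumes "finite V" "simple V E" "{a, c} \<in> E" "x \<noteq> a" "x \<noteq> c"
  shows "deg (contr a c E) x = (if {x, c} \<in> E \<and> {x, a} \<in> E then deg E x - 1 else deg E x)"
proof -
  note fin = finite_nbrs[OF assms(1,2), of x]
  have "a \<noteq> c" using simpleD[OF assms(2,3)] by auto
  show ?thesis
  proof (cases "{x, c} \<in> E")
    case c: True
    then have N: "{y. {x, y} \<in> contr a c E} = insert a ({y. {x, y} \<in> E} - {c})"
      using nbrs_contr[OF assms(2-5)] by simp
    show ?thesis
    proof (cases "{x, a} \<in> E")
      case True
      then have "insert a ({y. {x, y} \<in> E} - {c}) = {y. {x, y} \<in> E} - {c}"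
        using \<open>a \<noteq> c\<close> by auto
      then show ?thesis using N c True by (simp add: deg_def)
    next
      case False
      then have "card (insert a ({y. {x, y} \<in> E} - {c})) = card {y. {x, y} \<in> E}"
        using card_Suc_Diff1[OF fin, of c] fin c by simp
      then show ?thesis using N False by (simp add: deg_def)
    qed
  next
    case False
    then show ?thesis using nbrs_contr[OF assms(2-5)] by (simp add: deg_def)
  qed
qed

text \<open>The edge \<open>{a, b}\<close> marks the two vertices that may have small degree.
  Contracting another vertex preserves this situation.\<close>

definition rooted :: "'v set \<Rightarrow> 'v set set \<Rightarrow> 'v \<Rightarrow> 'v \<Rightarrow> bool" where
  "rooted V E a b \<longleftrightarrow> finite V \<and> simple V E \<and> conn E V \<and> {a, b} \<in> E"

lemma rooted_sym: "rooted V E a b \<Longrightarrow> rooted V E b a"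
  by (simp add: rooted_def insert_commute)

lemma rooted_contr:
  assumes "rooted V E a b" "{p, c} \<in> E" "c \<noteq> a" "c \<noteq> b"
  shows "rooted (V - {c}) (contr p c E) a b"
proof -
  have E: "finite V" "simple V E" "conn E V" "{a, b} \<in> E" using assms by (auto simp: rooted_def)
  have "p \<in> V" "p \<noteq> c" using simpleD[OF E(2) assms(2)] by auto
  then show ?thesis
    using E assms simple_contr[OF E(2) assms(2)] conn_contr[OF E(2) assms(2) E(3)]
    by (simp add: rooted_def contr_iff[OF E(2)])
qed

lemma three_nbrs:
  assumes "deg E y = 3" "{y, a} \<in> E" "{y, c} \<in> E" "a \<noteq> c"
  obtains z where "{x. {y, x} \<in> E} = {a, c, z}" "z \<noteq> a" "z \<noteq> c"
proof -
  have c3: "card {x. {y, x} \<in> E} = 3" using assms(1) by (simp add: deg_def)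
  then have fin: "finite {x. {y, x} \<in> E}" by (metis card.infinite zero_neq_numeral)
  have "card ({x. {y, x} \<in> E} - {a, c}) = 1"
    using c3 assms fin by (subst card_Diff_subset) auto
  then obtain z where "{x. {y, x} \<in> E} - {a, c} = {z}" by (auto simp: card_1_singleton_iff)
  then have "{x. {y, x} \<in> E} = {a, c, z}" "z \<noteq> a" "z \<noteq> c" using assms by auto
  then show thesis by (rule that)
qed

lemma link_edge: "simple V E \<Longrightarrow> {x, y} \<in> E \<Longrightarrow> link E {x} {y}"
  using simpleD(3) by (auto simp: link_def)

lemma K4m_four_vertices:
  assumes "simple V E" "{p, q} \<in> E" "{p, r} \<in> E" "{p, t} \<in> E" "{q, r} \<in> E" "{q, t} \<in> E" "{r, t} \<in> E"
  shows "K4m V E"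
  by (rule K4mI[of "{p}" V "{q}" "{r}" "{t}"])
     (use assms simpleD[OF assms(1)] in \<open>auto simp: link_def\<close>)

lemma card_ge_3: "finite V \<Longrightarrow> {x, y, z} \<subseteq> V \<Longrightarrow> x \<noteq> y \<Longrightarrow> x \<noteq> z \<Longrightarrow> y \<noteq> z \<Longrightarrow> 3 \<le> card V"
  using card_mono[of V "{x, y, z}"] by simp

text \<open>A minimal counterexample to the claim that there is a \<open>K\<^sub>4\<close> model as soon as all vertices off one
  edge \<open>{a, b}\<close> have degree at least three. Contracting an edge at \<open>a\<close> must create a vertex of degree
  two, which pins down the graph near \<open>a\<close>.\<close>

context
  fixes V :: "'v set" and E :: "'v set set"
  assumes IH: "\<And>V' E' a b. card V' < card V \<Longrightarrow> rooted V' E' a b \<Longrightarrow> 3 \<le> card V' \<Longrightarrow>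
      (\<And>x. x \<in> V' - {a, b} \<Longrightarrow> 3 \<le> deg E' x) \<Longrightarrow> K4m (V' :: 'v set) E'"
begin

text \<open>Contracting \<open>c\<close> into \<open>a\<close> gives a smaller instance unless some
  vertex drops below degree three. Such a vertex has degree three, is adjacent to both
  \<open>a\<close> and \<open>c\<close>, and differs from the exempt vertex
  \<open>b\<close>.\<close>

lemma contract_to_root:
  assumes r: "rooted V E a b" and deg: "\<And>x. x \<in> V - {a, b} \<Longrightarrow> 3 \<le> deg E x"
    and c: "{a, c} \<in> E" "c \<noteq> b" and no: "\<not> K4m V E"
  obtains y where "{a, y} \<in> E" "{c, y} \<in> E" "deg E y = 3" "y \<noteq> b"
proof -
  have E: "finite V" "simple V E" "conn E V" "{a, b} \<in> E" using r by (auto simp: rooted_def)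
  have ne: "a \<noteq> b" "c \<noteq> a" and V: "a \<in> V" "b \<in> V" "c \<in> V"
    using simpleD[OF E(2)] E(4) c by blast+
  have "\<exists>y. {a, y} \<in> E \<and> {c, y} \<in> E \<and> deg E y = 3 \<and> y \<noteq> b"
  proof (rule ccontr)
    assume none: "\<not> ?thesis"
    have deg': "3 \<le> deg (contr a c E) x" if "x \<in> V - {c} - {a, b}" for x
    proof -
      have "deg E x \<noteq> 3" if "{x, c} \<in> E" "{x, a} \<in> E"
        using none that \<open>x \<in> V - {c} - {a, b}\<close> by (auto simp: insert_commute)
      moreover have "deg (contr a c E) x = (if {x, c} \<in> E \<and> {x, a} \<in> E then deg E x - 1 else deg E x)"
        using that by (intro deg_contr[OF E(1,2) c(1)]) auto
      moreover have "3 \<le> deg E x" using deg that by simp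
      ultimately show ?thesis by (cases "{x, c} \<in> E \<and> {x, a} \<in> E") auto
    qed
    \<comment> \<open>A neighbour of \<open>c\<close> besides \<open>a\<close> and \<open>b\<close>
      guarantees that three vertices remain after the contraction.\<close>
    have "\<not> {y. {c, y} \<in> E} \<subseteq> {a, b}"
    proof
      assume "{y. {c, y} \<in> E} \<subseteq> {a, b}"
      then have "deg E c \<le> card {a, b}" unfolding deg_def by (intro card_mono) auto
      then show False using deg[of c] V c ne by (auto simp: card_insert_if split: if_splits)
    qed
    then obtain d where d: "{c, d} \<in> E" "d \<noteq> a" "d \<noteq> b" by auto
    then have "d \<in> V - {c}" using simpleD[OF E(2)] by blast
    with V ne c have "3 \<le> card (V - {c})"
      using d E(1) by (intro card_ge_3[of _ a b d]) auto
    moreover have "card (V - {c}) < card V"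
      using V E(1) by (intro psubset_card_mono) auto
    ultimately have "K4m (V - {c}) (contr a c E)"
      using IH[OF _ rooted_contr[OF r c(1) ne(2) c(2)]] deg' by blast
    then show False using K4m_uncontr[OF E(2) c(1)] no by blast
  qed
  then show thesis using that by blast
qed

text \<open>Without a model, \<open>a\<close>, \<open>c\<close>, \<open>y\<close> form a triangle in
  which \<open>c\<close> and \<open>y\<close> have degree three and share a third neighbour
  \<open>z\<close>. Contracting \<open>c\<close> and \<open>y\<close> into \<open>a\<close> then
  amounts to replacing them by an edge from \<open>a\<close> to \<open>z\<close>, so only
  \<open>z\<close> can violate the degree bound.\<close>

lemma K4m_step:
  assumes r: "rooted V E a b" and deg: "\<And>x. x \<in> V - {a, b} \<Longrightarrow> 3 \<le> deg E x"
    and c: "{a, c} \<in> E" "c \<noteq> b"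
  shows "K4m V E"
proof (rule ccontr)
  assume no: "\<not> K4m V E"
  have E: "finite V" "simple V E" "conn E V" "{a, b} \<in> E" using r by (auto simp: rooted_def)
  have inV: "x \<in> V" "y \<in> V" "x \<noteq> y" if "{x, y} \<in> E" for x y
    using simpleD[OF E(2) that] by auto
  obtain y where y: "{a, y} \<in> E" "{c, y} \<in> E" "deg E y = 3" "y \<noteq> b"
    using contract_to_root[OF r deg c no] .
  have ne: "c \<noteq> a" "y \<noteq> a" "y \<noteq> c" "a \<noteq> b" using inV c y E(4) by blast+
  obtain z where z: "{x. {y, x} \<in> E} = {a, c, z}" "z \<noteq> a" "z \<noteq> c"
    using three_nbrs[of E y a c] y ne by (auto simp: insert_commute)
  have yz: "{y, z} \<in> E" using z(1) by auto
  have zy: "z \<noteq> y" using inV[OF yz] by auto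
  \<comment> \<open>Otherwise contract \<open>y\<close> into \<open>c\<close>: then \<open>c\<close>
    trades its neighbour \<open>y\<close> for \<open>z\<close>, and the only common neighbour of
    \<open>c\<close> and \<open>y\<close> is the exempt vertex \<open>a\<close>.\<close>
  have cz: "{c, z} \<in> E"
  proof (rule ccontr)
    assume ncz: "{c, z} \<notin> E"
    let ?E = "contr c y E"
    have less: "card (V - {y}) < card V"
      using inV[OF yz] E(1) by (intro psubset_card_mono) auto
    have c3: "3 \<le> card (V - {y})"
      using inV[OF c(1)] inV[OF E(4)] c ne y E(1) by (intro card_ge_3[of _ a b c]) auto
    have "3 \<le> deg ?E x" if "x \<in> V - {y} - {a, b}" for x
    proof (cases "x = c")
      case True
      have "{x. {c, x} \<in> ?E} = insert z ({x. {c, x} \<in> E} - {y})"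
      proof (rule Set.set_eqI)
        fix x
        have "{c, x} \<in> ?E \<longleftrightarrow> x \<noteq> y \<and> ({c, x} \<in> E \<or> x \<noteq> c \<and> {y, x} \<in> E)"
          using ne by (subst contr_iff[OF E(2)]) auto
        moreover have "{y, x} \<in> E \<longleftrightarrow> x = a \<or> x = c \<or> x = z" using z(1) by auto
        moreover have "{c, a} \<in> E" using c(1) by (simp add: insert_commute)
        ultimately show "x \<in> {x. {c, x} \<in> ?E} \<longleftrightarrow> x \<in> insert z ({x. {c, x} \<in> E} - {y})"
          using z(3) zy by auto
      qed
      moreover have "finite {x. {c, x} \<in> E}" using E by (intro finite_nbrs)
      ultimately have "deg ?E c = deg E c"
        using ncz y(2) card_Suc_Diff1[of "{x. {c, x} \<in> E}" y] by (simp add: deg_def)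
      then show ?thesis using deg[of x] True that by simp
    next
      case False
      have "\<not> ({x, y} \<in> E \<and> {x, c} \<in> E)"
      proof
        assume x: "{x, y} \<in> E \<and> {x, c} \<in> E"
        then have "x \<in> {a, c, z}" using z(1) by (auto simp: insert_commute)
        then show False using x that ncz False by (auto simp: insert_commute)
      qed
      then show ?thesis
        using deg[of x] that False deg_contr[OF E(1,2) y(2), of x] by auto
    qed
    then have "K4m (V - {y}) ?E"
      using IH[OF less rooted_contr[OF r y(2) ne(2) y(4)] c3] by blast
    then show False using K4m_uncontr[OF E(2) y(2)] no by blast
  qed
  have az: "{a, z} \<notin> E"
    using K4m_four_vertices[of V E a c y z] E(2) c y yz cz no by blast
  have zb: "z \<noteq> b" using az E(4) by auto
  have yc: "{y, c} \<in> E" and ya: "{y, a} \<in> E" using y by (auto simp: insert_commute)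
  \<comment> \<open>The argument is repeated with \<open>y\<close> in place of \<open>c\<close>. The
    common neighbour of degree three can only be \<open>c\<close>, because \<open>z\<close> is not
    adjacent to \<open>a\<close>.\<close>
  obtain y2 where y2: "{a, y2} \<in> E" "{y, y2} \<in> E" "deg E y2 = 3"
    using contract_to_root[OF r deg y(1,4) no] .
  then have "y2 \<in> {a, c, z}" using z(1) by auto
  then have degc: "deg E c = 3" using y2 az inV(3)[OF y2(1)] by auto
  obtain z' where z': "{x. {c, x} \<in> E} = {a, y, z'}" "z' \<noteq> a" "z' \<noteq> y"
    using three_nbrs[of E c a y] degc c y ne by (auto simp: insert_commute)
  then have "z' = z" using cz z zy by auto
  with z' have Nc: "{x. {c, x} \<in> E} = {a, y, z}" by simp
  have Nc': "{x, c} \<in> E \<longleftrightarrow> x \<in> {a, y, z}" for x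
    unfolding Nc[symmetric] by (simp add: insert_commute)
  have Ny': "{x, y} \<in> E \<longleftrightarrow> x \<in> {a, c, z}" for x
    unfolding z(1)[symmetric] by (simp add: insert_commute)
  \<comment> \<open>In \<open>E2\<close> the vertex \<open>z\<close> has lost \<open>c\<close> and
    \<open>y\<close> and gained \<open>a\<close>, a net loss of one; the other degrees off
    \<open>a\<close> are unchanged. So the induction hypothesis applies unless \<open>z\<close> has
    degree three.\<close>
  define E1 where "E1 = contr a y E"
  define E2 where "E2 = contr a c E1"
  have r1: "rooted (V - {y}) E1 a b"
    unfolding E1_def using y ne by (intro rooted_contr[OF r]) auto
  have ac1: "{a, c} \<in> E1" using c ne y by (simp add: E1_def contr_iff[OF E(2)])
  have r2: "rooted (V - {y} - {c}) E2 a b"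
    unfolding E2_def using c ne by (intro rooted_contr[OF r1] ac1) auto
  have s1: "simple (V - {y}) E1" and f1: "finite (V - {y})" using r1 by (auto simp: rooted_def)
  have s2: "simple (V - {y} - {c}) E2" and f2: "finite (V - {y} - {c})" using r2 by (auto simp: rooted_def)
  have lift: "K4m V E" if "K4m (V - {y} - {c}) E2"
    using K4m_uncontr[OF s1 ac1] that K4m_uncontr[OF E(2) y(1)] by (simp add: E1_def E2_def)
  have mem2: "{x, x'} \<in> E2 \<longleftrightarrow> {x, x'} \<in> E \<or> (x = z \<and> x' = a)" if "x \<notin> {a, y, c}" "x' \<notin> {y, c}" for x x'
  proof -
    have "{x, x'} \<in> E2 \<longleftrightarrow> {x, x'} \<in> E1 \<or> x' = a \<and> {c, x} \<in> E1"
      using that ne(1) unfolding E2_def by (subst contr_iff[OF s1]) auto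
    also have "{x, x'} \<in> E1 \<longleftrightarrow> {x, x'} \<in> E \<or> x' = a \<and> {y, x} \<in> E"
      using that ne(2) unfolding E1_def by (subst contr_iff[OF E(2)]) auto
    also have "{c, x} \<in> E1 \<longleftrightarrow> {c, x} \<in> E"
      using that ne unfolding E1_def by (subst contr_iff[OF E(2)]) auto
    also have "{y, x} \<in> E \<longleftrightarrow> x = z" using z(1) that by auto
    also have "{c, x} \<in> E \<longleftrightarrow> x = z" using Nc that by auto
    finally show ?thesis by auto
  qed
  have deg2: "deg E2 x = deg E x" if "x \<notin> {a, y, c, z}" for x
  proof -
    have "{x'. {x, x'} \<in> E2} = {x'. {x, x'} \<in> E}"
    proof (intro Collect_cong)
      fix x' show "{x, x'} \<in> E2 \<longleftrightarrow> {x, x'} \<in> E"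
      proof (cases "x' \<in> {y, c}")
        case True
        then show ?thesis
          using that Nc'[of x] Ny'[of x] simpleD(2)[OF s2, of x x'] by blast
      next
        case False
        then show ?thesis using mem2[of x x'] that by simp
      qed
    qed
    then show ?thesis by (simp add: deg_def)
  qed
  have Nz2: "{x'. {z, x'} \<in> E2} = insert a ({x. {z, x} \<in> E} - {c, y})"
  proof (rule Set.set_eqI)
    fix x' show "x' \<in> {x'. {z, x'} \<in> E2} \<longleftrightarrow> x' \<in> insert a ({x. {z, x} \<in> E} - {c, y})"
    proof (cases "x' \<in> {y, c}")
      case True
      then show ?thesis using simpleD(2)[OF s2, of z x'] ne by blast
    next
      case False
      then show ?thesis using mem2[of z x'] z zy by auto
    qed
  qed
  have finz: "finite {x. {z, x} \<in> E}" using E by (intro finite_nbrs)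
  have "card ({x. {z, x} \<in> E} - {c, y}) = deg E z - 2"
    using finz cz yz ne by (subst card_Diff_subset) (auto simp: insert_commute deg_def)
  then have degz2: "deg E2 z = deg E z - 2 + 1"
    using finz az unfolding deg_def Nz2 by (simp add: insert_commute)
  have Vz: "z \<in> V" "a \<in> V" "b \<in> V" using inV yz E(4) by blast+
  have less: "card (V - {y} - {c}) < card V"
    using inV[OF yz] E(1) by (intro psubset_card_mono) auto
  show False
  proof (cases "deg E z = 3")
    case False
    then have "4 \<le> deg E z" using deg[of z] Vz z zb by fastforce
    then have "3 \<le> deg E2 x" if "x \<in> V - {y} - {c} - {a, b}" for x
      using deg2[of x] degz2 deg[of x] that by (cases "x = z") auto
    moreover have "3 \<le> card (V - {y} - {c})"
      using Vz zb ne z zy c y f2 by (intro card_ge_3[of _ a b z]) auto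
    ultimately have "K4m (V - {y} - {c}) E2" using IH[OF less r2] by blast
    then show False using lift no by blast
  next
    case True
    \<comment> \<open>If \<open>a\<close> and the remaining neighbour \<open>t\<close> of
      \<open>z\<close> are adjacent, \<open>{z, t}\<close> serves as fourth branch set beside
      \<open>a\<close>, \<open>c\<close>, \<open>y\<close>. If not, \<open>z\<close> can be
      contracted into \<open>a\<close> too, as no vertex outside the root edge is adjacent to
      both.\<close>
    obtain t where t: "{x. {z, x} \<in> E} = {c, y, t}" "t \<noteq> c" "t \<noteq> y"
      using three_nbrs[of E z c y] True cz yz ne by (auto simp: insert_commute)
    have zt: "{z, t} \<in> E" using t(1) by auto
    have tz: "t \<noteq> z" "t \<in> V" using inV[OF zt] by auto
    have ta: "t \<noteq> a" using zt az by (auto simp: insert_commute)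
    show False
    proof (cases "{a, t} \<in> E")
      case True
      have "c \<noteq> z" "y \<noteq> z" "a \<noteq> z" "a \<noteq> t" "c \<noteq> t" "y \<noteq> t"
        using z zy t ta by auto
      then have "link E {a} {z, t}" "link E {c} {z, t}" "link E {y} {z, t}"
        using True cz yz by (auto simp: link_def)
      moreover have "{a, c, y, z, t} \<subseteq> V" using Vz tz inV(1)[OF yz] inV(1)[OF cz] by auto
      ultimately have "K4m V E"
        using link_edge[OF E(2)] c y conn_pair[OF zt]
        by (intro K4mI[of "{a}" V "{c}" "{y}" "{z, t}"]) auto
      then show False using no by blast
    next
      case False
      have tb: "t \<noteq> b" using False E(4) by auto
      have az2: "{a, z} \<in> E2"
        using mem2[of z a] z zy ne by (simp add: insert_commute)
      define E3 where "E3 = contr a z E2"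
      have r3: "rooted (V - {y} - {c} - {z}) E3 a b"
        unfolding E3_def using z zb by (intro rooted_contr[OF r2 az2]) auto
      have less3: "card (V - {y} - {c} - {z}) < card V"
        using inV[OF yz] E(1) by (intro psubset_card_mono) auto
      have "3 \<le> deg E3 x" if x: "x \<in> V - {y} - {c} - {z} - {a, b}" for x
      proof -
        have "\<not> ({x, z} \<in> E2 \<and> {x, a} \<in> E2)"
        proof
          assume as: "{x, z} \<in> E2 \<and> {x, a} \<in> E2"
          then have "{x, z} \<in> E" "{x, a} \<in> E" using mem2[of x z] mem2[of x a] x z zy ne by auto
          then have "x \<in> {c, y, t}" using t(1) by (auto simp: insert_commute)
          then show False using x \<open>{x, a} \<in> E\<close> False by (auto simp: insert_commute)
        qed
        then show ?thesis
          using deg_contr[OF f2 s2 az2, of x] x deg2[of x] deg[of x] unfolding E3_def by auto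
      qed
      moreover have "3 \<le> card (V - {y} - {c} - {z})"
        using Vz zb ne z zy c y f2 t tz ta tb by (intro card_ge_3[of _ a b t]) auto
      ultimately have "K4m (V - {y} - {c} - {z}) E3" using IH[OF less3 r3] by blast
      then have "K4m (V - {y} - {c}) E2" unfolding E3_def by (rule K4m_uncontr[OF s2 az2])
      then show False using lift no by blast
    qed
  qed
qed

end

text \<open>Dirac's theorem with two exempt vertices. Connectivity and a third vertex give a
  neighbour \<open>c\<close> of \<open>a\<close> or of \<open>b\<close>, and the two roots are
  interchangeable.\<close>

lemma K4m_of_min_degree:
  assumes "rooted V E a b" "3 \<le> card V" "\<And>x. x \<in> V - {a, b} \<Longrightarrow> 3 \<le> deg E x"
  shows "K4m V E"
  using assms
proof (induction "card V" arbitrary: V E a b rule: less_induct)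
  case less
  have E: "finite V" "simple V E" "conn E V" "{a, b} \<in> E"
    using less.prems(1) by (auto simp: rooted_def)
  have "a \<in> V" "b \<in> V" using simpleD[OF E(2,4)] by auto
  have "\<exists>c. c \<notin> {a, b} \<and> ({a, c} \<in> E \<or> {b, c} \<in> E)"
  proof (rule ccontr)
    assume "\<not> ?thesis"
    then have "{a, b} = V"
      using \<open>a \<in> V\<close> \<open>b \<in> V\<close> by (intro connD[OF E(3), of _ a]) auto
    then show False using less.prems(2) card_insert_le_m1[of 2 "{b}" a] by auto
  qed
  then obtain c where c: "c \<noteq> a" "c \<noteq> b" "{a, c} \<in> E \<or> {b, c} \<in> E" by auto
  have deg: "3 \<le> deg E x" if "x \<in> V - {b, a}" for x using less.prems(3) that by auto
  show ?case
    using c(3)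
  proof
    assume ac: "{a, c} \<in> E"
    show ?thesis
      by (rule K4m_step[OF _ less.prems(1,3) ac c(2)]) (rule less.hyps, assumption+)
  next
    assume bc: "{b, c} \<in> E"
    show ?thesis
      by (rule K4m_step[OF _ rooted_sym[OF less.prems(1)] deg bc c(1)]) (rule less.hyps, assumption+)
  qed
qed

text \<open>On more than three vertices any edge may serve as root; on at most three vertices every
  degree is at most two.\<close>

lemma small_degree_vertex:
  assumes "finite V" "simple V E" "conn E V" "\<not> K4m V E" "2 \<le> card V"
  shows "\<exists>v \<in> V. deg E v \<le> 2"
proof (cases "3 < card V")
  case True
  obtain a where a: "a \<in> V" using assms(5) by fastforce
  have "\<exists>b. {a, b} \<in> E"
  proof (rule ccontr)
    assume "\<not> ?thesis"
    then have "{a} = V" using a by (intro connD[OF assms(3), of _ a]) auto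
    then show False using assms(5) by auto
  qed
  then obtain b where "{a, b} \<in> E" by blast
  then show ?thesis
    using K4m_of_min_degree[of V E a b] assms True by (force simp: rooted_def)
next
  case False
  obtain v where v: "v \<in> V" using assms(5) by fastforce
  have "{y. {v, y} \<in> E} \<subseteq> V - {v}" using simpleD[OF assms(2), of v] by auto
  then have "deg E v \<le> card (V - {v})" unfolding deg_def using assms(1) by (intro card_mono) auto
  also have "\<dots> \<le> 2" using False v assms(1) by simp
  finally show ?thesis using v by blast
qed

section \<open>Minors\<close>

lemma conn_Un:
  assumes "conn E P" "conn E Q" "p \<in> P" "q \<in> Q" "{p, q} \<in> E"
  shows "conn E (P \<union> Q)"
proof (rule connI)
  fix S s assume S: "S \<subseteq> P \<union> Q" "s \<in> S" "\<And>x y. x \<in> S \<Longrightarrow> y \<in> P \<union> Q \<Longrightarrow> {x, y} \<in> E \<Longrightarrow> y \<in> S"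
  have P: "P \<subseteq> S" if "t \<in> S" "t \<in> P" for t
  proof -
    have "S \<inter> P = P" using assms(1) by (rule connD[of _ _ _ t]) (use that S(3) in auto)
    then show ?thesis by blast
  qed
  have Q: "Q \<subseteq> S" if "t \<in> S" "t \<in> Q" for t
  proof -
    have "S \<inter> Q = Q" using assms(2) by (rule connD[of _ _ _ t]) (use that S(3) in auto)
    then show ?thesis by blast
  qed
  have "{q, p} \<in> E" using assms(5) by (simp add: insert_commute)
  then have "p \<in> S \<longleftrightarrow> q \<in> S" using S(3) assms(3-5) by blast
  then show "P \<union> Q \<subseteq> S" using P Q S(1,2) assms(3,4) by blast
qed

text \<open>Since no operation deletes a vertex, each vertex of \<open>G\<close> ends up in exactly
  one vertex of \<open>H\<close>, recorded by \<open>f\<close>. The fibres are the branch sets of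
  \<open>H\<close>.\<close>

definition shadow :: "'v graph \<Rightarrow> ('v \<Rightarrow> 'w) \<Rightarrow> 'w graph \<Rightarrow> bool" where
  "shadow G f H \<longleftrightarrow> f ` verts G = verts H \<and>
     (\<forall>h \<in> verts H. conn (edges G) {x \<in> verts G. f x = h}) \<and>
     (\<forall>p q. {p, q} \<in> edges H \<longrightarrow>
        (\<exists>x \<in> verts G. \<exists>y \<in> verts G. f x = p \<and> f y = q \<and> {x, y} \<in> edges G))"

text \<open>Contraction merges two fibres, which stay connected through a lift of the contracted
  edge; deletion only removes requirements.\<close>

lemma minor_shadow:
  assumes "minor G H" "simple (verts G) (edges G)"
  shows "simple (verts H) (edges H) \<and> (\<exists>f. shadow G f H)"
  using assms(1)
proof (induction rule: minor.induct)
  case refl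
  have "{x \<in> verts G. id x = h} = {h}" if "h \<in> verts G" for h using that by auto
  moreover have "\<exists>x \<in> verts G. \<exists>y \<in> verts G. id x = p \<and> id y = q \<and> {x, y} \<in> edges G"
    if "{p, q} \<in> edges G" for p q
    using simpleD[OF assms(2) that] that by auto
  ultimately have "shadow G id G"
    unfolding shadow_def by simp
  then show ?case using assms(2) by blast
next
  case (delete H e)
  then obtain f where "shadow G f H" by blast
  then have "shadow G f (delete_edge H e)" by (auto simp: shadow_def delete_edge_def)
  then show ?case using delete.IH by (auto simp: simple_def delete_edge_def)
next
  case (contract H u v w)
  then obtain f where f: "f ` verts G = verts H"
      "\<And>h. h \<in> verts H \<Longrightarrow> conn (edges G) {x \<in> verts G. f x = h}"
      "\<And>p q. {p, q} \<in> edges H \<Longrightarrow>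
        \<exists>x \<in> verts G. \<exists>y \<in> verts G. f x = p \<and> f y = q \<and> {x, y} \<in> edges G"
    unfolding shadow_def by blast
  have s: "simple (verts H) (edges H)" using contract.IH by blast
  have uv: "u \<in> verts H" "v \<in> verts H" "u \<noteq> v" using simpleD[OF s contract.hyps(2)] by auto
  let ?H = "contract_edge H u v w"
  define f' where "f' x = (if f x \<in> {u, v} then w else f x)" for x
  have H': "verts ?H = insert w (verts H - {u, v})"
    "edges ?H = {f \<in> edges H. f \<inter> {u, v} = {}} \<union>
      {{w, z} | z. z \<in> verts H - {u, v} \<and> ({u, z} \<in> edges H \<or> {v, z} \<in> edges H)}"
    by (auto simp: contract_edge_def)
  have "simple (verts ?H) (edges ?H)"
    unfolding simple_def
  proof
    fix e assume "e \<in> edges ?H"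
    then consider "e \<in> edges H" "e \<inter> {u, v} = {}" | z where "e = {w, z}" "z \<in> verts H - {u, v}"
      unfolding H' by blast
    then show "\<exists>x y. e = {x, y} \<and> x \<in> verts ?H \<and> y \<in> verts ?H \<and> x \<noteq> y"
    proof cases
      case 1
      then obtain x y where "e = {x, y}" "x \<in> verts H" "y \<in> verts H" "x \<noteq> y"
        using s unfolding simple_def by blast
      with 1 show ?thesis unfolding H' by auto
    next
      case 2
      then show ?thesis unfolding H' using contract.hyps(3) by blast
    qed
  qed
  moreover have "shadow G f' ?H"
    unfolding shadow_def
  proof (intro conjI ballI allI impI)
    have "u \<in> f ` verts G" using f(1) uv(1) by simp
    then obtain x where "x \<in> verts G" "f x = u" by blast
    then have "w \<in> f' ` verts G" by (intro image_eqI[of _ _ x]) (simp_all add: f'_def)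
    then show "f' ` verts G = verts ?H"
      unfolding H' f(1)[symmetric] f'_def by auto
  next
    fix h assume h: "h \<in> verts ?H"
    show "conn (edges G) {x \<in> verts G. f' x = h}"
    proof (cases "h = w")
      case True
      have "{x \<in> verts G. f' x = h} = {x \<in> verts G. f x = u} \<union> {x \<in> verts G. f x = v}"
        using True contract.hyps(3) f(1) by (auto simp: f'_def)
      moreover obtain x y where "x \<in> verts G" "y \<in> verts G" "f x = u" "f y = v" "{x, y} \<in> edges G"
        using f(3)[OF contract.hyps(2)] by blast
      ultimately show ?thesis
        using conn_Un[OF f(2)[OF uv(1)] f(2)[OF uv(2)], of x y] by simp
    next
      case False
      then have "h \<in> verts H" "h \<notin> {u, v}" using h H' by auto
      moreover from this have "{x \<in> verts G. f' x = h} = {x \<in> verts G. f x = h}"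
        using False by (auto simp: f'_def)
      ultimately show ?thesis using f(2) by simp
    qed
  next
    fix p q assume pq: "{p, q} \<in> edges ?H"
    have lift: "\<exists>x \<in> verts G. \<exists>y \<in> verts G. f' x = w \<and> f' y = z \<and> {x, y} \<in> edges G"
      if z: "z \<in> verts H - {u, v}" and uvz: "{u, z} \<in> edges H \<or> {v, z} \<in> edges H" for z
    proof -
      obtain t where t: "t \<in> {u, v}" "{t, z} \<in> edges H" using uvz by blast
      obtain x y where "x \<in> verts G" "y \<in> verts G" "f x = t" "f y = z" "{x, y} \<in> edges G"
        using f(3)[OF t(2)] by blast
      with t(1) show ?thesis using z by (intro bexI[of _ x] bexI[of _ y]) (auto simp: f'_def)
    qed
    from pq consider "{p, q} \<in> edges H" "{p, q} \<inter> {u, v} = {}"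
      | z where "{p, q} = {w, z}" "z \<in> verts H - {u, v}" "{u, z} \<in> edges H \<or> {v, z} \<in> edges H"
      unfolding H' by blast
    then show "\<exists>x \<in> verts G. \<exists>y \<in> verts G. f' x = p \<and> f' y = q \<and> {x, y} \<in> edges G"
    proof cases
      case 1
      then obtain x y where "x \<in> verts G" "y \<in> verts G" "f x = p" "f y = q" "{x, y} \<in> edges G"
        using f(3) by blast
      with 1 show ?thesis by (intro bexI[of _ x] bexI[of _ y]) (auto simp: f'_def)
    next
      case 2
      then obtain x y where xy: "x \<in> verts G" "y \<in> verts G" "f' x = w" "f' y = z" "{x, y} \<in> edges G"
        using lift by blast
      then have yx: "{y, x} \<in> edges G" by (simp add: insert_commute)
      from 2(1) have "p = w \<and> q = z \<or> p = z \<and> q = w" by (auto simp: doubleton_eq_iff)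
      with xy yx show ?thesis by blast
    qed
  qed
  ultimately show ?case by blast
qed

lemma edges_complete_iff: "{i, j} \<in> edges (complete_graph A) \<longleftrightarrow> i \<in> A \<and> j \<in> A \<and> i \<noteq> j"
  by (auto simp: complete_graph_def doubleton_eq_iff)

lemma K4_minor_map:
  assumes "simple_graph (V, E)" "\<not> K4_minor_free (V, E)"
  obtains f :: "'v \<Rightarrow> nat" where "f ` V = {0..<4}" "\<And>i. i < 4 \<Longrightarrow> conn E {x \<in> V. f x = i}"
    "\<And>i j. i < 4 \<Longrightarrow> j < 4 \<Longrightarrow> i \<noteq> j \<Longrightarrow> \<exists>x \<in> V. \<exists>y \<in> V. f x = i \<and> f y = j \<and> {x, y} \<in> E"
proof -
  obtain H g where H: "minor (V, E) H" and g: "bij_betw g (verts H) {0..<4::nat}"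
    "edges (complete_graph {0..<4::nat}) = (\<lambda>e. g ` e) ` edges H"
    using assms(2) by (auto simp: K4_minor_free_def graph_isomorphic_def complete_graph_def)
  obtain f where "shadow (V, E) f H" and s: "simple (verts H) (edges H)"
    using minor_shadow[OF H] simple_graph_simple[OF assms(1)] by auto
  then have f: "f ` V = verts H" "\<And>h. h \<in> verts H \<Longrightarrow> conn E {x \<in> V. f x = h}"
      "\<And>p q. {p, q} \<in> edges H \<Longrightarrow> \<exists>x \<in> V. \<exists>y \<in> V. f x = p \<and> f y = q \<and> {x, y} \<in> E"
    by (auto simp: shadow_def)
  have inj: "inj_on g (verts H)" and onto: "g ` verts H = {0..<4}"
    using g(1) by (auto simp: bij_betw_def)
  show thesis
  proof (rule that[of "g \<circ> f"])
    show "(g \<circ> f) ` V = {0..<4}" by (simp only: image_comp[symmetric] f(1) onto)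
  next
    fix i :: nat assume "i < 4"
    then have "i \<in> g ` verts H" using onto by simp
    then obtain h where h: "h \<in> verts H" "g h = i" by blast
    then have "{x \<in> V. (g \<circ> f) x = i} = {x \<in> V. f x = h}"
      using inj f(1) by (auto simp: inj_on_def)
    then show "conn E {x \<in> V. (g \<circ> f) x = i}" using f(2) h by simp
  next
    fix i j :: nat assume "i < 4" "j < 4" "i \<noteq> j"
    then have "{i, j} \<in> (\<lambda>e. g ` e) ` edges H"
      unfolding g(2)[symmetric] edges_complete_iff by auto
    then obtain e where e: "e \<in> edges H" "{i, j} = g ` e" by blast
    then obtain p q where "e = {p, q}" using s unfolding simple_def by blast
    then have "{p, q} \<in> edges H" "{q, p} \<in> edges H" "g p = i \<and> g q = j \<or> g p = j \<and> g q = i"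
      using e by (auto simp: doubleton_eq_iff insert_commute)
    then obtain p q where "{p, q} \<in> edges H" "g p = i" "g q = j" by blast
    then show "\<exists>x \<in> V. \<exists>y \<in> V. (g \<circ> f) x = i \<and> (g \<circ> f) y = j \<and> {x, y} \<in> E"
      using f(3)[of p q] by auto
  qed
qed

text \<open>The surviving end keeps its name in \<open>contr\<close>, so all vertex sets stay inside
  \<open>V\<close>; the rule for \<open>minor\<close> permits this choice of the merged
  vertex.\<close>

lemma contract_edge_contr:
  assumes "simple V E" "{a, c} \<in> E"
  shows "contract_edge (V, E) a c a = (V - {c}, contr a c E)"
proof -
  have ac: "a \<in> V" "a \<noteq> c" using simpleD[OF assms] by auto
  have "e \<in> {f \<in> E. f \<inter> {a, c} = {}} \<union> {{a, z} | z. z \<in> V - {a, c} \<and> ({a, z} \<in> E \<or> {c, z} \<in> E)} \<longleftrightarrow>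
      e \<in> contr a c E" (is "e \<in> ?L \<longleftrightarrow> _") for e
  proof
    assume "e \<in> ?L"
    then consider "e \<in> E" "e \<inter> {a, c} = {}" | z where "e = {a, z}" "z \<notin> {a, c}" "{a, z} \<in> E"
      | z where "e = {a, z}" "z \<notin> {a, c}" "{c, z} \<in> E"
      by blast
    then show "e \<in> contr a c E"
      using ac unfolding contr_def by cases blast+
  next
    assume "e \<in> contr a c E"
    then consider "e \<in> E" "c \<notin> e" | z where "e = {a, z}" "{c, z} \<in> E" "z \<noteq> a"
      by (auto simp: contr_def)
    then show "e \<in> ?L"
    proof cases
      case 1
      then obtain x y where xy: "e = {x, y}" "x \<in> V" "y \<in> V" "x \<noteq> y"
        using assms(1) unfolding simple_def by blast
      show ?thesis
      proof (cases "a \<in> e")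
        case True
        then obtain z where "e = {a, z}" "z \<in> V" "z \<noteq> a" using xy by auto
        then show ?thesis using 1 by auto
      next
        case False
        then show ?thesis using 1 by auto
      qed
    next
      case 2
      then show ?thesis using simpleD[OF assms(1) 2(2)] by auto
    qed
  qed
  then have "?L = contr a c E" by (rule Set.set_eqI)
  then show ?thesis using ac by (auto simp: contract_edge_def)
qed

lemma K4_iso:
  assumes "inj_on b {0..<4::nat}" "V = b ` {0..<4}" "simple V E"
    "\<And>i j. i < 4 \<Longrightarrow> j < 4 \<Longrightarrow> i \<noteq> j \<Longrightarrow> {b i, b j} \<in> E"
  shows "graph_isomorphic (V, E) (complete_graph {0..<4::nat})"
proof -
  define g where "g = inv_into {0..<4} b"
  have gb: "g (b i) = i" if "i < 4" for i using assms(1) that by (simp add: g_def)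
  have "bij_betw g V {0..<4}"
    using assms(1,2) unfolding g_def by (metis bij_betw_imageI bij_betw_inv_into)
  moreover have "edges (complete_graph {0..<4}) = (\<lambda>e. g ` e) ` E"
  proof (intro subset_antisym subsetI)
    fix e assume "e \<in> edges (complete_graph {0..<4::nat})"
    then obtain i j where ij: "e = {i, j}" "i < 4" "j < 4" "i \<noteq> j"
      by (auto simp: complete_graph_def)
    then have "e = g ` {b i, b j}" using gb by simp
    then show "e \<in> (\<lambda>e. g ` e) ` E" using assms(4) ij by blast
  next
    fix e assume "e \<in> (\<lambda>e. g ` e) ` E"
    then obtain x y where xy: "e = {g x, g y}" "x \<in> V" "y \<in> V" "x \<noteq> y"
      using assms(3) unfolding simple_def by force
    then obtain i j where "x = b i" "y = b j" "i < 4" "j < 4" using assms(2) by auto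
    then show "e \<in> edges (complete_graph {0..<4::nat})"
      using xy gb by (auto simp: edges_complete_iff)
  qed
  ultimately show ?thesis
    unfolding graph_isomorphic_def by (intro exI[of _ g]) (auto simp: complete_graph_def)
qed

text \<open>As long as an edge leads from a branch set into itself or to a vertex of no branch set,
  it is contracted and the model survives. When no such edge is left, the branch sets are singletons
  and their union is closed under adjacency. By connectivity it is everything, and the graph is
  \<open>K4\<close> itself.\<close>

lemma K4m_minor:
  assumes "minor G (V, E)" "finite V" "simple V E" "conn E V" "K4m V E"
  shows "\<exists>H. minor G H \<and> graph_isomorphic H (complete_graph {0..<4::nat})"
  using assms
proof (induction "card V" arbitrary: V E rule: less_induct)
  case less
  note s = less.prems(3)
  obtain B where B: "\<And>i. i < (4::nat) \<Longrightarrow> B i \<subseteq> V \<and> B i \<noteq> {} \<and> conn E (B i)"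
    and link: "\<And>i j. i < 4 \<Longrightarrow> j < 4 \<Longrightarrow> i \<noteq> j \<Longrightarrow> link E (B i) (B j)"
    using less.prems(5) unfolding K4m_def by blast
  have disj: "i = j" if "i < 4" "j < 4" "x \<in> B i" "x \<in> B j" for i j x
    using link[of i j] that by (auto simp: link_def)
  show ?case
  proof (cases "\<exists>x y i. i < 4 \<and> x \<in> B i \<and> {x, y} \<in> E \<and> (\<forall>j<4. y \<in> B j \<longrightarrow> j = i)")
    case True
    then obtain x y i where i: "i < 4" "x \<in> B i" "{x, y} \<in> E" "\<And>j. j < 4 \<Longrightarrow> y \<in> B j \<Longrightarrow> j = i"
      by blast
    have xy: "x \<in> V" "y \<in> V" "x \<noteq> y" using simpleD[OF s i(3)] by auto
    have "K4m (V - {y}) (contr x y E)"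
      unfolding K4m_def
    proof (intro exI[of _ "\<lambda>j. B j - {y}"] conjI allI impI)
      fix j :: nat assume j: "j < 4"
      show "B j - {y} \<subseteq> V - {y}" using B[OF j] by auto
      show "B j - {y} \<noteq> {}"
      proof (cases "j = i")
        case True
        then show ?thesis using i(2) xy(3) by blast
      next
        case False
        then have "y \<notin> B j" using i(4) j by blast
        then show ?thesis using B[OF j] by simp
      qed
      show "conn (contr x y E) (B j - {y})"
      proof (cases "j = i")
        case True
        then show ?thesis using conn_contr[OF s i(3), of "B j"] B[OF j] i(2) by simp
      next
        case False
        then have "y \<notin> B j" using i(4) j by blast
        then show ?thesis using conn_contr_off[of E "B j" y x] B[OF j] by simp
      qed
      fix k :: nat assume k: "k < 4" "j \<noteq> k"
      then obtain p q where pq: "p \<in> B j" "q \<in> B k" "{p, q} \<in> E" "B j \<inter> B k = {}"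
        using link[of j k] j by (auto simp: link_def)
      have x: "x \<in> B j - {y}" if "p = y" using that pq(1) i(2) i(4)[OF j] xy(3) by simp
      have x': "x \<in> B k - {y}" if "q = y" using that pq(2) i(2) i(4)[OF k(1)] xy(3) by simp
      consider "p \<noteq> y" "q \<noteq> y" | "p = y" "q \<noteq> y" | "q = y" "p \<noteq> y"
        using simpleD(3)[OF s pq(3)] by blast
      then have "\<exists>p \<in> B j - {y}. \<exists>q \<in> B k - {y}. {p, q} \<in> contr x y E"
      proof cases
        case 1
        then show ?thesis using pq by (intro bexI[of _ p] bexI[of _ q]) (auto simp: contr_def)
      next
        case 2
        then have "q \<noteq> x" using x pq by blast
        then show ?thesis using 2 x pq
          by (intro bexI[of _ x] bexI[of _ q]) (auto simp: contr_iff[OF s xy(3)])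
      next
        case 3
        then have "p \<noteq> x" using x' pq by blast
        then show ?thesis using 3 x' pq xy
          by (intro bexI[of _ p] bexI[of _ x]) (auto simp: contr_iff[OF s xy(3)] insert_commute)
      qed
      then show "link (contr x y E) (B j - {y}) (B k - {y})"
        using pq(4) unfolding link_def by blast
    qed
    moreover have "minor G (V - {y}, contr x y E)"
      using minor.contract[OF less.prems(1), of x y x] i(3) contract_edge_contr[OF s i(3)] by simp
    moreover have "card (V - {y}) < card V"
      using xy less.prems(2) by (intro psubset_card_mono) auto
    ultimately show ?thesis
      using less.hyps[of "V - {y}" "contr x y E"] less.prems(2) simple_contr[OF s i(3)]
        conn_contr[OF s i(3) less.prems(4) xy(1)] by auto
  next
    case False
    then have no: "\<exists>j<4. y \<in> B j \<and> j \<noteq> i" if "i < 4" "x \<in> B i" "{x, y} \<in> E" for x y i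
      using that by blast
    have "\<forall>i. \<exists>b. i < 4 \<longrightarrow> B i = {b}"
    proof
      fix i
      show "\<exists>b. i < 4 \<longrightarrow> B i = {b}"
      proof (cases "i < 4")
        case i: True
        then obtain b where b: "b \<in> B i" using B by blast
        have "conn E (B i)" using B i by blast
        then have "{b} = B i"
          by (rule connD[of _ _ _ b]) (use b no[OF i] disj i in blast)+
        then show ?thesis by blast
      qed auto
    qed
    then obtain b where b: "\<And>i. i < 4 \<Longrightarrow> B i = {b i}" by metis
    have "(\<Union>i\<in>{0..<4}. B i) = V"
      using less.prems(4)
    proof (rule connD)
      show "(\<Union>i\<in>{0..<4}. B i) \<subseteq> V" by (rule UN_least) (use B in simp)
      show "b 0 \<in> (\<Union>i\<in>{0..<4}. B i)" using b[of 0] by force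
      fix x y assume "x \<in> (\<Union>i\<in>{0..<4}. B i)" "{x, y} \<in> E"
      then show "y \<in> (\<Union>i\<in>{0..<4}. B i)" using no by fastforce
    qed
    then have V: "V = b ` {0..<4}" using b by auto
    have "inj_on b {0..<4}"
      using disj b by (auto simp: inj_on_def)
    moreover have "{b i, b j} \<in> E" if "i < 4" "j < 4" "i \<noteq> j" for i j
      using link[OF that] b that by (auto simp: link_def)
    ultimately have "graph_isomorphic (V, E) (complete_graph {0..<4::nat})"
      using K4_iso[of b V E] V s by blast
    then show ?thesis using less.prems(1) by blast
  qed
qed

lemma K4_minor_free_no_K4m:
  assumes "simple_graph (V, E)" "connected_graph (V, E)" "K4_minor_free (V, E)"
  shows "\<not> K4m V E"
  using K4m_minor[OF minor.refl[of "(V, E)"]] simple_graph_simple[OF assms(1)]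
    connected_graph_conn[OF _ assms(2)] assms(1,3)
  by (auto simp: K4_minor_free_def simple_graph_def)

section \<open>Graphs whose lists of cuts are connected by quadratic steps\<close>

text \<open>Modulo two, the counts at \<open>{u, x}\<close> and \<open>{u, y}\<close> differ by the
  count at \<open>{x, y}\<close>, so their parities propagate along edges.\<close>

lemma cut_count_parity:
  assumes "simple V E" "conn E V" "u \<in> V" "w \<in> V" "same_counts E d X Y"
  shows "even (cut_count d X {u, w}) = even (cut_count d Y {u, w})"
proof -
  have tri: "even (cut_count d Z {u, x} + cut_count d Z {x, y} + cut_count d Z {u, y})"
    for Z :: "nat \<Rightarrow> 'a \<Rightarrow> bool" and x y
    unfolding cut_count_def sum.distrib[symmetric]
    by (intro dvd_sum) (auto simp: of_bool_def)
  define S where "S = {x \<in> V. even (cut_count d X {u, x}) = even (cut_count d Y {u, x})}"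
  have "S = V" using assms(2)
  proof (rule connD)
    show "S \<subseteq> V" by (auto simp: S_def)
    have "cut_count d Z {u, u} = 0" for Z :: "nat \<Rightarrow> 'a \<Rightarrow> bool"
      unfolding cut_count_def sep_doubleton by simp
    then show "u \<in> S" using assms(3) by (simp add: S_def)
    fix x y assume "x \<in> S" "y \<in> V" "{x, y} \<in> E"
    moreover have "cut_count d X {x, y} = cut_count d Y {x, y}"
      using \<open>{x, y} \<in> E\<close> assms(5) by (simp add: same_counts_def)
    ultimately show "y \<in> S"
      using tri[of X x y] tri[of Y x y] by (simp add: S_def even_add)
  qed
  then show ?thesis using assms(4) by (auto simp: S_def)
qed

lemma sep_singleton [simp]: "\<not> sep {x} y"
  by (simp add: sep_def)

lemma quad_connected_insert_singleton:
  assumes "quad_connected E"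
  shows "quad_connected (insert {u} E)"
proof -
  have "cut_count d X {u} = 0" for d and X :: "nat \<Rightarrow> 'a \<Rightarrow> bool"
    by (simp add: cut_count_def)
  then have "same_counts (insert {u} E) = same_counts E"
    by (intro ext) (simp add: same_counts_def)
  then have "quad_step (insert {u} E) = quad_step E"
    by (intro ext) (simp add: quad_step_def)
  then show ?thesis
    using assms \<open>same_counts (insert {u} E) = same_counts E\<close> by (simp add: quad_connected_def)
qed

lemma edges_at_vertex:
  assumes "simple V E" "{y. {v, y} \<in> E} = {u, w}"
  shows "E = {e \<in> E. v \<notin> e} \<union> {{u, v}, {v, w}}"
proof -
  have "e = {u, v} \<or> e = {v, w}" if e: "e \<in> E" "v \<in> e" for e
  proof -
    obtain p q where "e = {p, q}" using e(1) assms(1) unfolding simple_def by blast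
    then have "e = {v, if p = v then q else p}" using e(2) by auto
    then obtain y where y: "e = {v, y}" by blast
    then have "y \<in> {y. {v, y} \<in> E}" using e(1) by simp
    then have "y = u \<or> y = w" unfolding assms(2) by simp
    then show ?thesis using y by (auto simp: insert_commute)
  qed
  moreover have "{u, v} \<in> E" "{v, w} \<in> E"
    using assms(2) by (simp_all add: insert_commute[of u] set_eq_iff)
  ultimately show ?thesis by blast
qed

lemma simple_delete_vertex: "simple V E \<Longrightarrow> simple (V - {v}) {e \<in> E. v \<notin> e}"
  unfolding simple_def by blast

text \<open>A nonempty proper part of \<open>V - {v}\<close> closed under edges that avoid
  \<open>v\<close> must contain a neighbour of \<open>v\<close>, or it would be closed in the
  connected graph. The same holds for its complement, so it contains exactly one of
  \<open>u\<close>, \<open>w\<close>.\<close>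

lemma disconnected_side:
  assumes "simple V E" "conn E V" "v \<in> V" "{y. {v, y} \<in> E} = {u, w}"
    and "\<not> conn {e \<in> E. v \<notin> e} (V - {v})"
  obtains A where "u \<in> A" "w \<notin> A" "v \<notin> A" "\<And>x y. {x, y} \<in> E \<Longrightarrow> v \<notin> {x, y} \<Longrightarrow> x \<in> A \<longleftrightarrow> y \<in> A"
proof -
  obtain S s where S: "S \<subseteq> V - {v}" "s \<in> S" "S \<noteq> V - {v}"
    and cl: "\<And>x y. x \<in> S \<Longrightarrow> y \<in> V - {v} \<Longrightarrow> {x, y} \<in> E \<Longrightarrow> v \<notin> {x, y} \<Longrightarrow> y \<in> S"
    using assms(5) unfolding conn_def by blast
  have iff: "x \<in> S \<longleftrightarrow> y \<in> S" if "{x, y} \<in> E" "v \<notin> {x, y}" for x y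
    using cl[of x y] cl[of y x] that simpleD[OF assms(1) that(1)] by (auto simp: insert_commute)
  have nbr: "y \<in> {u, w}" if "{y, v} \<in> E" for y
    using that unfolding assms(4)[symmetric] by (simp add: insert_commute)
  have uw: "u \<in> V" "w \<in> V" "u \<noteq> v" "w \<noteq> v" using simpleD[OF assms(1), of v] assms(4) by blast+
  have "u \<in> S \<or> w \<in> S"
  proof (rule ccontr)
    assume no: "\<not> ?thesis"
    have "S = V" using assms(2) _ S(2)
    proof (rule connD)
      show "S \<subseteq> V" using S(1) by blast
      fix x y assume x: "x \<in> S" "y \<in> V" "{x, y} \<in> E"
      then have "y \<noteq> v" using nbr[of x] no by blast
      then show "y \<in> S" using iff[OF x(3)] x(1) S(1) by blast
    qed
    then show False using S(1) assms(3) by blast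
  qed
  moreover have "\<not> (u \<in> S \<and> w \<in> S)"
  proof
    assume both: "u \<in> S \<and> w \<in> S"
    obtain t where t: "t \<in> V - {v} - S" using S by blast
    have "V - {v} - S = V" using assms(2) _ t
    proof (rule connD)
      show "V - {v} - S \<subseteq> V" by blast
      fix x y assume x: "x \<in> V - {v} - S" "y \<in> V" "{x, y} \<in> E"
      then have "y \<noteq> v" using nbr[of x] both by blast
      then show "y \<in> V - {v} - S" using iff[OF x(3)] x by blast
    qed
    then show False using assms(3) by blast
  qed
  ultimately consider "u \<in> S" "w \<notin> S" | "u \<notin> S" "w \<in> S" by blast
  then show thesis
  proof cases
    case 1
    then show ?thesis using that[of S] S(1) iff by blast
  next
    case 2
    have "x \<in> V - {v} - S \<longleftrightarrow> y \<in> V - {v} - S" if "{x, y} \<in> E" "v \<notin> {x, y}" for x y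
      using iff[OF that] simpleD[OF assms(1) that(1)] that(2) by blast
    then show ?thesis using that[of "V - {v} - S"] 2 uw by blast
  qed
qed

text \<open>Neither deleting \<open>v\<close> nor contracting \<open>v\<close> into \<open>u\<close>
  creates a \<open>K4\<close> model. Contraction preserves connectivity, so the induction hypothesis
  serves \<open>EB\<close>; deletion may destroy it, whence the two versions of the ascent. A
  pendant \<open>v\<close> counts as an ear with \<open>u = w\<close>, where the level is always
  zero.\<close>

theorem quad_connected_no_K4m:
  assumes "finite V" "simple V E" "conn E V" "\<not> K4m V E"
  shows "quad_connected E"
  using assms
proof (induction "card V" arbitrary: V E rule: less_induct)
  case less
  note fin = less.prems(1) and s = less.prems(2) and c = less.prems(3) and no = less.prems(4)
  show ?case
  proof (cases "2 \<le> card V")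
    case False
    have "E = {}"
    proof (rule ccontr)
      assume "E \<noteq> {}"
      then obtain x y where "{x, y} \<subseteq> V" "x \<noteq> y" using s unfolding simple_def by blast
      then show False using False card_mono[OF fin, of "{x, y}"] by simp
    qed
    then show ?thesis by (auto simp: quad_connected_def intro: reach_rowwise)
  next
    case True
    then obtain v where v: "v \<in> V" "deg E v \<le> 2"
      using small_degree_vertex[OF fin s c no] by blast
    have finN: "finite {y. {v, y} \<in> E}" using fin s by (rule finite_nbrs)
    have "{y. {v, y} \<in> E} \<noteq> {}"
    proof
      assume "{y. {v, y} \<in> E} = {}"
      then have "{v} = V" using v by (intro connD[OF c, of _ v]) auto
      then show False using True by auto
    qed
    then have "deg E v = 1 \<or> deg E v = 2"
      using v(2) finN card_gt_0_iff[of "{y. {v, y} \<in> E}"] unfolding deg_def by linarith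
    then obtain u w where N: "{y. {v, y} \<in> E} = {u, w}"
      unfolding deg_def card_1_singleton_iff card_2_iff by (metis insert_absorb2 One_nat_def card_1_singletonE)
    define E' where "E' = {e \<in> E. v \<notin> e}"
    have vu: "{v, u} \<in> E" "{v, w} \<in> E" using N by auto
    have ne: "v \<noteq> u" "v \<noteq> w" and V: "u \<in> V" "w \<in> V"
      using simpleD[OF s vu(1)] simpleD[OF s vu(2)] by auto
    interpret ear E' u v w
      using ne by unfold_locales (auto simp: E'_def)
    have EP: "EP = E" unfolding EP_def unfolding E'_def by (rule edges_at_vertex[OF s N, symmetric])
    have lessV: "card (V - {v}) < card V" using v(1) fin by (intro psubset_card_mono) auto
    have fin': "finite (V - {v})" using fin by simp
    have s': "simple (V - {v}) E'" unfolding E'_def using s by (rule simple_delete_vertex)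
    have no': "\<not> K4m (V - {v}) E'"
      using K4m_mono[of "V - {v}" E' V E] no by (auto simp: E'_def)
    have delete: "quad_connected E'" if "conn E' (V - {v})"
      by (rule less.hyps[OF lessV fin' s' that no'])
    have B: "quad_connected EB"
    proof (cases "u = w")
      case True
      \<comment> \<open>For a pendant \<open>v\<close>, contraction and deletion coincide. If
        deletion disconnected the graph, \<open>disconnected_side\<close> would put
        \<open>u = w\<close> on both sides.\<close>
      have "conn E' (V - {v})"
      proof (rule ccontr)
        assume "\<not> ?thesis"
        then show False
          using disconnected_side[OF s c v(1) N] True unfolding E'_def by blast
      qed
      then show ?thesis
        unfolding EB_def using quad_connected_insert_singleton[OF delete, of u] True by simp
    next
      case False
      have uv: "{u, v} \<in> E" using vu by (simp add: insert_commute)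
      have "z = w" if "{v, z} \<in> E" "z \<noteq> u" for z
        using that N by blast
      then have "contr u v E = EB"
        using vu(2) False unfolding contr_def EB_def unfolding E'_def by blast
      moreover have "quad_connected (contr u v E)"
        using less.hyps[OF lessV fin' simple_contr[OF s uv] conn_contr[OF s uv c V(1)]]
          K4m_uncontr[OF s uv] no by blast
      ultimately show ?thesis by simp
    qed
    have cross: "\<exists>X'. reach EP d X X' \<and> cut_count d X' {u, w} = cut_count d X {u, w} + 2"
      if XY: "same_counts EP d X Y" "cut_count d X {u, w} < cut_count d Y {u, w}" for d X Y
    proof (cases "conn E' (V - {v})")
      case True
      show ?thesis
      proof (rule cross_connected[OF delete[OF True] B _ XY])
        fix d X Y assume "same_counts E' d X Y"
        then show "even (cut_count d X {u, w}) = even (cut_count d Y {u, w})"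
          using cut_count_parity[OF s' True] V ne by blast
      qed
    next
      case False
      then obtain A where A: "u \<in> A" "w \<notin> A" "v \<notin> A"
          "\<And>x y. {x, y} \<in> E \<Longrightarrow> v \<notin> {x, y} \<Longrightarrow> x \<in> A \<longleftrightarrow> y \<in> A"
        using disconnected_side[OF s c v(1) N] unfolding E'_def by blast
      show ?thesis
      proof (rule cross_disconnected[OF _ A(1-3) _ XY])
        show "x \<in> A \<longleftrightarrow> y \<in> A" if "{x, y} \<in> E'" for x y
          using that by (intro A(4)) (auto simp: E'_def)
        show "\<exists>x y. e = {x, y}" if "e \<in> E'" for e
          using that s' unfolding simple_def by blast
      qed
    qed
    have "quad_connected EP" by (rule quad_connected_EP[OF B]) (rule cross)
    then show ?thesis unfolding EP .
  qed
qed

section \<open>Ideals of polynomial rings\<close>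

abbreviation monom :: "('x \<Rightarrow>\<^sub>0 nat) \<Rightarrow> ('x, 'k::field) mpoly" where
  "monom m \<equiv> Poly_Mapping.single m 1"

lemma lookup_Const_mult [simp]:
  "Poly_Mapping.lookup (Const c * p) m = c * Poly_Mapping.lookup p m" for c :: "'k::field"
  unfolding Const_def mult_map_scale_conv_mult[symmetric]
  by (simp add: Poly_Mapping.map.rep_eq when_def)

text \<open>Ideals are handled as subspaces, so that spans, independent sets and their extension to
  bases are available.\<close>

global_interpretation mp: vector_space "\<lambda>c (p :: ('x, 'k::field) mpoly). Const c * p"
  by unfold_locales (rule poly_mapping_eqI, simp add: lookup_add distrib_left distrib_right mult.assoc)+

lemma monom_mult: "monom m * monom n = (monom (m + n) :: ('x, 'k::field) mpoly)"
  by (simp add: mult_single)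

lemma keys_Const_mult: "Poly_Mapping.keys (Const c * p) \<subseteq> Poly_Mapping.keys p" for c :: "'k::field"
  by (auto simp: in_keys_iff)

text \<open>Linear extension of \<open>h\<close> from monomials. Monomial homomorphisms and
  projections to homogeneous components are both of this form.\<close>

definition lin :: "(('x \<Rightarrow>\<^sub>0 nat) \<Rightarrow> ('y, 'k::field) mpoly) \<Rightarrow> ('x, 'k) mpoly \<Rightarrow> ('y, 'k) mpoly" where
  "lin h p = (\<Sum>m \<in> Poly_Mapping.keys p. Const (Poly_Mapping.lookup p m) * h m)"

lemma lin_superset:
  assumes "finite A" "Poly_Mapping.keys p \<subseteq> A"
  shows "lin h p = (\<Sum>m \<in> A. Const (Poly_Mapping.lookup p m) * h m)"
  unfolding lin_def using assms
  by (intro sum.mono_neutral_left) (auto simp: in_keys_iff)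

lemma lin_add: "lin h (p + q) = lin h p + lin h q"
proof -
  let ?A = "Poly_Mapping.keys p \<union> Poly_Mapping.keys q"
  have "lin h (p + q) = (\<Sum>m \<in> ?A. Const (Poly_Mapping.lookup (p + q) m) * h m)"
    by (rule lin_superset) (use keys_add[of p q] in auto)
  also have "\<dots> = (\<Sum>m \<in> ?A. Const (Poly_Mapping.lookup p m) * h m) +
      (\<Sum>m \<in> ?A. Const (Poly_Mapping.lookup q m) * h m)"
    by (simp add: lookup_add mp.scale_left_distrib sum.distrib)
  also have "\<dots> = lin h p + lin h q"
    by (subst (1 2) lin_superset[of ?A]) auto
  finally show ?thesis .
qed

lemma lin_scale: "lin h (Const c * p) = Const c * lin h p"
proof -
  have "lin h (Const c * p) = (\<Sum>m \<in> Poly_Mapping.keys p. Const (c * Poly_Mapping.lookup p m) * h m)"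
    by (subst lin_superset[OF _ keys_Const_mult]) auto
  also have "\<dots> = Const c * lin h p"
    unfolding lin_def sum_distrib_left
    by (intro sum.cong) (auto intro!: poly_mapping_eqI)
  finally show ?thesis .
qed

lemma lin_mono [simp]: "lin h (monom m) = h m"
  by (simp add: lin_def mp.scale_one)

lemma lin_zero [simp]: "lin h 0 = 0"
  by (simp add: lin_def)

lemma lin_uminus: "lin h (- p) = - lin h p"
  using lin_add[of h p "- p"] by (simp add: eq_neg_iff_add_eq_0 add.commute)

lemma lin_diff: "lin h (p - q) = lin h p - lin h q"
  using lin_add[of h p "- q"] lin_uminus[of h q] by simp

lemma lin_expand: "lin monom p = p"
proof (rule poly_mapping_eqI)
  fix m
  have "Poly_Mapping.lookup (lin monom p) m =
      (\<Sum>n \<in> Poly_Mapping.keys p. if n = m then Poly_Mapping.lookup p n else 0)"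
    unfolding lin_def lookup_sum
    by (intro sum.cong) (auto simp: lookup_single when_def)
  also have "\<dots> = Poly_Mapping.lookup p m"
    by (simp add: in_keys_iff)
  finally show "Poly_Mapping.lookup (lin monom p) m = Poly_Mapping.lookup p m" .
qed

section \<open>Exponent vectors, carriers and ideals\<close>

definition mons :: "'x set \<Rightarrow> ('x \<Rightarrow>\<^sub>0 nat) set" where
  "mons X = {m. Poly_Mapping.keys m \<subseteq> X}"

lemma mons_zero [simp]: "0 \<in> mons X"
  by (simp add: mons_def)

lemma keys_add_nat: "Poly_Mapping.keys (m + n) = Poly_Mapping.keys m \<union> Poly_Mapping.keys (n :: 'x \<Rightarrow>\<^sub>0 nat)"
  by (auto simp: in_keys_iff lookup_add)

lemma mons_add [simp]: "m + n \<in> mons X \<longleftrightarrow> m \<in> mons X \<and> n \<in> mons X"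
  by (simp add: mons_def keys_add_nat)

lemma carrier_mpoly_ring: "p \<in> carrier (mpoly_ring X) \<longleftrightarrow> Poly_Mapping.keys p \<subseteq> mons X"
  by (auto simp: mpoly_ring_def vars_def mons_def)

lemma mpoly_ring_simps [simp]:
  "mult (mpoly_ring X) = (*)" "one (mpoly_ring X) = 1" "zero (mpoly_ring X) = 0" "add (mpoly_ring X) = (+)"
  by (auto simp: mpoly_ring_def)

lemma keys_mult_mons:
  assumes "Poly_Mapping.keys p \<subseteq> mons X" "Poly_Mapping.keys q \<subseteq> mons X"
  shows "Poly_Mapping.keys (p * q) \<subseteq> mons X"
  using keys_mult[of p q] assms by fastforce

lemma keys_add_subset:
  "Poly_Mapping.keys p \<subseteq> U \<Longrightarrow> Poly_Mapping.keys q \<subseteq> U \<Longrightarrow> Poly_Mapping.keys (p + q) \<subseteq> U"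
  using keys_add[of p q] by blast

lemma keys_uminus: "Poly_Mapping.keys (- p) = Poly_Mapping.keys (p :: 'a \<Rightarrow>\<^sub>0 'k::field)"
  by (auto simp: in_keys_iff)

lemma ring_mpoly_ring: "ring (mpoly_ring X :: ('x, 'k::field) mpoly ring)"
proof (rule ringI)
  show "abelian_group (mpoly_ring X :: ('x, 'k) mpoly ring)"
  proof (rule abelian_groupI)
    fix p assume "p \<in> carrier (mpoly_ring X :: ('x, 'k) mpoly ring)"
    then show "\<exists>q \<in> carrier (mpoly_ring X). q \<oplus>\<^bsub>mpoly_ring X\<^esub> p = \<zero>\<^bsub>mpoly_ring X\<^esub>"
      by (intro bexI[of _ "- p"]) (auto simp: carrier_mpoly_ring keys_uminus)
  qed (auto simp: carrier_mpoly_ring keys_add_subset add_ac)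
  show "monoid (mpoly_ring X :: ('x, 'k) mpoly ring)"
    by (rule monoidI) (auto simp: carrier_mpoly_ring keys_mult_mons mult_ac)
qed (auto simp: algebra_simps)

text \<open>A general multiplier is a linear combination of monomials, so for a subspace it suffices
  to test monomials.\<close>

lemma ideal_mpoly_ringI:
  assumes carrier: "J \<subseteq> carrier (mpoly_ring X :: ('x, 'k::field) mpoly ring)"
    and sub: "mp.subspace J"
    and monom: "\<And>p k. p \<in> J \<Longrightarrow> k \<in> mons X \<Longrightarrow> monom k * p \<in> J"
  shows "ideal J (mpoly_ring X)"
proof (rule idealI[OF ring_mpoly_ring])
  have mult: "q * p \<in> J" if p: "p \<in> J" and q: "q \<in> carrier (mpoly_ring X)" for p q
  proof -
    have "q * p = (\<Sum>m \<in> Poly_Mapping.keys q. Const (Poly_Mapping.lookup q m) * (monom m * p))"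
      by (subst lin_expand[of q, symmetric]) (simp add: lin_def sum_distrib_right mult.assoc)
    also have "\<dots> \<in> J"
      using q by (intro mp.subspace_sum[OF sub] mp.subspace_scale[OF sub] monom p)
        (auto simp: carrier_mpoly_ring)
    finally show ?thesis .
  qed
  then show "x \<otimes>\<^bsub>mpoly_ring X\<^esub> a \<in> J" "a \<otimes>\<^bsub>mpoly_ring X\<^esub> x \<in> J"
    if "a \<in> J" "x \<in> carrier (mpoly_ring X)" for a x
    using that by (auto simp: mult.commute)
  interpret R: ring "mpoly_ring X :: ('x, 'k) mpoly ring" by (rule ring_mpoly_ring)
  show "subgroup J (add_monoid (mpoly_ring X))"
  proof (rule R.add.subgroupI)
    show "J \<subseteq> carrier (mpoly_ring X)" by (rule carrier)
    show "J \<noteq> {}" using mp.subspace_0[OF sub] by blast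
    fix a assume a: "a \<in> J"
    then have "- a \<in> J" by (rule mp.subspace_neg[OF sub])
    moreover have "\<ominus>\<^bsub>mpoly_ring X\<^esub> a = - a"
      using a \<open>- a \<in> J\<close> carrier by (intro R.minus_equality) auto
    ultimately show "\<ominus>\<^bsub>mpoly_ring X\<^esub> a \<in> J" by simp
  qed (auto intro: mp.subspace_add[OF sub])
qed

lemma ideal_mult:
  assumes "ideal J (mpoly_ring X)" "p \<in> J" "Poly_Mapping.keys q \<subseteq> mons X"
  shows "q * p \<in> J"
  using ideal.I_l_closed[OF assms(1,2), of q] assms(3) by (simp add: carrier_mpoly_ring)

lemma ideal_subspace:
  assumes "ideal J (mpoly_ring X)"
  shows "mp.subspace J"
proof (rule mp.subspaceI)
  interpret ideal J "mpoly_ring X" by (rule assms)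
  show "0 \<in> J" using additive_subgroup.zero_closed[OF is_additive_subgroup] by simp
  show "x + y \<in> J" if "x \<in> J" "y \<in> J" for x y
    using additive_subgroup.a_closed[OF is_additive_subgroup that] by simp
  show "Const c * x \<in> J" if "x \<in> J" for c x
    using ideal_mult[OF assms that, of "Const c"] by (auto simp: Const_def)
qed

lemma Idl_ideal: "F \<subseteq> carrier (mpoly_ring X) \<Longrightarrow> ideal (Idl\<^bsub>mpoly_ring X\<^esub> F) (mpoly_ring X)"
  by (rule ring.genideal_ideal[OF ring_mpoly_ring])

lemma Idl_superset: "F \<subseteq> carrier (mpoly_ring X) \<Longrightarrow> F \<subseteq> Idl\<^bsub>mpoly_ring X\<^esub> F"
  by (rule ring.genideal_self[OF ring_mpoly_ring])

lemma Idl_least: "ideal J (mpoly_ring X) \<Longrightarrow> F \<subseteq> J \<Longrightarrow> Idl\<^bsub>mpoly_ring X\<^esub> F \<subseteq> J"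
  by (rule ring.genideal_minimal[OF ring_mpoly_ring])

text \<open>A monomial ideal. It controls the supports of all elements of a generated ideal, which
  is how generation is refuted later.\<close>

lemma upward_closed_ideal:
  assumes "\<And>m k. m \<in> U \<Longrightarrow> k + m \<in> U"
  shows "ideal {p \<in> carrier (mpoly_ring X). Poly_Mapping.keys p \<subseteq> U} (mpoly_ring X)"
proof (rule ideal_mpoly_ringI)
  show "mp.subspace {p \<in> carrier (mpoly_ring X). Poly_Mapping.keys p \<subseteq> U}"
    using keys_Const_mult by (intro mp.subspaceI) (auto simp: carrier_mpoly_ring keys_add_subset, blast+)
next
  fix p :: "('a, 'b) mpoly" and k
  assume "p \<in> {p \<in> carrier (mpoly_ring X). Poly_Mapping.keys p \<subseteq> U}" "k \<in> mons X"
  moreover from this have "Poly_Mapping.keys (monom k * p) \<subseteq> U"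
    using keys_mult[of "monom k" p] assms by fastforce
  ultimately show "monom k * p \<in> {p \<in> carrier (mpoly_ring X). Poly_Mapping.keys p \<subseteq> U}"
    by (simp add: carrier_mpoly_ring keys_mult_mons)
qed auto

section \<open>Degrees and homogeneous components\<close>

lemma total_deg_add: "total_deg (m + n) = total_deg m + total_deg n"
  unfolding total_deg_def by (rule setsum_keys_plus_distrib) auto

lemma total_deg_single [simp]: "total_deg (Poly_Mapping.single x n) = n"
  by (simp add: total_deg_def)

lemma total_deg_zero [simp]: "total_deg 0 = 0"
  by (simp add: total_deg_def)

lemma total_deg_eq_0 [simp]: "total_deg m = 0 \<longleftrightarrow> m = 0"
proof
  assume "total_deg m = 0"
  then have "Poly_Mapping.lookup m x = 0" for x by (auto simp: total_deg_def in_keys_iff)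
  then show "m = 0" by (intro poly_mapping_eqI) simp
qed simp

lemma total_deg_Suc:
  assumes "total_deg m = Suc d"
  obtains x n where "m = n + Poly_Mapping.single x 1" "total_deg n = d"
proof -
  have "m \<noteq> 0" using assms by auto
  then obtain x where x: "Poly_Mapping.lookup m x \<noteq> 0" by (metis poly_mapping_eqI lookup_zero)
  have "m = (m - Poly_Mapping.single x 1) + Poly_Mapping.single x 1"
    using x by (intro poly_mapping_eqI) (auto simp: lookup_add lookup_minus lookup_single when_def)
  moreover from this have "total_deg m = total_deg (m - Poly_Mapping.single x 1) + 1"
    by (metis total_deg_add total_deg_single)
  ultimately show thesis using assms that by auto
qed

lemma homogeneous_monom_mult:
  "homogeneous d p \<Longrightarrow> homogeneous (total_deg k + d) (monom k * p)"
  using keys_mult[of "monom k" p] by (fastforce simp: homogeneous_def total_deg_add)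

lemma homogeneous_unique: "homogeneous d p \<Longrightarrow> homogeneous d' p \<Longrightarrow> p \<noteq> 0 \<Longrightarrow> d = d'"
  unfolding homogeneous_def by (metis equals0I keys_eq_empty)

text \<open>Projection to the component of degree \<open>d\<close> is linear, fixes
  \<open>p\<close>, and sends each element of \<open>B\<close> to itself or to zero.\<close>

lemma span_homogeneous:
  assumes "p \<in> mp.span B" "homogeneous d p" "\<And>b. b \<in> B \<Longrightarrow> \<exists>d. homogeneous d b"
  shows "p \<in> mp.span {b \<in> B. homogeneous d b}"
proof -
  define comp :: "('a, 'b) mpoly \<Rightarrow> ('a, 'b) mpoly"
    where "comp = lin (\<lambda>m. if total_deg m = d then monom m else 0)"
  have comp: "comp q = (if d' = d then q else 0)" if "homogeneous d' q" for d' q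
  proof -
    have "comp q = lin (\<lambda>m. if d' = d then monom m else 0) q"
      unfolding comp_def lin_def using that by (intro sum.cong) (auto simp: homogeneous_def)
    then show ?thesis by (simp add: lin_expand lin_def[of "\<lambda>_. 0"])
  qed
  have "comp p \<in> mp.span {b \<in> B. homogeneous d b}"
    using assms(1)
  proof (induction rule: mp.span_induct_alt)
    case base
    then show ?case by (simp add: comp_def mp.span_zero)
  next
    case (step c b q)
    obtain d' where d': "homogeneous d' b" using assms(3) step by blast
    then have "comp b \<in> mp.span {b \<in> B. homogeneous d b}"
      using step(1) by (auto simp: comp[OF d'] intro: mp.span_base mp.span_zero)
    then show ?case
      using step(2) unfolding comp_def lin_add lin_scale by (intro mp.span_add mp.span_scale)
  qed
  then show ?thesis by (simp add: comp[OF assms(2)])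
qed

section \<open>Toric ideals\<close>

abbreviation binom :: "('x \<Rightarrow>\<^sub>0 nat) \<Rightarrow> ('x \<Rightarrow>\<^sub>0 nat) \<Rightarrow> ('x, 'k::field) mpoly" where
  "binom m n \<equiv> monom m - monom n"

lemma keys_diff_subset:
  "Poly_Mapping.keys p \<subseteq> U \<Longrightarrow> Poly_Mapping.keys q \<subseteq> U \<Longrightarrow> Poly_Mapping.keys (p - q) \<subseteq> U"
  for p q :: "'a \<Rightarrow>\<^sub>0 'k::field"
  using keys_add_subset[of p U "- q"] keys_uminus[of q] by simp

lemma homogeneous_binom: "total_deg m = d \<Longrightarrow> total_deg n = d \<Longrightarrow> homogeneous d (binom m n)"
  using keys_diff_subset[of "monom m" "{m, n}" "monom n"] by (fastforce simp: homogeneous_def)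

text \<open>Here \<open>\<psi>\<close> is the effect of a monomial homomorphism on exponent vectors
  and \<open>I\<close> is its kernel; \<open>psi_deg\<close> makes the kernel homogeneous.\<close>

locale toric =
  fixes X :: "'x set" and \<psi> :: "('x \<Rightarrow>\<^sub>0 nat) \<Rightarrow> ('y \<Rightarrow>\<^sub>0 nat)" and I :: "('x, 'k::field) mpoly set"
  assumes psi_add: "\<psi> (m + n) = \<psi> m + \<psi> n"
    and psi_deg: "m \<in> mons X \<Longrightarrow> n \<in> mons X \<Longrightarrow> \<psi> m = \<psi> n \<Longrightarrow> total_deg m = total_deg n"
    and I_eq: "I = {p \<in> carrier (mpoly_ring X). lin (monom \<circ> \<psi>) p = 0}"
begin

definition binoms :: "('x, 'k) mpoly set" where
  "binoms = {binom m n | m n. m \<in> mons X \<and> n \<in> mons X \<and> \<psi> m = \<psi> n}"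

lemma binomsI: "m \<in> mons X \<Longrightarrow> n \<in> mons X \<Longrightarrow> \<psi> m = \<psi> n \<Longrightarrow> binom m n \<in> binoms"
  unfolding binoms_def by blast

lemma I_carrier: "I \<subseteq> carrier (mpoly_ring X)"
  by (auto simp: I_eq)

lemma I_subspace: "mp.subspace I"
  by (rule mp.subspaceI)
    (auto simp: I_eq carrier_mpoly_ring lin_add lin_scale keys_add_subset dest: keys_Const_mult[THEN subsetD])

lemma binom_in_I: "m \<in> mons X \<Longrightarrow> n \<in> mons X \<Longrightarrow> \<psi> m = \<psi> n \<Longrightarrow> binom m n \<in> I"
  by (auto simp: I_eq carrier_mpoly_ring lin_diff keys_diff_subset)

text \<open>The coefficient of the image at \<open>\<psi> m\<close> vanishes, so \<open>m\<close>
  cannot be the only monomial of \<open>p\<close> above it.\<close>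

lemma partner:
  assumes "p \<in> I" "m \<in> Poly_Mapping.keys p"
  obtains n where "n \<in> Poly_Mapping.keys p" "n \<noteq> m" "\<psi> n = \<psi> m"
proof -
  have "\<exists>n \<in> Poly_Mapping.keys p. n \<noteq> m \<and> \<psi> n = \<psi> m"
  proof (rule ccontr)
    assume no: "\<not> ?thesis"
    have "0 = Poly_Mapping.lookup (lin (monom \<circ> \<psi>) p) (\<psi> m)"
      using assms(1) by (simp add: I_eq)
    also have "\<dots> = (\<Sum>n \<in> Poly_Mapping.keys p. if n = m then Poly_Mapping.lookup p n else 0)"
      unfolding lin_def lookup_sum
      by (intro sum.cong) (use no in \<open>auto simp: lookup_single when_def\<close>)
    also have "\<dots> = Poly_Mapping.lookup p m" using assms(2) by simp
    finally show False using assms(2) by (simp add: in_keys_iff)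
  qed
  then show thesis using that by blast
qed

text \<open>Subtracting a multiple of \<open>binom m n\<close>, with \<open>m\<close> and its
  partner \<open>n\<close> both in the support, removes \<open>m\<close> and adds no
  monomial.\<close>

lemma I_span: "I = mp.span binoms"
proof
  show "mp.span binoms \<subseteq> I"
    using binom_in_I by (intro mp.span_minimal I_subspace) (auto simp: binoms_def)
  show "I \<subseteq> mp.span binoms"
  proof
    fix p assume "p \<in> I"
    then show "p \<in> mp.span binoms"
    proof (induction "card (Poly_Mapping.keys p)" arbitrary: p rule: less_induct)
      case less
      show ?case
      proof (cases "p = 0")
        case True
        then show ?thesis by (simp add: mp.span_zero)
      next
        case False
        then obtain m where m: "m \<in> Poly_Mapping.keys p" by (metis equals0I keys_eq_empty)
        obtain n where n: "n \<in> Poly_Mapping.keys p" "n \<noteq> m" "\<psi> n = \<psi> m"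
          using partner[OF less.prems m] .
        have mons: "m \<in> mons X" "n \<in> mons X"
          using m n less.prems I_carrier by (auto simp: carrier_mpoly_ring subset_iff)
        define b where "b = Const (Poly_Mapping.lookup p m) * binom m n"
        have b: "b \<in> mp.span binoms"
          unfolding b_def using mons n(3) by (intro mp.span_scale mp.span_base binomsI) auto
        have bI: "b \<in> I"
          unfolding b_def using mons n(3) by (intro mp.subspace_scale[OF I_subspace] binom_in_I) auto
        have "Poly_Mapping.keys (p - b) \<subseteq> Poly_Mapping.keys p - {m}"
          using n by (auto simp: in_keys_iff lookup_minus b_def lookup_single when_def split: if_splits)
        then have "card (Poly_Mapping.keys (p - b)) < card (Poly_Mapping.keys p)"
          using m by (intro psubset_card_mono) auto
        moreover have "p - b \<in> I" using less.prems bI by (rule mp.subspace_diff[OF I_subspace])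
        ultimately have "p - b \<in> mp.span binoms" by (rule less.hyps)
        from mp.span_add[OF this b] show ?thesis by simp
      qed
    qed
  qed
qed

lemma I_ideal: "ideal I (mpoly_ring X)"
proof (rule ideal_mpoly_ringI[OF I_carrier I_subspace])
  fix p k assume p: "p \<in> I" and k: "k \<in> mons X"
  have "p \<in> mp.span binoms" using p I_span by simp
  then show "monom k * p \<in> I"
  proof (induction rule: mp.span_induct_alt)
    case base
    then show ?case using mp.subspace_0[OF I_subspace] by simp
  next
    case (step c b q)
    then obtain m n where b: "b = binom m n" "m \<in> mons X" "n \<in> mons X" "\<psi> m = \<psi> n"
      by (auto simp: binoms_def)
    then have "monom k * b \<in> I"
      using k binom_in_I[of "k + m" "k + n"] by (simp add: right_diff_distrib monom_mult psi_add)
    then have "Const c * (monom k * b) + monom k * q \<in> I"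
      using step by (intro mp.subspace_add[OF I_subspace] mp.subspace_scale[OF I_subspace])
    then show ?case by (simp add: distrib_left mult.left_commute)
  qed
qed

lemma binoms_homogeneous:
  assumes "b \<in> binoms"
  shows "\<exists>d. homogeneous d b"
proof -
  obtain m n where b: "b = binom m n" and mn: "m \<in> mons X" "n \<in> mons X" "\<psi> m = \<psi> n"
    using assms unfolding binoms_def by blast
  show ?thesis
    unfolding b using homogeneous_binom[OF psi_deg[OF mn] HOL.refl] by blast
qed

section \<open>Minimal homogeneous generating systems\<close>

definition homs :: "('x, 'k) mpoly set" where
  "homs = {p \<in> I. \<exists>d. homogeneous d p}"

text \<open>These span the product of the ideal with the irrelevant maximal ideal.\<close>

definition multiples :: "('x, 'k) mpoly set" where
  "multiples = {monom k * p | k p. k \<in> mons X \<and> k \<noteq> 0 \<and> p \<in> homs}"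

lemma multiples_homs: "multiples \<subseteq> homs"
  using homogeneous_monom_mult ideal_mult[OF I_ideal]
  by (fastforce simp: multiples_def homs_def)

lemma I_span_homs: "I = mp.span homs"
proof
  have "binoms \<subseteq> homs"
    using binoms_homogeneous binom_in_I by (auto simp: homs_def binoms_def)
  then show "I \<subseteq> mp.span homs" using mp.span_mono by (subst I_span) blast
  show "mp.span homs \<subseteq> I" by (rule mp.span_minimal[OF _ I_subspace]) (auto simp: homs_def)
qed

text \<open>Graded Nakayama: a homogeneous vector space basis of the ideal that extends one of the span of
  \<open>multiples\<close> gives a minimal generating system.\<close>

lemma min_hom_generating_exists: "\<exists>F. min_hom_generating (mpoly_ring X) I F"
proof -
  obtain B0 where B0: "B0 \<subseteq> multiples" "mp.independent B0" "multiples \<subseteq> mp.span B0"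
    using mp.maximal_independent_subset[of multiples] by blast
  obtain B where B: "B0 \<subseteq> B" "B \<subseteq> homs" "mp.independent B" "homs \<subseteq> mp.span B"
    using mp.maximal_independent_subset_extend[of B0 homs] B0 multiples_homs by blast
  define F where "F = B - B0"
  have FI: "F \<subseteq> I" using B(2) by (auto simp: F_def homs_def)
  have FC: "F \<subseteq> carrier (mpoly_ring X)" using FI I_carrier by blast
  note idF = Idl_ideal[OF FC]
  \<comment> \<open>Induction on the degree: a basis element in \<open>B0\<close> is a monomial
    multiple of an element of smaller degree, and the other basis elements belong to
    \<open>F\<close>.\<close>
  have gen: "p \<in> Idl\<^bsub>mpoly_ring X\<^esub> F" if "p \<in> I" "homogeneous d p" for p d
    using that
  proof (induction d arbitrary: p rule: less_induct)
    case (less d)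
    have "p \<in> mp.span B" using less.prems B(4) by (auto simp: homs_def)
    then have "p \<in> mp.span {b \<in> B. homogeneous d b}"
      by (rule span_homogeneous[OF _ less.prems(2)]) (use B(2) in \<open>auto simp: homs_def\<close>)
    moreover have "mp.span {b \<in> B. homogeneous d b} \<subseteq> Idl\<^bsub>mpoly_ring X\<^esub> F"
    proof (rule mp.span_minimal[OF _ ideal_subspace[OF idF]], rule subsetI)
      fix b assume b: "b \<in> {b \<in> B. homogeneous d b}"
      show "b \<in> Idl\<^bsub>mpoly_ring X\<^esub> F"
      proof (cases "b \<in> B0")
        case False
        then show ?thesis using b Idl_superset[OF FC] by (auto simp: F_def)
      next
        case True
        then obtain k q d' where q: "b = monom k * q" "k \<in> mons X" "k \<noteq> 0" "q \<in> I" "homogeneous d' q"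
          using B0(1) by (auto simp: multiples_def homs_def)
        have "b \<noteq> 0" using B(3) b mp.dependent_zero by blast
        then have "d = total_deg k + d'"
          using b q homogeneous_monom_mult[OF q(5), of k] homogeneous_unique by blast
        moreover have "0 < total_deg k" using q(3) total_deg_eq_0[of k] by linarith
        ultimately have "q \<in> Idl\<^bsub>mpoly_ring X\<^esub> F" using q by (intro less.IH[of d']) auto
        then show ?thesis
          unfolding q(1) by (rule ideal_mult[OF idF]) (use q(2) in simp)
      qed
    qed
    ultimately show ?case by blast
  qed
  have "Idl\<^bsub>mpoly_ring X\<^esub> F = I"
  proof
    show "Idl\<^bsub>mpoly_ring X\<^esub> F \<subseteq> I" by (rule Idl_least[OF I_ideal FI])
    show "I \<subseteq> Idl\<^bsub>mpoly_ring X\<^esub> F"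
      by (subst I_span_homs, rule mp.span_minimal[OF _ ideal_subspace[OF idF]])
        (use gen in \<open>auto simp: homs_def\<close>)
  qed
  moreover have "\<exists>d. homogeneous d f" if "f \<in> F" for f
    using that B(2) by (auto simp: F_def homs_def)
  ultimately have hom: "hom_generating (mpoly_ring X) I F"
    using FC unfolding hom_generating_def by blast
  have "\<not> hom_generating (mpoly_ring X) I F'" if F': "F' \<subset> F" for F'
  proof
    assume "hom_generating (mpoly_ring X) I F'"
    then have eq: "Idl\<^bsub>mpoly_ring X\<^esub> F' = I" by (simp add: hom_generating_def)
    obtain f where f: "f \<in> F" "f \<notin> F'" using F' by blast
    have sub: "F' \<union> multiples \<subseteq> homs" using F' B(2) multiples_homs by (auto simp: F_def)
    have "mp.span (F' \<union> multiples) \<subseteq> mp.span homs" by (rule mp.span_mono[OF sub])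
    also have "\<dots> = I" by (rule I_span_homs[symmetric])
    finally have spanI: "mp.span (F' \<union> multiples) \<subseteq> I" .
    \<comment> \<open>A nonconstant monomial times an element of \<open>homs\<close> lies in
      \<open>multiples\<close>, so this span is an ideal. If \<open>F'\<close> generated
      \<open>I\<close>, it would contain \<open>f\<close>, although it lies in the span of
      \<open>B - {f}\<close>.\<close>
    have "ideal (mp.span (F' \<union> multiples)) (mpoly_ring X)"
    proof (rule ideal_mpoly_ringI[OF _ mp.subspace_span])
      show "mp.span (F' \<union> multiples) \<subseteq> carrier (mpoly_ring X)" using spanI I_carrier by blast
      fix p k assume p: "p \<in> mp.span (F' \<union> multiples)" and k: "k \<in> mons X"
      show "monom k * p \<in> mp.span (F' \<union> multiples)"
      proof (cases "k = 0")
        case True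
        then show ?thesis using p by simp
      next
        case False
        from p show ?thesis
        proof (induction rule: mp.span_induct_alt)
          case base
          then show ?case by (simp add: mp.span_zero)
        next
          case (step c b q)
          then have "b \<in> homs" using sub by blast
          then have "monom k * b \<in> multiples" unfolding multiples_def using k False by blast
          then have "Const c * (monom k * b) + monom k * q \<in> mp.span (F' \<union> multiples)"
            using step by (intro mp.span_add mp.span_scale) (auto intro: mp.span_base)
          then show ?case by (simp add: distrib_left mult.left_commute)
        qed
      qed
    qed
    then have "Idl\<^bsub>mpoly_ring X\<^esub> F' \<subseteq> mp.span (F' \<union> multiples)"
      by (rule Idl_least) (auto intro: mp.span_base)
    then have "f \<in> mp.span (F' \<union> multiples)" using eq f(1) FI by blast
    moreover have "mp.span (F' \<union> multiples) \<subseteq> mp.span (B - {f})"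
    proof (rule mp.span_minimal[OF _ mp.subspace_span], rule Un_least)
      show "F' \<subseteq> mp.span (B - {f})" using F' f by (auto simp: F_def intro: mp.span_base)
      have "B0 \<subseteq> B - {f}" using B(1) f(1) by (auto simp: F_def)
      then show "multiples \<subseteq> mp.span (B - {f})" using B0(3) mp.span_mono by blast
    qed
    ultimately have "f \<in> mp.span (B - {f})" by blast
    then show False using B(3) f(1) by (auto simp: mp.dependent_def F_def)
  qed
  then show ?thesis using hom by (auto simp: min_hom_generating_def)
qed

lemma Idl_keys_upward_closed:
  assumes "F \<subseteq> carrier (mpoly_ring X)" "\<And>f m. f \<in> F \<Longrightarrow> m \<in> Poly_Mapping.keys f \<Longrightarrow> m \<in> U"
    and "\<And>m k. m \<in> U \<Longrightarrow> k + m \<in> U" "p \<in> Idl\<^bsub>mpoly_ring X\<^esub> F" "m \<in> Poly_Mapping.keys p"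
  shows "m \<in> U"
proof -
  have "Idl\<^bsub>mpoly_ring X\<^esub> F \<subseteq> {p \<in> carrier (mpoly_ring X). Poly_Mapping.keys p \<subseteq> U}"
    using assms(1,2) by (intro Idl_least upward_closed_ideal assms(3)) auto
  then show ?thesis using assms(4,5) by blast
qed

end

section \<open>Generators of degree two\<close>

locale toric_quadric = toric +
  assumes low_deg: "m \<in> mons X \<Longrightarrow> n \<in> mons X \<Longrightarrow> \<psi> m = \<psi> n \<Longrightarrow> total_deg m \<le> 1 \<Longrightarrow> m = n"
    and quadric: "\<exists>m \<in> mons X. \<exists>n \<in> mons X. m \<noteq> n \<and> \<psi> m = \<psi> n \<and> total_deg m = 2"
begin

lemma I_low_deg:
  assumes "p \<in> I" "m \<in> Poly_Mapping.keys p"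
  shows "2 \<le> total_deg m"
proof (rule ccontr)
  assume "\<not> 2 \<le> total_deg m"
  obtain n where n: "n \<in> Poly_Mapping.keys p" "n \<noteq> m" "\<psi> n = \<psi> m" using partner[OF assms] .
  have "m \<in> mons X" "n \<in> mons X" using assms n(1) I_carrier by (auto simp: carrier_mpoly_ring subset_iff)
  then have "m = n" using n(3) \<open>\<not> 2 \<le> total_deg m\<close> by (intro low_deg) auto
  with n(2) show False by simp
qed

text \<open>The ideal is zero below degree two. If no generator had degree two, all monomials of the
  ideal would have degree at least three. This holds for every homogeneous generating system, and so
  also for one in a single degree.\<close>

lemma quadratic_generator:
  assumes "hom_generating (mpoly_ring X) I F"
  shows "\<exists>f \<in> F. f \<noteq> 0 \<and> homogeneous 2 f"
proof (rule ccontr)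
  assume no: "\<not> ?thesis"
  have FC: "F \<subseteq> carrier (mpoly_ring X)" and hom: "\<And>f. f \<in> F \<Longrightarrow> \<exists>d. homogeneous d f"
    and gen: "Idl\<^bsub>mpoly_ring X\<^esub> F = I"
    using assms by (auto simp: hom_generating_def)
  obtain m n where mn: "m \<in> mons X" "n \<in> mons X" "m \<noteq> n" "\<psi> m = \<psi> n" "total_deg m = 2"
    using quadric by blast
  have "m \<in> {m. 3 \<le> total_deg m}"
  proof (rule Idl_keys_upward_closed[OF FC])
    fix f m assume f: "f \<in> F" and m: "m \<in> Poly_Mapping.keys f"
    then obtain d where d: "homogeneous d f" using hom by blast
    have "total_deg m = d" using d m by (auto simp: homogeneous_def)
    moreover have "2 \<le> total_deg m" using I_low_deg[OF _ m] Idl_superset[OF FC] f gen by blast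
    moreover have "d \<noteq> 2" using no f d m by auto
    ultimately show "m \<in> {m. 3 \<le> total_deg m}" by simp
  next
    show "binom m n \<in> Idl\<^bsub>mpoly_ring X\<^esub> F" using binom_in_I mn gen by blast
    show "m \<in> Poly_Mapping.keys (binom m n :: ('a, 'c) mpoly)"
      using mn(3) by (simp add: in_keys_iff lookup_minus lookup_single when_def)
  qed (auto simp: total_deg_add)
  then show False using mn(5) by simp
qed

lemma has_quadratic_min_generator: "has_min_generator_of_degree (mpoly_ring X) I 2"
  using min_hom_generating_exists quadratic_generator
  by (auto simp: has_min_generator_of_degree_def min_hom_generating_def)

lemma generated_single_degree:
  assumes "generated_in_degree (mpoly_ring X) I d"
  shows "d = 2"
proof -
  obtain F where F: "hom_generating (mpoly_ring X) I F" "\<And>f. f \<in> F \<Longrightarrow> homogeneous d f"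
    using assms by (auto simp: generated_in_degree_def)
  then show ?thesis using quadratic_generator[OF F(1)] homogeneous_unique by blast
qed

end

context toric
begin

definition quadrics :: "('x, 'k) mpoly set" where
  "quadrics = {binom m n | m n. m \<in> mons X \<and> n \<in> mons X \<and> \<psi> m = \<psi> n \<and> total_deg m = 2}"

lemma quadrics_carrier: "quadrics \<subseteq> carrier (mpoly_ring X)"
  unfolding quadrics_def using binom_in_I I_carrier by blast

lemma generated_by_quadrics:
  assumes "\<And>m n. m \<in> mons X \<Longrightarrow> n \<in> mons X \<Longrightarrow> \<psi> m = \<psi> n \<Longrightarrow>
    binom m n \<in> Idl\<^bsub>mpoly_ring X\<^esub> quadrics"
  shows "generated_in_degree (mpoly_ring X) I 2"
proof -
  have hom: "homogeneous 2 f" if fq: "f \<in> quadrics" for f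
  proof -
    obtain m n where f: "f = binom m n" and mn: "m \<in> mons X" "n \<in> mons X" "\<psi> m = \<psi> n"
      and m2: "total_deg m = 2"
      using fq unfolding quadrics_def by blast
    show ?thesis
      unfolding f using homogeneous_binom[OF m2] psi_deg[OF mn] m2 by simp
  qed
  have "I \<subseteq> Idl\<^bsub>mpoly_ring X\<^esub> quadrics"
    unfolding I_span
  proof (rule mp.span_minimal[OF _ ideal_subspace[OF Idl_ideal[OF quadrics_carrier]]])
    show "binoms \<subseteq> Idl\<^bsub>mpoly_ring X\<^esub> quadrics"
      unfolding binoms_def using assms by blast
  qed
  moreover have "Idl\<^bsub>mpoly_ring X\<^esub> quadrics \<subseteq> I"
  proof (rule Idl_least[OF I_ideal])
    show "quadrics \<subseteq> I" unfolding quadrics_def using binom_in_I by blast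
  qed
  ultimately have "Idl\<^bsub>mpoly_ring X\<^esub> quadrics = I" by (rule equalityI[rotated])
  then have "hom_generating (mpoly_ring X) I quadrics"
    unfolding hom_generating_def using hom quadrics_carrier by blast
  then show ?thesis unfolding generated_in_degree_def using hom by blast
qed

text \<open>The monomials that do not divide \<open>m\<close> form an upward closed set. By
  \<open>rigid\<close>, a quadratic divisor of \<open>m\<close> has no partner, so it occurs in no
  quadric of the ideal; hence \<open>m\<close> occurs in nothing generated by quadrics, although it
  occurs in \<open>binom m n\<close>.\<close>

lemma not_generated_by_quadrics:
  assumes "m \<in> mons X" "n \<in> mons X" "\<psi> m = \<psi> n" "m \<noteq> n"
    and rigid: "\<And>k q q'. k + q = m \<Longrightarrow> q' \<in> mons X \<Longrightarrow> total_deg q = 2 \<Longrightarrow> \<psi> q = \<psi> q' \<Longrightarrow> q = q'"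
  shows "\<not> generated_in_degree (mpoly_ring X) I 2"
proof
  assume "generated_in_degree (mpoly_ring X) I 2"
  then obtain F where F: "hom_generating (mpoly_ring X) I F" "\<And>f. f \<in> F \<Longrightarrow> homogeneous 2 f"
    by (auto simp: generated_in_degree_def)
  then have FC: "F \<subseteq> carrier (mpoly_ring X)" and gen: "Idl\<^bsub>mpoly_ring X\<^esub> F = I"
    by (auto simp: hom_generating_def)
  have "m \<in> {q. \<not> (\<exists>k. k + q = m)}"
  proof (rule Idl_keys_upward_closed[OF FC])
    fix f q assume f: "f \<in> F" and q: "q \<in> Poly_Mapping.keys f"
    have fI: "f \<in> I" using f Idl_superset[OF FC] gen by blast
    obtain q' where q': "q' \<in> Poly_Mapping.keys f" "q' \<noteq> q" "\<psi> q' = \<psi> q" using partner[OF fI q] .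
    have "q' \<in> mons X" using q' fI I_carrier by (auto simp: carrier_mpoly_ring subset_iff)
    moreover have "total_deg q = 2" using F(2)[OF f] q by (auto simp: homogeneous_def)
    ultimately show "q \<in> {q. \<not> (\<exists>k. k + q = m)}" using rigid q' by force
  next
    show "binom m n \<in> Idl\<^bsub>mpoly_ring X\<^esub> F" using binom_in_I assms gen by blast
    show "m \<in> Poly_Mapping.keys (binom m n :: ('x, 'k) mpoly)"
      using assms(4) by (simp add: in_keys_iff lookup_minus lookup_single when_def)
    show "k + q \<in> {q. \<not> (\<exists>k. k + q = m)}" if "q \<in> {q. \<not> (\<exists>k. k + q = m)}" for q k
      using that by (auto simp: add.assoc[symmetric])
  qed
  then show False by (metis (mono_tags) add_0 mem_Collect_eq)
qed

end

section \<open>Cut ideals as toric ideals\<close>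

lemma monom_sum: "finite A \<Longrightarrow> monom (\<Sum>a \<in> A. g a) = (\<Prod>a \<in> A. monom (g a) :: ('x, 'k::field) mpoly)"
  by (induction A rule: finite_induct) (simp_all add: monom_mult[symmetric])

definition expo :: "('x \<Rightarrow> ('y \<Rightarrow>\<^sub>0 nat)) \<Rightarrow> ('x \<Rightarrow>\<^sub>0 nat) \<Rightarrow> ('y \<Rightarrow>\<^sub>0 nat)" where
  "expo g m = (\<Sum>x \<in> Poly_Mapping.keys m. \<Sum>i < Poly_Mapping.lookup m x. g x)"

lemma monom_expo:
  "monom (expo g m) = (\<Prod>x \<in> Poly_Mapping.keys m. (monom (g x) :: ('y, 'k::field) mpoly) ^ Poly_Mapping.lookup m x)"
  by (simp add: expo_def monom_sum)

lemma subst_hom_lin: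
  assumes "\<And>x. f x = (monom (g x) :: ('y, 'k::field) mpoly)"
  shows "subst_hom f = lin (monom \<circ> expo g)"
  by (intro ext) (simp add: subst_hom_def lin_def monom_expo assms)

lemma lookup_expo:
  "Poly_Mapping.lookup (expo g m) y = (\<Sum>x \<in> Poly_Mapping.keys m. Poly_Mapping.lookup m x * Poly_Mapping.lookup (g x) y)"
  by (simp add: expo_def lookup_sum)

lemma expo_add: "expo g (m + n) = expo g m + expo g n"
proof (rule poly_mapping_eqI)
  fix y
  show "Poly_Mapping.lookup (expo g (m + n)) y = Poly_Mapping.lookup (expo g m + expo g n) y"
    unfolding lookup_expo lookup_add
    using setsum_keys_plus_distrib[of "\<lambda>x k. k * Poly_Mapping.lookup (g x) y" m n]
    by (simp add: lookup_add distrib_right)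
qed

lemma expo_zero [simp]: "expo g 0 = 0"
  by (simp add: expo_def)

lemma expo_single [simp]: "expo g (Poly_Mapping.single x (Suc 0)) = g x"
  by (simp add: expo_def)

lemma expo_sum: "finite A \<Longrightarrow> expo g (\<Sum>a \<in> A. h a) = (\<Sum>a \<in> A. expo g (h a))"
  by (induction A rule: finite_induct) (simp_all add: expo_add)

section \<open>Bipartitions as Boolean rows up to complement\<close>

definition bipart :: "'v set \<Rightarrow> ('v \<Rightarrow> bool) \<Rightarrow> 'v set set" where
  "bipart V x = {{v \<in> V. x v}, {v \<in> V. \<not> x v}}"

lemma bipart_in: "bipart V x \<in> bipartitions V"
proof -
  have "{v \<in> V. x v} \<union> {v \<in> V. \<not> x v} = V" "{v \<in> V. x v} \<inter> {v \<in> V. \<not> x v} = {}" by auto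
  then show ?thesis unfolding bipart_def bipartitions_def by blast
qed

lemma bipartitions_bipart:
  assumes "P \<in> bipartitions V"
  obtains x where "P = bipart V x"
proof -
  obtain A B where AB: "P = {A, B}" "A \<union> B = V" "A \<inter> B = {}"
    using assms unfolding bipartitions_def by blast
  then have "{v \<in> V. v \<in> A} = A" "{v \<in> V. v \<notin> A} = B" by auto
  then have "P = bipart V (\<lambda>v. v \<in> A)" using AB(1) by (simp add: bipart_def)
  then show thesis by (rule that)
qed

lemma bipart_cong: "(\<And>v. v \<in> V \<Longrightarrow> x v = y v) \<Longrightarrow> bipart V x = bipart V y"
  unfolding bipart_def by (intro arg_cong2[of _ _ _ _ "\<lambda>A B. {A, B}"] Collect_cong) blast+

lemma bipart_compl: "bipart V (\<lambda>v. \<not> x v) = bipart V x"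
  by (simp add: bipart_def insert_commute)

lemma bipart_up_to_compl:
  assumes "\<And>v. v \<in> V \<Longrightarrow> (x v \<noteq> y v) = c"
  shows "bipart V x = bipart V y"
proof (cases c)
  case True
  then have "bipart V x = bipart V (\<lambda>v. \<not> y v)" using assms by (intro bipart_cong) blast
  then show ?thesis by (simp add: bipart_compl)
next
  case False
  then show ?thesis using assms by (intro bipart_cong) blast
qed

lemma Cut_bipart:
  assumes "simple V E"
  shows "Cut (V, E) (bipart V x) = {e \<in> E. sep e x}"
proof (intro subset_antisym subsetI)
  fix e assume "e \<in> Cut (V, E) (bipart V x)"
  then obtain A B a b where e: "e \<in> E" "bipart V x = {A, B}" "a \<in> A" "b \<in> B" "e = {a, b}"
    by (auto simp: Cut_def)
  then have "x a \<noteq> x b"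
    by (auto simp: bipart_def doubleton_eq_iff)
  with e show "e \<in> {e \<in> E. sep e x}" by simp
next
  fix e assume e: "e \<in> {e \<in> E. sep e x}"
  then obtain a b where ab: "e = {a, b}" "a \<in> V" "b \<in> V" using assms unfolding simple_def by blast
  have "x a \<noteq> x b" using e ab by simp
  have "\<exists>a b. a \<in> {v \<in> V. x v} \<and> b \<in> {v \<in> V. \<not> x v} \<and> e = {a, b}"
  proof (cases "x a")
    case True
    then show ?thesis using ab \<open>x a \<noteq> x b\<close> by (intro exI[of _ a] exI[of _ b]) auto
  next
    case False
    then show ?thesis using ab \<open>x a \<noteq> x b\<close> by (intro exI[of _ b] exI[of _ a]) auto
  qed
  then show "e \<in> Cut (V, E) (bipart V x)"
    using e unfolding Cut_def bipart_def snd_conv by blast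
qed

lemma lookup_sum_single:
  assumes "finite A"
  shows "Poly_Mapping.lookup (\<Sum>a \<in> A. Poly_Mapping.single (s_var a) 1) (s_var e) = (of_bool (e \<in> A) :: nat)"
    "Poly_Mapping.lookup (\<Sum>a \<in> A. Poly_Mapping.single (t_var a) 1) (t_var e) = (of_bool (e \<in> A) :: nat)"
    "Poly_Mapping.lookup (\<Sum>a \<in> A. Poly_Mapping.single (s_var a) 1) (t_var e) = (0 :: nat)"
    "Poly_Mapping.lookup (\<Sum>a \<in> A. Poly_Mapping.single (t_var a) 1) (s_var e) = (0 :: nat)"
  using assms by (simp_all add: lookup_sum lookup_single when_def)

definition cut_expo :: "'v graph \<Rightarrow> 'v set set \<Rightarrow> ('v set edge_var \<Rightarrow>\<^sub>0 nat)" where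
  "cut_expo G P = (\<Sum>e \<in> Cut G P. Poly_Mapping.single (s_var e) 1) +
     (\<Sum>e \<in> edges G - Cut G P. Poly_Mapping.single (t_var e) 1)"

text \<open>Relative to \<open>o'\<close>, every point keeps its two values or sees them exchanged.
  If one point only allowed the exchange and another only forbade it, the count of this pair would
  jump between zero and two. So one choice works for all of \<open>A\<close>: the cut ideal of a
  complete graph has no quadrics.\<close>

lemma pair_rigid:
  fixes p p' r r' :: "'a \<Rightarrow> bool"
  assumes eq: "\<And>i j. i \<in> A \<Longrightarrow> j \<in> A \<Longrightarrow> of_bool (p i \<noteq> p j) + of_bool (p' i \<noteq> p' j) =
      (of_bool (r i \<noteq> r j) + of_bool (r' i \<noteq> r' j) :: nat)" and o: "o' \<in> A"
  shows "(\<forall>i \<in> A. (r i \<noteq> r o') = (p i \<noteq> p o') \<and> (r' i \<noteq> r' o') = (p' i \<noteq> p' o')) \<or>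
    (\<forall>i \<in> A. (r i \<noteq> r o') = (p' i \<noteq> p' o') \<and> (r' i \<noteq> r' o') = (p i \<noteq> p o'))"
    (is "(\<forall>i \<in> A. ?P i) \<or> (\<forall>i \<in> A. ?Q i)")
proof (rule ccontr)
  define P Q where "P = ?P" and "Q = ?Q"
  assume "\<not> ?thesis"
  then have "\<not> ((\<forall>i \<in> A. P i) \<or> (\<forall>i \<in> A. Q i))" unfolding P_def Q_def .
  then obtain i j where "i \<in> A" "\<not> P i" "j \<in> A" "\<not> Q j" by blast
  then have i: "i \<in> A" "\<not> ?P i" and j: "j \<in> A" "\<not> ?Q j" unfolding P_def Q_def by this+
  \<comment> \<open>Relative to \<open>o'\<close>, \<open>a\<close> and \<open>b\<close> are the
    values of \<open>p\<close> at \<open>i\<close> and \<open>j\<close>, while \<open>c\<close> and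
    \<open>d\<close> are those of \<open>r\<close>; primes mark the second row of each pair.\<close>
  have *: False if "of_bool a + of_bool a' = (of_bool c + of_bool c' :: nat)"
    "of_bool b + of_bool b' = (of_bool d + of_bool d' :: nat)"
    "of_bool (a \<noteq> b) + of_bool (a' \<noteq> b') = (of_bool (c \<noteq> d) + of_bool (c' \<noteq> d') :: nat)"
    "\<not> (c = a \<and> c' = a')" "\<not> (d = b' \<and> d' = b)" for a a' b b' c c' d d'
    using that by (cases a; cases a'; cases b; cases b'; cases c; cases c'; cases d; cases d') simp_all
  have "((s i \<noteq> s o') \<noteq> (s j \<noteq> s o')) = (s i \<noteq> s j)" for s :: "'a \<Rightarrow> bool" by blast
  then show False
    using *[OF eq[OF i(1) o] eq[OF j(1) o] _ i(2) j(2)] eq[OF i(1) j(1)] by simp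
qed

text \<open>An edge \<open>e\<close> lets the degree be read off the image, as the sum of the
  exponents of \<open>s_var e\<close> and \<open>t_var e\<close>. Without edges all variables would
  map to one and the kernel would not be homogeneous.\<close>

locale cut_graph =
  fixes V :: "'v set" and E :: "'v set set"
  assumes graph: "simple_graph (V, E)" and connected: "connected_graph (V, E)" and nonempty: "E \<noteq> {}"
begin

lemma simple_VE: "simple V E"
  by (rule simple_graph_simple[OF graph])

lemma conn_VE: "conn E V"
  by (rule connected_graph_conn[OF simple_VE connected])

lemma finite_V: "finite V" and finite_E: "finite E"
proof -
  show "finite V" using graph by (simp add: simple_graph_def)
  then have fin: "finite (Pow V)" by simp
  have "E \<subseteq> Pow V"
  proof
    fix e assume "e \<in> E"
    then obtain x y where "e = {x, y}" "x \<in> V" "y \<in> V" using simple_VE unfolding simple_def by blast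
    then show "e \<in> Pow V" by simp
  qed
  then show "finite E" using fin by (rule finite_subset)
qed

abbreviation \<psi> where "\<psi> \<equiv> expo (cut_expo (V, E))"

definition row_monom :: "nat \<Rightarrow> (nat \<Rightarrow> 'v \<Rightarrow> bool) \<Rightarrow> ('v set set \<Rightarrow>\<^sub>0 nat)" where
  "row_monom d X = (\<Sum>k<d. Poly_Mapping.single (bipart V (X k)) 1)"

lemma Cut_subset: "Cut (V, E) P \<subseteq> E"
  by (auto simp: Cut_def)

lemma cut_hom_lin: "cut_hom (V, E) = lin (monom \<circ> \<psi>)"
  unfolding cut_hom_def
proof (rule subst_hom_lin)
  fix P
  have "finite (Cut (V, E) P)" using finite_E Cut_subset by (rule finite_subset[rotated])
  then show "(\<Prod>e \<in> Cut (V, E) P. Var (s_var e)) * (\<Prod>e \<in> edges (V, E) - Cut (V, E) P. Var (t_var e)) =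
      monom (cut_expo (V, E) P)"
    using finite_E by (simp add: cut_expo_def monom_mult[symmetric] monom_sum Var_def)
qed

lemma cut_ideal_lin:
  "cut_ideal (V, E) = {p \<in> carrier (mpoly_ring (bipartitions V)). lin (monom \<circ> \<psi>) p = 0}"
  unfolding cut_ideal_def a_kernel_def' cut_hom_lin by (simp add: S_ring_def R_ring_def)

lemma lookup_cut_expo:
  "Poly_Mapping.lookup (cut_expo (V, E) (bipart V x)) (s_var e) = of_bool (e \<in> E \<and> sep e x)"
  "Poly_Mapping.lookup (cut_expo (V, E) (bipart V x)) (t_var e) = of_bool (e \<in> E \<and> \<not> sep e x)"
proof -
  have fin: "finite {e \<in> E. sep e x}" "finite (E - {e \<in> E. sep e x})" using finite_E by simp_all
  show "Poly_Mapping.lookup (cut_expo (V, E) (bipart V x)) (s_var e) = of_bool (e \<in> E \<and> sep e x)"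
    "Poly_Mapping.lookup (cut_expo (V, E) (bipart V x)) (t_var e) = of_bool (e \<in> E \<and> \<not> sep e x)"
    unfolding cut_expo_def Cut_bipart[OF simple_VE] lookup_add snd_conv
      lookup_sum_single[OF fin(1)] lookup_sum_single[OF fin(2)] by auto
qed

lemma expo_row_monom: "\<psi> (row_monom d X) = (\<Sum>k<d. cut_expo (V, E) (bipart V (X k)))"
  by (simp add: row_monom_def expo_sum)

lemma lookup_expo_row_monom:
  assumes "e \<in> E"
  shows "Poly_Mapping.lookup (\<psi> (row_monom d X)) (s_var e) = cut_count d X e"
    and "Poly_Mapping.lookup (\<psi> (row_monom d X)) (t_var e) + cut_count d X e = d"
proof -
  show "Poly_Mapping.lookup (\<psi> (row_monom d X)) (s_var e) = cut_count d X e"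
    unfolding expo_row_monom lookup_sum lookup_cut_expo cut_count_def using assms by simp
  have "Poly_Mapping.lookup (\<psi> (row_monom d X)) (t_var e) + cut_count d X e =
      (\<Sum>k<d. of_bool (\<not> sep e (X k)) + of_bool (sep e (X k)))"
    unfolding expo_row_monom lookup_sum lookup_cut_expo cut_count_def sum.distrib using assms by simp
  also have "\<dots> = (\<Sum>k<d. 1)" by (intro sum.cong) auto
  finally show "Poly_Mapping.lookup (\<psi> (row_monom d X)) (t_var e) + cut_count d X e = d" by simp
qed

lemma lookup_expo_row_monom_off:
  assumes "e \<notin> E"
  shows "Poly_Mapping.lookup (\<psi> (row_monom d X)) (s_var e) = 0"
    "Poly_Mapping.lookup (\<psi> (row_monom d X)) (t_var e) = 0"
  unfolding expo_row_monom lookup_sum lookup_cut_expo using assms by simp_all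

lemma expo_eq_degree:
  assumes "\<psi> (row_monom d X) = \<psi> (row_monom d' Y)"
  shows "d = d'"
proof -
  obtain e where "e \<in> E" using nonempty by blast
  from lookup_expo_row_monom[OF this, of d X] lookup_expo_row_monom[OF this, of d' Y] assms
  show ?thesis by simp
qed

text \<open>The exponent of \<open>s_var e\<close> is the number of rows that cut \<open>e\<close>,
  and that of \<open>t_var e\<close> is the number of the others.\<close>

lemma expo_eq_iff: "\<psi> (row_monom d X) = \<psi> (row_monom d Y) \<longleftrightarrow> same_counts E d X Y"
proof
  assume "\<psi> (row_monom d X) = \<psi> (row_monom d Y)"
  then show "same_counts E d X Y"
    unfolding same_counts_def by (metis lookup_expo_row_monom(1))
next
  assume same: "same_counts E d X Y"
  show "\<psi> (row_monom d X) = \<psi> (row_monom d Y)"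
  proof (rule poly_mapping_eqI)
    fix y :: "'v set edge_var"
    obtain e where y: "y = s_var e \<or> y = t_var e" by (cases y) auto
    show "Poly_Mapping.lookup (\<psi> (row_monom d X)) y = Poly_Mapping.lookup (\<psi> (row_monom d Y)) y"
    proof (cases "e \<in> E")
      case True
      have "cut_count d X e = cut_count d Y e" using same True by (simp add: same_counts_def)
      then show ?thesis
        using y lookup_expo_row_monom[OF True, of d X] lookup_expo_row_monom[OF True, of d Y] by auto
    next
      case False
      then show ?thesis using y by (auto simp: lookup_expo_row_monom_off)
    qed
  qed
qed

lemma row_monom_mons: "row_monom d X \<in> mons (bipartitions V)"
  using bipart_in
  by (induction d) (auto simp: row_monom_def mons_def keys_add_nat)

lemma total_deg_row_monom: "total_deg (row_monom d X) = d"
  by (induction d) (auto simp: row_monom_def total_deg_add)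

lemma row_monom_exists:
  assumes "m \<in> mons (bipartitions V)"
  shows "\<exists>X. m = row_monom (total_deg m) X"
  using assms
proof (induction "total_deg m" arbitrary: m)
  case 0
  then have "m = 0" by simp
  then show ?case by (simp add: row_monom_def)
next
  case (Suc d)
  obtain P n where m: "m = n + Poly_Mapping.single P 1" "total_deg n = d"
    using total_deg_Suc[OF Suc(2)[symmetric]] .
  have "n \<in> mons (bipartitions V)" "P \<in> bipartitions V"
    using Suc.prems unfolding m mons_add by (auto simp: mons_def)
  then obtain X x where X: "n = row_monom d X" and x: "P = bipart V x"
    using Suc.hyps(1)[of n] m(2) bipartitions_bipart by metis
  have "row_monom (Suc d) (X(d := x)) = row_monom d X + Poly_Mapping.single P 1"
    by (simp add: row_monom_def x)
  then show ?case using X m Suc.hyps(2) by metis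
qed

text \<open>Whether the two rows differ at a vertex is constant along edges, so by connectivity they
  are equal or complementary on \<open>V\<close>.\<close>

lemma bipart_eq:
  assumes "\<And>e. e \<in> E \<Longrightarrow> sep e x = sep e y"
  shows "bipart V x = bipart V y"
proof -
  obtain r where r: "r \<in> V" using graph by (auto simp: simple_graph_def)
  have "{z \<in> V. (x z \<noteq> y z) = (x r \<noteq> y r)} = V" using conn_VE
  proof (rule connD)
    show "r \<in> {z \<in> V. (x z \<noteq> y z) = (x r \<noteq> y r)}" using r by simp
    fix a b assume "a \<in> {z \<in> V. (x z \<noteq> y z) = (x r \<noteq> y r)}" "b \<in> V" "{a, b} \<in> E"
    with assms[of "{a, b}"] show "b \<in> {z \<in> V. (x z \<noteq> y z) = (x r \<noteq> y r)}" by auto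
  qed auto
  then show ?thesis by (intro bipart_up_to_compl[of _ _ _ "x r \<noteq> y r"]) blast
qed

lemma bipart_sep: "bipart V x = bipart V y \<Longrightarrow> e \<in> E \<Longrightarrow> sep e x = sep e y"
  using Cut_bipart[OF simple_VE, of x] Cut_bipart[OF simple_VE, of y] by auto

sublocale toric "bipartitions V" \<psi> "cut_ideal (V, E) :: ('v set set, 'k::field) mpoly set"
proof
  fix m n assume mn: "m \<in> mons (bipartitions V)" "n \<in> mons (bipartitions V)" and eq: "\<psi> m = \<psi> n"
  obtain X where X: "m = row_monom (total_deg m) X" using row_monom_exists[OF mn(1)] by blast
  obtain Y where Y: "n = row_monom (total_deg n) Y" using row_monom_exists[OF mn(2)] by blast
  show "total_deg m = total_deg n"
    using eq by (subst (asm) X, subst (asm) Y) (rule expo_eq_degree)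
qed (rule expo_add, rule cut_ideal_lin)

lemma low_deg_unique:
  assumes "m \<in> mons (bipartitions V)" "n \<in> mons (bipartitions V)" "\<psi> m = \<psi> n" "total_deg m \<le> 1"
  shows "m = n"
proof -
  define d where "d = total_deg m"
  obtain X where X: "m = row_monom d X" using row_monom_exists[OF assms(1)] unfolding d_def by blast
  obtain Y where Y: "n = row_monom (total_deg n) Y" using row_monom_exists[OF assms(2)] by blast
  have "total_deg n = d" using psi_deg[OF assms(1-3)] unfolding d_def by (rule HOL.sym)
  then have Y: "n = row_monom d Y" using Y by simp
  have d1: "d \<le> 1" using assms(4) unfolding d_def .
  show ?thesis
  proof (cases "d = 0")
    case True
    show ?thesis unfolding X Y True by (simp add: row_monom_def)
  next
    case False
    then have d: "d = 1" using d1 by simp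
    have "\<psi> (row_monom 1 X) = \<psi> (row_monom 1 Y)" using assms(3) unfolding X Y d .
    then have "same_counts E 1 X Y" unfolding expo_eq_iff .
    then have "of_bool (sep e (X 0)) = (of_bool (sep e (Y 0)) :: nat)" if "e \<in> E" for e
      using that by (simp add: same_counts_def cut_count_def)
    then have "sep e (X 0) = sep e (Y 0)" if "e \<in> E" for e
      using that unfolding of_bool_eq_iff by blast
    then have "bipart V (X 0) = bipart V (Y 0)" by (rule bipart_eq)
    then show ?thesis unfolding X Y d by (simp add: row_monom_def)
  qed
qed


lemma row_monom_split:
  assumes "i < d" "j < d" "i \<noteq> j"
  shows "row_monom d X = (\<Sum>k\<in>{..<d} - {i, j}. Poly_Mapping.single (bipart V (X k)) 1) +
    (Poly_Mapping.single (bipart V (X i)) 1 + Poly_Mapping.single (bipart V (X j)) 1)"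
  unfolding row_monom_def sum_two_indices[OF assms] by (simp add: add.commute)

lemma single_bipart_mons: "Poly_Mapping.single (bipart V x) 1 \<in> mons (bipartitions V)"
  using bipart_in by (auto simp: mons_def)

text \<open>The rows that a step leaves alone give a common factor, which cancels in the exponent
  vectors and leaves a quadric.\<close>

lemma quad_step_quadrics:
  assumes "quad_step E d X Y"
  shows "binom (row_monom d X) (row_monom d Y) \<in>
    Idl\<^bsub>mpoly_ring (bipartitions V)\<^esub> (quadrics :: ('v set set, 'k::field) mpoly set)" (is "_ \<in> ?J")
proof -
  have J: "ideal ?J (mpoly_ring (bipartitions V))" by (rule Idl_ideal[OF quadrics_carrier])
  show ?thesis
    using assms
  proof (cases rule: quad_step_cases)
    case rowwise
    then have "bipart V (X k) = bipart V (Y k)" if "k < d" for k using that by (intro bipart_eq) blast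
    then have "row_monom d X = row_monom d Y" unfolding row_monom_def by (intro sum.cong) auto
    then show ?thesis using mp.subspace_0[OF ideal_subspace[OF J]] by simp
  next
    case (two i j)
    define c where "c = (\<Sum>k\<in>{..<d} - {i, j}. Poly_Mapping.single (bipart V (X k)) 1 :: 'v set set \<Rightarrow>\<^sub>0 nat)"
    define q where "q Z = Poly_Mapping.single (bipart V (Z i)) 1 + Poly_Mapping.single (bipart V (Z j)) (1 :: nat)"
      for Z :: "nat \<Rightarrow> 'v \<Rightarrow> bool"
    have "(\<Sum>k\<in>{..<d} - {i, j}. Poly_Mapping.single (bipart V (Y k)) 1) = c"
      unfolding c_def using two(4) by (intro sum.cong) auto
    then have XY: "row_monom d X = c + q X" "row_monom d Y = c + q Y"
      unfolding row_monom_split[OF two(1-3)] by (simp_all only: c_def q_def)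
    have "same_counts E d X Y" using assms by (simp add: quad_step_def)
    then have "\<psi> (c + q X) = \<psi> (c + q Y)" unfolding XY[symmetric] expo_eq_iff .
    then have eq: "\<psi> (q X) = \<psi> (q Y)" unfolding expo_add by simp
    have mons: "q Z \<in> mons (bipartitions V)" for Z
      unfolding q_def mons_add using single_bipart_mons by blast
    have "total_deg (q X) = 2" by (simp add: q_def total_deg_add)
    then have "binom (q X) (q Y) \<in> (quadrics :: ('v set set, 'k) mpoly set)"
      unfolding quadrics_def using mons eq by blast
    then have "binom (q X) (q Y) \<in> ?J" using Idl_superset[OF quadrics_carrier] by blast
    moreover have "c \<in> mons (bipartitions V)"
      using row_monom_mons[of d X] unfolding XY by simp
    ultimately have "monom c * binom (q X) (q Y) \<in> ?J"
      by (intro ideal_mult[OF J]) simp_all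
    then show ?thesis unfolding XY by (simp add: right_diff_distrib monom_mult)
  qed
qed

lemma reach_quadrics:
  assumes "reach E d X Y"
  shows "binom (row_monom d X) (row_monom d Y) \<in>
    Idl\<^bsub>mpoly_ring (bipartitions V)\<^esub> (quadrics :: ('v set set, 'k::field) mpoly set)" (is "_ \<in> ?J")
proof -
  have J: "mp.subspace ?J" by (rule ideal_subspace[OF Idl_ideal[OF quadrics_carrier]])
  show ?thesis
    using assms
  proof (induction rule: rtranclp_induct)
    case base
    then show ?case using mp.subspace_0[OF J] by simp
  next
    case (step Y Z)
    from mp.subspace_add[OF J step.IH quad_step_quadrics[OF step.hyps(2)]]
    show ?case by simp
  qed
qed

lemma generated_if_quad_connected:
  assumes "quad_connected E"
  shows "generated_in_degree (mpoly_ring (bipartitions V)) (cut_ideal (V, E) :: ('v set set, 'k::field) mpoly set) 2"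
proof (rule generated_by_quadrics)
  fix m n assume mn: "m \<in> mons (bipartitions V)" "n \<in> mons (bipartitions V)" "\<psi> m = \<psi> n"
  obtain X where X: "m = row_monom (total_deg m) X" using row_monom_exists[OF mn(1)] by blast
  obtain Y where Y: "n = row_monom (total_deg n) Y" using row_monom_exists[OF mn(2)] by blast
  define d where "d = total_deg m"
  have Xd: "m = row_monom d X" using X unfolding d_def .
  have Yd: "n = row_monom d Y" using Y psi_deg[OF mn] unfolding d_def by simp
  have "\<psi> (row_monom d X) = \<psi> (row_monom d Y)" using mn(3) unfolding Xd Yd .
  then have "reach E d X Y" using assms unfolding expo_eq_iff quad_connected_def by blast
  then show "binom m n \<in> Idl\<^bsub>mpoly_ring (bipartitions V)\<^esub> (quadrics :: ('v set set, 'k) mpoly set)"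
    unfolding Xd Yd by (rule reach_quadrics)
qed

section \<open>A quadric from a nonadjacent pair, and the quartic obstruction from
  \<open>K4\<close>\<close>

lemma bipart_eq_trivial: "bipart V x = bipart V (\<lambda>_. False) \<Longrightarrow> a \<in> V \<Longrightarrow> b \<in> V \<Longrightarrow> x a = x b"
  by (auto simp: bipart_def doubleton_eq_iff)

lemma keys_row_monom: "Poly_Mapping.keys (row_monom d X) = (\<lambda>k. bipart V (X k)) ` {..<d}"
  by (induction d) (auto simp: row_monom_def keys_add_nat lessThan_Suc)

text \<open>The counts of \<open>X\<close> and \<open>Y\<close> differ only at the pair
  \<open>{u, v}\<close>, which no row of \<open>X\<close> and both rows of \<open>Y\<close>
  separate.\<close>

lemma quadric_of_nonadjacent:
  assumes "u \<in> V" "v \<in> V" "u \<noteq> v" "{u, v} \<notin> E" "z \<in> V" "z \<noteq> u" "z \<noteq> v"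
  shows "\<exists>m \<in> mons (bipartitions V). \<exists>n \<in> mons (bipartitions V). m \<noteq> n \<and> \<psi> m = \<psi> n \<and> total_deg m = 2"
proof -
  define X where "X = (\<lambda>k::nat. if k = 0 then (\<lambda>_. False) else (\<lambda>y. y = u \<or> y = v))"
  define Y where "Y = (\<lambda>k::nat. if k = 0 then (\<lambda>y. y = u) else (\<lambda>y. y = v))"
  have two: "{..<2::nat} = {0, 1}" by auto
  have "same_counts E 2 X Y"
    unfolding same_counts_def
  proof
    fix e assume e: "e \<in> E"
    then obtain a b where ab: "e = {a, b}" "a \<noteq> b" using simple_VE unfolding simple_def by blast
    have "\<not> (a = u \<and> b = v)" "\<not> (a = v \<and> b = u)"
      using e assms(4) unfolding ab by (auto simp: insert_commute)
    then show "cut_count 2 X e = cut_count 2 Y e"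
      using ab(2) assms(3) unfolding ab cut_count_def two X_def Y_def sep_doubleton
      by (cases "a = u"; cases "a = v"; cases "b = u"; cases "b = v") simp_all
  qed
  moreover have "row_monom 2 X \<noteq> row_monom 2 Y"
  proof
    assume eq: "row_monom 2 X = row_monom 2 Y"
    have keys: "Poly_Mapping.keys (row_monom 2 Z) = {bipart V (Z 0), bipart V (Z 1)}"
      for Z :: "nat \<Rightarrow> 'v \<Rightarrow> bool"
      unfolding keys_row_monom two by simp
    have "bipart V (\<lambda>_. False) \<in> Poly_Mapping.keys (row_monom 2 X)" unfolding keys by (simp add: X_def)
    then have "bipart V (\<lambda>_. False) = bipart V (\<lambda>y. y = u) \<or> bipart V (\<lambda>_. False) = bipart V (\<lambda>y. y = v)"
      unfolding eq keys by (simp add: Y_def)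
    then show False
      using bipart_eq_trivial[of "\<lambda>y. y = u" u z] bipart_eq_trivial[of "\<lambda>y. y = v" v z] assms by auto
  qed
  ultimately show ?thesis
    using row_monom_mons total_deg_row_monom expo_eq_iff by blast
qed

lemma row_monom_two: "row_monom 2 X = Poly_Mapping.single (bipart V (X 0)) 1 + Poly_Mapping.single (bipart V (X 1)) 1"
proof -
  have "{..<2::nat} = {0, 1}" by auto
  then show ?thesis by (simp add: row_monom_def)
qed

lemma cut_count_two: "cut_count 2 X e = of_bool (sep e (X 0)) + of_bool (sep e (X 1))"
proof -
  have "{..<2::nat} = {0, 1}" by auto
  then show ?thesis unfolding cut_count_def by (simp del: sum_of_bool_eq)
qed

text \<open>The blow-up along \<open>f\<close> of the quartic generator of the cut ideal of the complete graph on four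
  vertices: the first monomial consists of the empty cut and the three balanced cuts, the second one
  of the four cuts that isolate a vertex.\<close>

definition K4_rows :: "('v \<Rightarrow> nat) \<Rightarrow> nat \<Rightarrow> 'v \<Rightarrow> bool" where
  "K4_rows f k v \<longleftrightarrow> k \<noteq> 0 \<and> (f v = 0 \<or> f v = k)"

definition K4_rows' :: "('v \<Rightarrow> nat) \<Rightarrow> nat \<Rightarrow> 'v \<Rightarrow> bool" where
  "K4_rows' f k v \<longleftrightarrow> f v = k"

text \<open>Two of the three balanced cuts and two of the four isolating cuts separate any two
  distinct values of \<open>f\<close>, so the counts agree. For rigidity, two rows of the first list
  cut no edge inside a fibre; hence any pair of rows with the same counts is constant on the
  connected fibres and descends to four points. By \<open>adj\<close> all pairs of these are
  adjacent, and \<open>pair_rigid\<close> applies.\<close>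

lemma not_generated_if_K4:
  fixes f :: "'v \<Rightarrow> nat"
  assumes onto: "f ` V = {0..<4}" and fib: "\<And>i. i < 4 \<Longrightarrow> conn E {x \<in> V. f x = i}"
    and adj: "\<And>i j. i < 4 \<Longrightarrow> j < 4 \<Longrightarrow> i \<noteq> j \<Longrightarrow> \<exists>x \<in> V. \<exists>y \<in> V. f x = i \<and> f y = j \<and> {x, y} \<in> E"
  shows "\<not> generated_in_degree (mpoly_ring (bipartitions V))
    (cut_ideal (V, E) :: ('v set set, 'k::field) mpoly set) 2"
proof -
  have f4: "f x < 4" if "x \<in> V" for x using onto that by fastforce
  obtain rep where rep: "\<And>i. i < 4 \<Longrightarrow> rep i \<in> V \<and> f (rep i) = i"
  proof -
    have "\<exists>x. i < 4 \<longrightarrow> x \<in> V \<and> f x = i" for i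
    proof (cases "i < 4")
      case True
      then have "i \<in> f ` V" using onto by simp
      then show ?thesis by blast
    qed simp
    then show thesis using that by metis
  qed
  have four: "{..<4::nat} = {0, 1, 2, 3}" by auto
  show ?thesis
  proof (rule not_generated_by_quadrics)
    show "row_monom 4 (K4_rows f) \<in> mons (bipartitions V)" "row_monom 4 (K4_rows' f) \<in> mons (bipartitions V)"
      by (rule row_monom_mons)+
    have "same_counts E 4 (K4_rows f) (K4_rows' f)"
      unfolding same_counts_def
    proof
      fix e assume "e \<in> E"
      then obtain a b where ab: "e = {a, b}" "a \<in> V" "b \<in> V" using simple_VE unfolding simple_def by blast
      have "f a \<in> {0, 1, 2, 3}" "f b \<in> {0, 1, 2, 3}" using f4[OF ab(2)] f4[OF ab(3)] by auto
      then show "cut_count 4 (K4_rows f) e = cut_count 4 (K4_rows' f) e"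
        unfolding ab(1) cut_count_def four sep_doubleton K4_rows_def K4_rows'_def by auto
    qed
    then show "\<psi> (row_monom 4 (K4_rows f)) = \<psi> (row_monom 4 (K4_rows' f))" unfolding expo_eq_iff .
    show "row_monom 4 (K4_rows f) \<noteq> row_monom 4 (K4_rows' f)"
    proof
      assume "row_monom 4 (K4_rows f) = row_monom 4 (K4_rows' f)"
      then have "bipart V (K4_rows f 0) \<in> Poly_Mapping.keys (row_monom 4 (K4_rows' f))"
        using keys_row_monom[of 4 "K4_rows f"] by auto
      then obtain k where k: "k < 4" "bipart V (K4_rows f 0) = bipart V (K4_rows' f k)"
        unfolding keys_row_monom by auto
      have "bipart V (K4_rows' f k) = bipart V (\<lambda>_. False)"
        unfolding k(2)[symmetric] K4_rows_def by simp
      \<comment> \<open>An index other than \<open>k\<close>, at which row \<open>k\<close> of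
        \<open>K4_rows'\<close> is false; so this row is not the empty cut.\<close>
      moreover define l :: nat where "l = (if k = 0 then 1 else 0)"
      have "l < 4" "l \<noteq> k" by (auto simp: l_def)
      ultimately show False
        using bipart_eq_trivial[of "K4_rows' f k" "rep k" "rep l"] rep[OF k(1)] rep[of l]
        by (auto simp: K4_rows'_def)
    qed
  next
    fix c q q' assume cq: "c + q = row_monom 4 (K4_rows f)" and q': "q' \<in> mons (bipartitions V)"
      and deg: "total_deg q = 2" and eq: "\<psi> q = \<psi> q'"
    have qm: "q \<in> mons (bipartitions V)"
      using row_monom_mons[of 4 "K4_rows f"] unfolding cq[symmetric] by simp
    have deg': "total_deg q' = 2" using psi_deg[OF qm q' eq] deg by simp
    obtain X where X: "q = row_monom 2 X" using row_monom_exists[OF qm] unfolding deg by blast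
    obtain Y where Y: "q' = row_monom 2 Y" using row_monom_exists[OF q'] unfolding deg' by blast
    have "Poly_Mapping.keys q \<subseteq> (\<lambda>k. bipart V (K4_rows f k)) ` {..<4}"
      unfolding keys_row_monom[symmetric] cq[symmetric] keys_add_nat by blast
    then have "bipart V (X 0) \<in> (\<lambda>k. bipart V (K4_rows f k)) ` {..<4}"
      "bipart V (X 1) \<in> (\<lambda>k. bipart V (K4_rows f k)) ` {..<4}"
      unfolding X keys_row_monom by auto
    then obtain k0 k1 where k: "bipart V (X 0) = bipart V (K4_rows f k0)" "bipart V (X 1) = bipart V (K4_rows f k1)"
      by blast
    define p where "p = (\<lambda>k i. k \<noteq> (0::nat) \<and> (i = 0 \<or> i = k))"
    have K: "K4_rows f k v = p k (f v)" for k v by (simp add: p_def K4_rows_def)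
    have same: "same_counts E 2 X Y" using eq unfolding X Y expo_eq_iff .
    have counts: "of_bool (p k0 (f a) \<noteq> p k0 (f b)) + of_bool (p k1 (f a) \<noteq> p k1 (f b)) =
        (of_bool (Y 0 a \<noteq> Y 0 b) + of_bool (Y 1 a \<noteq> Y 1 b) :: nat)" if "{a, b} \<in> E" for a b
    proof -
      have "cut_count 2 X {a, b} = cut_count 2 Y {a, b}" using same that by (simp add: same_counts_def)
      moreover have "sep {a, b} (X 0) = sep {a, b} (K4_rows f k0)" "sep {a, b} (X 1) = sep {a, b} (K4_rows f k1)"
        using bipart_sep[OF k(1) that] bipart_sep[OF k(2) that] by auto
      ultimately show ?thesis unfolding cut_count_two by (simp add: K)
    qed
    have const: "Y l a = Y l (rep (f a))" if a: "a \<in> V" and l: "l \<in> {0, 1}" for a l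
    proof -
      have i: "f a < 4" using f4[OF a] .
      have "{z \<in> V. f z = f a \<and> Y l z = Y l a} = {z \<in> V. f z = f a}" using fib[OF i]
      proof (rule connD)
        show "a \<in> {z \<in> V. f z = f a \<and> Y l z = Y l a}" using a by simp
        fix x y assume x: "x \<in> {z \<in> V. f z = f a \<and> Y l z = Y l a}" and y: "y \<in> {z \<in> V. f z = f a}"
          and xy: "{x, y} \<in> E"
        have "f x = f y" using x y by simp
        then have "of_bool (Y 0 x \<noteq> Y 0 y) + of_bool (Y 1 x \<noteq> Y 1 y) = (0 :: nat)"
          using counts[OF xy] by simp
        then have "Y l x = Y l y" using l by (auto split: if_splits)
        then show "y \<in> {z \<in> V. f z = f a \<and> Y l z = Y l a}" using x y by simp
      qed auto
      moreover have "rep (f a) \<in> {z \<in> V. f z = f a}" using rep[OF i] by simp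
      ultimately show ?thesis by blast
    qed
    define r where "r l i = Y l (rep i)" for l i
    have pr: "of_bool (p k0 i \<noteq> p k0 j) + of_bool (p k1 i \<noteq> p k1 j) =
        (of_bool (r 0 i \<noteq> r 0 j) + of_bool (r 1 i \<noteq> r 1 j) :: nat)" if ij: "i \<in> {..<4}" "j \<in> {..<4}" for i j
    proof (cases "i = j")
      case False
      then obtain x y where xy: "x \<in> V" "y \<in> V" "f x = i" "f y = j" "{x, y} \<in> E"
        using adj[of i j] ij by auto
      have "Y l x = r l i" "Y l y = r l j" if "l \<in> {0, 1}" for l
        using const[OF xy(1) that] const[OF xy(2) that] xy by (simp_all add: r_def)
      then show ?thesis using counts[OF xy(5)] xy(3,4) by simp
    qed simp
    have bip: "bipart V (Y l) = bipart V (K4_rows f k)"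
      if l: "l \<in> {0, 1}" and h: "\<And>i. i < 4 \<Longrightarrow> (r l i \<noteq> r l 0) = (p k i \<noteq> p k 0)" for l k
    proof (rule bipart_up_to_compl)
      fix v assume v: "v \<in> V"
      show "(Y l v \<noteq> K4_rows f k v) = (r l 0 \<noteq> p k 0)"
        unfolding K const[OF v l] using h[OF f4[OF v]] by (auto simp: r_def)
    qed
    have "(0::nat) \<in> {..<4}" by simp
    from pair_rigid[OF pr this] show "q = q'"
    proof
      assume "\<forall>i\<in>{..<4}. (r 0 i \<noteq> r 0 0) = (p k0 i \<noteq> p k0 0) \<and> (r 1 i \<noteq> r 1 0) = (p k1 i \<noteq> p k1 0)"
      then have "bipart V (Y 0) = bipart V (K4_rows f k0)" "bipart V (Y 1) = bipart V (K4_rows f k1)"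
        using bip[of 0 k0] bip[of 1 k1] by auto
      then show ?thesis unfolding X Y row_monom_two k by simp
    next
      assume "\<forall>i\<in>{..<4}. (r 0 i \<noteq> r 0 0) = (p k1 i \<noteq> p k1 0) \<and> (r 1 i \<noteq> r 1 0) = (p k0 i \<noteq> p k0 0)"
      then have "bipart V (Y 0) = bipart V (K4_rows f k1)" "bipart V (Y 1) = bipart V (K4_rows f k0)"
        using bip[of 0 k1] bip[of 1 k0] by auto
      then show ?thesis unfolding X Y row_monom_two k by (simp add: add.commute)
    qed
  qed
qed

end

theorem corollary6p5:
  fixes G :: "'v graph"
    and S :: "('v set set, 'k::field) mpoly ring"
    and I :: "('v set set, 'k) mpoly set"
  assumes "simple_graph G"
    and "connected_graph G"
    and "G \<noteq> complete_graph (verts G)"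
    and "S = S_ring G"
    and "I = cut_ideal G"
  shows "has_min_generator_of_degree S I 2 \<and>
         ((\<exists>d. generated_in_degree S I d) \<longleftrightarrow> generated_in_degree S I 2) \<and>
         (generated_in_degree S I 2 \<longleftrightarrow> K4_minor_free G)"
proof -
  obtain V E where G: "G = (V, E)" by (cases G)
  have graph: "simple_graph (V, E)" and conn_graph: "connected_graph (V, E)" using assms(1,2) G by auto
  have s: "simple V E" by (rule simple_graph_simple[OF graph])
  have c: "conn E V" by (rule connected_graph_conn[OF s conn_graph])
  have "E \<noteq> edges (complete_graph V)" using assms(3) by (auto simp: G complete_graph_def)
  moreover have "E \<subseteq> edges (complete_graph V)" using graph by (simp add: simple_graph_def)
  ultimately obtain u v where uv: "u \<in> V" "v \<in> V" "u \<noteq> v" "{u, v} \<notin> E"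
    unfolding complete_graph_def by auto
  \<comment> \<open>A neighbour of \<open>u\<close> supplies both the edge that
    \<open>cut_graph\<close> demands and a third vertex, since \<open>v\<close> is not adjacent to
    \<open>u\<close>.\<close>
  have "\<exists>z. {u, z} \<in> E"
  proof (rule ccontr)
    assume "\<not> ?thesis"
    then have "{u} = V" using uv(1) by (intro connD[OF c, of _ u]) auto
    then show False using uv by blast
  qed
  then obtain z where uz: "{u, z} \<in> E" by blast
  have z: "z \<in> V" "z \<noteq> u" "z \<noteq> v" using simpleD[OF s uz] uz uv(4) by auto
  interpret cut_graph V E
    using graph conn_graph uz by unfold_locales auto
  have quadric: "toric_quadric (bipartitions V) \<psi> (cut_ideal (V, E) :: ('v set set, 'k) mpoly set)"
    by unfold_locales (use low_deg_unique quadric_of_nonadjacent[OF uv z] in blast)+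
  have I: "I = cut_ideal (V, E)" unfolding assms(5) G ..
  have S: "S = mpoly_ring (bipartitions V)" unfolding assms(4) G S_ring_def by simp
  have single: "(\<exists>d. generated_in_degree S I d) \<longleftrightarrow> generated_in_degree S I 2"
    unfolding S I using toric_quadric.generated_single_degree[OF quadric] by blast
  have "generated_in_degree S I 2" if "K4_minor_free G"
    unfolding S I
    using K4_minor_free_no_K4m[OF graph conn_graph] that quad_connected_no_K4m[OF finite_V s c]
    by (intro generated_if_quad_connected) (simp add: G)
  moreover have "\<not> generated_in_degree S I 2" if not_free: "\<not> K4_minor_free G"
  proof -
    obtain f :: "'v \<Rightarrow> nat" where "f ` V = {0..<4}" "\<And>i. i < 4 \<Longrightarrow> conn E {x \<in> V. f x = i}"
      "\<And>i j. i < 4 \<Longrightarrow> j < 4 \<Longrightarrow> i \<noteq> j \<Longrightarrow> \<exists>x \<in> V. \<exists>y \<in> V. f x = i \<and> f y = j \<and> {x, y} \<in> E"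
      using K4_minor_map[OF graph] not_free unfolding G by blast
    then show ?thesis unfolding S I by (rule not_generated_if_K4)
  qed
  ultimately show ?thesis
    using toric_quadric.has_quadratic_min_generator[OF quadric] single unfolding S I by blast
qed

end
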